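(* Let $p \geq 5$ be a prime, let $n \neq 1$ be a positive divisor of $p-1$, and let $F_{pn}$ be the Frobenius group of degree $p$ and order $pn$. Suppose that $F_{pn}$ has even order. Then there exists an irreducible polynomial $f \in \mathbb{Q}[x]$ of degree $p$ over $\mathbb{Q}$, having complex (i.e. non-real) roots, such that $\operatorname{Gal}(f/\mathbb{Q}) \cong F_{pn}$. Furthermore, the splitting field of $f$ (in $\mathbb{C}$) is $\mathbb{Q}(a, \mathbf{i}b)$ for every complex (i.e. non-real) root $a + \mathbf{i}b$ of $f$, where $a, b \in \mathbb{R}$ and $\mathbf{i} = \sqrt{-1}$.
   Context: For a prime $p$ and a divisor $n \neq 1$ of $p-1$, $F_{pn}$ denotes the group $\mathbb{F}_p \rtimes U$, where $U$ is the (cyclic) subgroup of order $n$ of $\mathbb{F}_p^{*}$ acting on the additive group $\mathbb{F}_p$ by multiplication; equivalently, $F_{pn}$ is the group of permutations $\zeta \mapsto \alpha\zeta + \beta$ of $\mathbb{F}_p$ with $\alpha \in U$, $\beta \in \mathbb{F}_p$. It is a Frobenius group of degree $p$, i.e. a transitive, non-regular permutation group on $p$ letters in which only the identity has more than one fixed point. "Complex root" means non-real root. $\operatorname{Gal}(f/\mathbb{Q})$ denotes the Galois group over $\mathbb{Q}$ of the splitting field of $f$ in $\mathbb{C}$. *)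

theory Defs
  imports
    Complex_Main
    "HOL-Computational_Algebra.Computational_Algebra"
    "HOL-Number_Theory.Residues"
    "HOL-Algebra.Bij"
    "HOL-Algebra.Generated_Fields"
    "HOL-Algebra.Algebraic_Closure_Type"
begin

hide_const (open) Divisibility.prime Divisibility.irreducible Polynomials.degree
  Ring_Divisibility.mult_of

section \<open>The Frobenius groups $F_{pn}$\<close>

definition frobenius_complement :: "nat \<Rightarrow> nat \<Rightarrow> int set" where
  "frobenius_complement p n =
     (THE U. subgroup U (mult_of (residue_ring (int p))) \<and> card U = n)"

lemma ex1_subgroup_of_card:
  assumes "prime p" "n dvd p - 1"
  shows "\<exists>!U. subgroup U (mult_of (residue_ring (int p))) \<and> card U = n"
proof -
  define R where "R = residue_ring (int p)"
  interpret R: residues_prime p R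
    using assms by unfold_locales (simp_all add: R_def)
  interpret G: group "mult_of R"
    by (rule R.field_mult_group)
  have finG: "finite (carrier (mult_of R))"
    by simp
  have order: "Coset.order (mult_of R) = p - 1"
    using R.order_mult_of by (simp add: Coset.order_def R.res_carrier_eq)
  have p1: "p - 1 > 0"
    using prime_gt_1_nat[OF assms(1)] by simp
  then have n0: "n \<noteq> 0" 
    using assms(2) by (metis dvd_0_left_iff less_numeral_extra(3))
  obtain a where a: "a \<in> carrier (mult_of R)"
      "carrier (mult_of R) = {a [^]\<^bsub>R\<^esub> i | i::nat. i \<in> UNIV}"
    using R.finite_field_mult_group_has_gen by auto
  have "carrier (mult_of R) = generate (mult_of R) {a}"
    using G.generate_pow_on_finite_carrier[OF finG a(1)] a(2)
    by (simp add: Multiplicative_Group.nat_pow_mult_of)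
  then have orda: "G.ord a = p - 1"
    using G.generate_pow_card[OF a(1)] order by (simp add: Coset.order_def)
  define b where "b = a [^]\<^bsub>mult_of R\<^esub> ((p - 1) div n)"
  have b: "b \<in> carrier (mult_of R)"
    unfolding b_def by (rule G.nat_pow_closed[OF a(1)])
  have "G.ord b = (p - 1) div ((p - 1) div n)"
    unfolding b_def using assms(2) p1 orda
    by (subst G.ord_pow[OF a(1)]) (auto simp: dvd_div_eq_0_iff)
  also have "\<dots> = n"
    using assms(2) p1 n0 by (metis dvd_div_mult_self dvd_triv_left nonzero_mult_div_cancel_left
        mult_eq_0_iff less_numeral_extra(3))
  finally have cardb: "card (generate (mult_of R) {b}) = n"
    using G.generate_pow_card[OF b] by simp
  have subb: "subgroup (generate (mult_of R) {b}) (mult_of R)"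
    by (rule G.generate_is_subgroup) (use b in auto)
  let ?S = "{x \<in> carrier R. x [^]\<^bsub>R\<^esub> n = \<one>\<^bsub>R\<^esub>}"
  have *: "U = ?S" if U: "subgroup U (mult_of R)" "card U = n" for U
  proof (rule card_seteq)
    show "finite ?S"
      by simp
    show "U \<subseteq> ?S"
    proof
      fix x assume x: "x \<in> U"
      interpret GU: group "(mult_of R)\<lparr>carrier := U\<rparr>"
        using U(1) by (rule G.subgroup_imp_group)
      have "x [^]\<^bsub>(mult_of R)\<lparr>carrier := U\<rparr>\<^esub> n = \<one>\<^bsub>mult_of R\<^esub>"
        using GU.pow_order_eq_1[of x] x U(2) by (simp add: Coset.order_def)
      then have "x [^]\<^bsub>mult_of R\<^esub> n = \<one>\<^bsub>mult_of R\<^esub>"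
        by (simp add: nat_pow_def)
      then show "x \<in> ?S"
        using subgroup.mem_carrier[OF U(1) x] by (simp add: Multiplicative_Group.nat_pow_mult_of)
    qed
    show "card ?S \<le> card U"
      using R.num_roots_le_deg[OF R.finite n0] U(2) by simp
  qed
  show ?thesis
    unfolding R_def[symmetric] using subb cardb * by metis
qed

lemma
  assumes "prime p" "n dvd p - 1"
  shows subgroup_frobenius_complement:
      "subgroup (frobenius_complement p n) (mult_of (residue_ring (int p)))"
    and card_frobenius_complement: "card (frobenius_complement p n) = n"
  using theI'[OF ex1_subgroup_of_card[OF assms]]
  by (simp_all add: frobenius_complement_def)

definition affine_map :: "nat \<Rightarrow> int \<Rightarrow> int \<Rightarrow> int \<Rightarrow> int" where
  "affine_map p \<alpha> \<beta> =
     (\<lambda>\<zeta>\<in>carrier (residue_ring (int p)).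
        \<alpha> \<otimes>\<^bsub>residue_ring (int p)\<^esub> \<zeta> \<oplus>\<^bsub>residue_ring (int p)\<^esub> \<beta>)"

definition frobenius_group :: "nat \<Rightarrow> nat \<Rightarrow> (int \<Rightarrow> int) monoid" where
  "frobenius_group p n =
     (BijGroup (carrier (residue_ring (int p))))
       \<lparr>carrier := {affine_map p \<alpha> \<beta> | \<alpha> \<beta>.
          \<alpha> \<in> frobenius_complement p n \<and> \<beta> \<in> carrier (residue_ring (int p))}\<rparr>"

lemma order_frobenius_group:
  assumes "prime p" "n dvd p - 1"
  shows "Coset.order (frobenius_group p n) = p * n"
proof -
  define R where "R = residue_ring (int p)"
  interpret R: residues_prime p R
    using assms by unfold_locales (simp_all add: R_def)
  let ?U = "frobenius_complement p n"
  have U: "x \<in> carrier R" if "x \<in> ?U" for x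
    using subgroup.mem_carrier[OF subgroup_frobenius_complement[OF assms] that]
    by (simp add: R_def)
  have "inj_on (\<lambda>(\<alpha>, \<beta>). affine_map p \<alpha> \<beta>) (?U \<times> carrier R)"
  proof (rule inj_onI, clarify)
    fix \<alpha> \<beta> \<gamma> \<delta>
    assume *: "\<alpha> \<in> ?U" "\<beta> \<in> carrier R" "\<gamma> \<in> ?U" "\<delta> \<in> carrier R"
      and eq: "affine_map p \<alpha> \<beta> = affine_map p \<gamma> \<delta>"
    have ev: "\<alpha> \<otimes>\<^bsub>R\<^esub> \<zeta> \<oplus>\<^bsub>R\<^esub> \<beta> = \<gamma> \<otimes>\<^bsub>R\<^esub> \<zeta> \<oplus>\<^bsub>R\<^esub> \<delta>"
      if "\<zeta> \<in> carrier R" for \<zeta>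
      using fun_cong[OF eq, of \<zeta>] that by (simp add: affine_map_def R_def)
    have "\<beta> = \<delta>"
      using ev[OF R.zero_closed] * U by simp
    moreover have "\<alpha> = \<gamma>"
      using ev[OF R.one_closed] * U \<open>\<beta> = \<delta>\<close> by simp
    ultimately show "\<alpha> = \<gamma> \<and> \<beta> = \<delta>"
      by simp
  qed
  moreover have "carrier (frobenius_group p n) =
      (\<lambda>(\<alpha>, \<beta>). affine_map p \<alpha> \<beta>) ` (?U \<times> carrier R)"
    by (auto simp: frobenius_group_def R_def)
  ultimately show ?thesis
    by (simp add: Coset.order_def card_image card_cartesian_product R.res_carrier_eq
        card_frobenius_complement[OF assms])
qed


section \<open>Subfields of the complex numbers and Galois groups\<close>

abbreviation complex_field :: "complex ring" where
  "complex_field \<equiv> ring_of_type_algebra"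

definition rat_adjoin :: "complex set \<Rightarrow> complex set" where
  "rat_adjoin S = generate_field complex_field (\<rat> \<union> S)"

abbreviation complex_poly :: "rat poly \<Rightarrow> complex poly" where
  "complex_poly f \<equiv> map_poly of_rat f"

definition splitting_field :: "rat poly \<Rightarrow> complex set" where
  "splitting_field f = rat_adjoin {z. poly (complex_poly f) z = 0}"

text \<open>
  Automorphisms of \<open>L\<close> are represented by functions that are \<open>undefined\<close> outside \<open>L\<close>, as in
  \<^const>\<open>BijGroup\<close>, so that each automorphism is counted once.
\<close>

definition galois_group :: "complex set \<Rightarrow> complex set \<Rightarrow> (complex \<Rightarrow> complex) monoid" where
  "galois_group L K =
     (BijGroup L)
       \<lparr>carrier := {\<sigma> \<in> Bij L.
          \<sigma> \<in> ring_hom (complex_field\<lparr>carrier := L\<rparr>) (complex_field\<lparr>carrier := L\<rparr>) \<and>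
          (\<forall>x\<in>K. \<sigma> x = x)}\<rparr>"

definition poly_galois_group :: "rat poly \<Rightarrow> (complex \<Rightarrow> complex) monoid" where
  "poly_galois_group f = galois_group (splitting_field f) \<rat>"

end

theory Submission
  imports Defs "HOL-Number_Theory.Residue_Primitive_Roots"
begin

text \<open>
  Since \<open>n\<close> is even, there are a modulus \<open>N\<close> divisible by \<open>p\<close> and a character \<open>\<chi>\<close> from the units modulo
  \<open>N\<close> onto the subgroup of order \<open>n\<close> of the units modulo \<open>p\<close> with \<open>\<chi> (-1) = -1\<close>. Let \<open>\<zeta>\<close> be a primitive
  \<open>N\<close>-th root of unity and twist \<open>\<chi>\<close> by the inverse of the cyclotomic character to get \<open>c\<close>. For a suitable
  integer \<open>a\<close>, the product \<open>\<theta>\<close> of the \<open>(a - \<zeta> ^ s) ^ c s\<close> is not a \<open>p\<close>-th power in the field generated by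
  \<open>\<zeta>\<close>, so adjoining \<open>\<beta>\<close> with \<open>\<beta> ^ p = \<theta>\<close> gives a Kummer extension of degree \<open>p\<close>, and the choice of \<open>c\<close>
  makes it Galois over the rationals. Let \<open>B j\<close> be the multiple of \<open>\<beta> ^ j\<close> in which the exponents of the
  radicals of \<open>a - \<zeta> ^ s\<close> are reduced modulo \<open>p\<close>. The Galois group acts on the sums
  \<open>\<alpha> k = (\<Sum>j<p. \<zeta>p ^ (j * k) * B j)\<close>, where \<open>\<zeta>p\<close> is a primitive \<open>p\<close>-th root of unity, exactly through the
  affine maps \<open>k \<mapsto> \<chi> t * k + b\<close>, and complex conjugation acts through \<open>k \<mapsto> b - k\<close>. Hence the
  polynomial with the roots \<open>\<alpha> k\<close> has the required Galois group and nonreal roots. An affine map fixing two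
  points is the identity, so any two roots generate the splitting field; apply this to a nonreal root and its
  conjugate.
\<close>

section \<open>Ring maps, polynomials and subfields of the complex numbers\<close>

text \<open>The twist is dictated by conjugation. An automorphism over
  \<open>\<zeta> \<mapsto> \<zeta> ^ t\<close> raises \<open>\<zeta>p\<close> to the power
  \<open>t\<close> and the class of \<open>\<theta>\<close> modulo \<open>p\<close>-th powers to the
  power \<open>ci t\<close>, the inverse of \<open>c t\<close>. Conjugating the translation
  \<open>\<beta> \<mapsto> \<zeta>p * \<beta>\<close> by it therefore gives its power
  \<open>t * c t\<close>, and this has to be \<open>\<chi> t\<close>. The value of
  \<open>\<chi>\<close> at -1 is the obstacle that shapes the construction: with value 1, complex
  conjugation would act as a translation of order at most 2, hence trivially, and all roots would be
  real. If \<open>(p - 1) / n\<close> is even, every character of order \<open>n\<close> modulo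
  \<open>p\<close> has this defect, so a second prime has to enter \<open>N\<close>; it is found
  explicitly among the prime factors of a number built from powers of 3. The field of
  \<open>\<zeta>\<close> and \<open>\<beta>\<close> may be larger than the splitting field, because
  \<open>\<chi>\<close> may have a kernel. Hence \<open>\<Gamma>\<close> is merely a set of ring
  maps acting through affine maps, and the Galois group is computed from the affine maps by means of
  a primitive element.\<close>

locale ring_map =
  fixes h :: "'a::comm_ring_1 \<Rightarrow> 'b::comm_ring_1"
  assumes map_add: "h (x + y) = h x + h y"
    and map_mult: "h (x * y) = h x * h y"
    and map_one: "h 1 = 1"
begin

lemma map_zero: "h 0 = 0"
  using map_add[of 0 0] by simp

lemma map_uminus: "h (- x) = - h x"
  using map_add[of x "- x"] by (simp add: map_zero add_eq_0_iff)

lemma map_diff: "h (x - y) = h x - h y"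
  using map_add[of x "- y"] by (simp add: map_uminus)

lemma map_power: "h (x ^ k) = h x ^ k"
  by (induction k) (simp_all add: map_one map_mult)

lemma map_sum: "h (sum f A) = (\<Sum>x\<in>A. h (f x))"
  by (induction A rule: infinite_finite_induct) (simp_all add: map_zero map_add)

lemma map_prod: "h (prod f A) = (\<Prod>x\<in>A. h (f x))"
  by (induction A rule: infinite_finite_induct) (simp_all add: map_one map_mult)

lemma map_of_nat: "h (of_nat k) = of_nat k"
  by (induction k) (simp_all add: map_zero map_one map_add)

lemma map_poly_pCons': "map_poly h (pCons a q) = pCons (h a) (map_poly h q)"
  by (simp add: map_poly_pCons map_zero)

lemma map_poly_monom': "map_poly h (monom a k) = monom (h a) k"
  by (simp add: map_poly_monom map_zero)

lemma coeff_map_poly': "coeff (map_poly h q) k = h (coeff q k)"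
  by (simp add: coeff_map_poly map_zero)

lemma poly_map_poly': "poly (map_poly h q) (h x) = h (poly q x)"
  by (induction q) (simp_all add: map_poly_pCons' map_zero map_add map_mult)

lemma map_poly_smult': "map_poly h (smult a q) = smult (h a) (map_poly h q)"
  by (rule poly_eqI) (simp add: coeff_map_poly' map_mult)

lemma ring_map_map_poly: "ring_map (map_poly h)"
proof
  show "map_poly h (q + r) = map_poly h q + map_poly h r" for q r
    by (rule poly_eqI) (simp add: coeff_map_poly' map_add)
  show "map_poly h (q * r) = map_poly h q * map_poly h r" for q r
    by (rule poly_eqI) (simp add: coeff_map_poly' coeff_mult map_sum map_mult)
  show "map_poly h 1 = 1"
    by (simp add: map_one)
qed

lemma ring_map_comp: "ring_map g \<Longrightarrow> ring_map (\<lambda>x. g (h x))"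
  by (simp add: ring_map_def map_add map_mult map_one)

end

lemma ring_map_poly: "ring_map (\<lambda>q. poly q z)"
  by standard simp_all

lemma ring_map_eval: "ring_map h \<Longrightarrow> ring_map (\<lambda>q. poly (map_poly h q) z)"
  using ring_map.ring_map_comp[OF ring_map.ring_map_map_poly ring_map_poly] .

interpretation rat: ring_map "of_rat :: rat \<Rightarrow> complex"
  by standard (simp_all add: of_rat_add of_rat_mult)

interpretation cpoly: ring_map complex_poly
  by (rule rat.ring_map_map_poly)

interpretation cint: ring_map "of_int :: int \<Rightarrow> complex"
  by standard simp_all

interpretation ipoly: ring_map "map_poly (of_int :: int \<Rightarrow> complex)"
  by (rule cint.ring_map_map_poly)

interpretation ratint: ring_map "of_int :: int \<Rightarrow> rat"
  by standard simp_all

lemma degree_complex_poly: "degree (complex_poly q) = degree q"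
  by (intro degree_map_poly) auto

lemma complex_poly_eq_0_iff: "complex_poly q = 0 \<longleftrightarrow> q = 0"
  by (intro map_poly_eq_0_iff) auto

lemma degree_of_int_poly: "degree (map_poly (of_int :: int \<Rightarrow> complex) q) = degree q"
  by (intro degree_map_poly) auto

lemma complex_poly_of_int_poly:
  "complex_poly (map_poly of_int q) = map_poly of_int q"
  by (simp add: map_poly_map_poly o_def)

lemma rational_coeffs_imp_complex_poly:
  assumes "\<And>k. coeff q k \<in> \<rat>"
  shows "\<exists>g. q = complex_poly g"
proof -
  define r where "r z = (if z = 0 then 0 else SOME x. z = complex_of_rat x)" for z
  have r: "of_rat (r z) = z" if "z \<in> \<rat>" for z
    using someI_ex[of "\<lambda>x. z = complex_of_rat x"] that
    by (auto simp: r_def elim: Rats_cases)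
  have "r 0 = 0"
    by (simp add: r_def)
  then have "q = complex_poly (map_poly r q)"
    by (intro poly_eqI) (simp add: coeff_map_poly r assms)
  then show ?thesis
    by blast
qed

lemma ex_int_poly_multiple:
  fixes g :: "rat poly"
  obtains d :: int and h :: "int poly" where "d > 0" "map_poly of_int h = smult (of_int d) g"
proof -
  have "\<exists>d h. d > 0 \<and> map_poly of_int h = smult (of_int d) g"
  proof (induction g)
    case 0
    show ?case
      by (rule exI[of _ 1], rule exI[of _ 0]) simp
  next
    case (pCons a g)
    then obtain d h where dh: "d > 0" "map_poly of_int h = smult (of_int d) g"
      by blast
    obtain u v where a: "a = of_int u / of_int v" "v > 0"
      by (metis quotient_of_denom_pos' quotient_of_div surjective_pairing)
    have "map_poly of_int (pCons (d * u) (smult v h)) = smult (of_int (d * v)) (pCons a g)"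
      using a by (simp add: ratint.map_poly_pCons' ratint.map_poly_smult' dh(2) mult_ac)
    with dh(1) a(2) show ?case
      by (metis mult_pos_pos)
  qed
  then show ?thesis
    using that by blast
qed

text \<open>Subtracting multiples of a monic \<open>B\<close> never divides by a leading
  coefficient, so all coefficients stay in \<open>S\<close>. The set form serves the field
  \<open>M\<close> of \<open>radical_linearly_independent\<close>, which is a subset of the complex
  numbers and not a type.\<close>

lemma monic_division:
  fixes A B :: "'a::comm_ring_1 poly"
  assumes S: "0 \<in> S" "\<And>x y. x \<in> S \<Longrightarrow> y \<in> S \<Longrightarrow> x + y \<in> S" "\<And>x y. x \<in> S \<Longrightarrow> y \<in> S \<Longrightarrow> x * y \<in> S"
      "\<And>x. x \<in> S \<Longrightarrow> - x \<in> S"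
    and B: "lead_coeff B = 1" "\<And>k. coeff B k \<in> S" "degree B > 0"
    and A: "\<And>k. coeff A k \<in> S"
  shows "\<exists>Q R. A = B * Q + R \<and> degree R < degree B \<and> (\<forall>k. coeff Q k \<in> S) \<and> (\<forall>k. coeff R k \<in> S)"
  using A
proof (induction "degree A" arbitrary: A rule: less_induct)
  case less
  show ?case
  proof (cases "degree A < degree B")
    case True
    have "A = B * 0 + A \<and> degree A < degree B \<and> (\<forall>k. coeff 0 k \<in> S) \<and> (\<forall>k. coeff A k \<in> S)"
      using True less.prems S(1) by simp
    then show ?thesis
      by blast
  next
    case False
    define c where "c = lead_coeff A"
    define T where "T = monom c (degree A - degree B)"
    define A' where "A' = A - B * T"
    have cS: "c \<in> S"
      unfolding c_def by (rule less.prems)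
    have TS: "coeff T k \<in> S" for k
      using cS S(1) by (simp add: T_def)
    have BT: "coeff (B * T) k \<in> S" for k
      using B(2) cS S(1,3) by (simp add: T_def mult.commute[of B] coeff_monom_mult)
    have A'S: "coeff A' k \<in> S" for k
      using S(2)[OF less.prems S(4)[OF BT]] by (simp add: A'_def)
    have "degree (B * T) \<le> degree A"
      using degree_mult_le[of B T] degree_monom_le[of c "degree A - degree B"] False
      by (simp add: T_def)
    then have le: "degree A' \<le> degree A"
      unfolding A'_def by (intro degree_diff_le) auto
    have "coeff A' (degree A) = 0"
      using False B(1) by (simp add: A'_def T_def c_def mult.commute[of B] coeff_monom_mult)
    then have "degree A' < degree A"
      using le B(3) False
      by (metis coeff_eq_0 degree_0 leading_coeff_0_iff nat_less_le not_less)
    from less.hyps[OF this A'S] obtain Q R where QR: "A' = B * Q + R" "degree R < degree B"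
        "\<forall>k. coeff Q k \<in> S" "\<forall>k. coeff R k \<in> S"
      by blast
    then have "A = B * (Q + T) + R"
      by (simp add: A'_def algebra_simps)
    moreover have "\<forall>k. coeff (Q + T) k \<in> S"
      using QR(3) TS S(2) by simp
    ultimately show ?thesis
      using QR by blast
  qed
qed

lemma monic_division':
  fixes A B :: "'a::comm_ring_1 poly"
  assumes "lead_coeff B = 1" "degree B > 0"
  obtains Q R where "A = B * Q + R" "degree R < degree B"
  using monic_division[of UNIV B A] assms by auto

section \<open>Subfields of the complex numbers generated over the rationals\<close>

lemma rat_adjoin_superset: "\<rat> \<union> T \<subseteq> rat_adjoin T"
  unfolding rat_adjoin_def by (auto intro: generate_field.incl)

lemma complex_field_simps:
  "carrier complex_field = UNIV" "x \<oplus>\<^bsub>complex_field\<^esub> y = x + y" "x \<otimes>\<^bsub>complex_field\<^esub> y = x * y"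
  "\<one>\<^bsub>complex_field\<^esub> = 1" "\<zero>\<^bsub>complex_field\<^esub> = 0" for x y :: complex
  by (simp_all add: ring_of_type_algebra_def)

lemma complex_field_minus: "\<ominus>\<^bsub>complex_field\<^esub> x = - x" for x :: complex
proof -
  interpret R: ring "complex_field :: complex ring"
    by (rule ring_from_type_algebra)
  show ?thesis
    by (rule R.minus_equality) (simp_all add: complex_field_simps)
qed

lemma complex_field_inv: "x \<noteq> 0 \<Longrightarrow> inv\<^bsub>complex_field\<^esub> x = inverse x" for x :: complex
proof -
  interpret R: cring "complex_field :: complex ring"
    by (rule cring_from_type_algebra)
  show "x \<noteq> 0 \<Longrightarrow> inv\<^bsub>complex_field\<^esub> x = inverse x"
    by (intro R.comm_inv_char) (simp_all add: complex_field_simps)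
qed

lemma rat_adjoin_closed:
  shows "x \<in> rat_adjoin T \<Longrightarrow> y \<in> rat_adjoin T \<Longrightarrow> x + y \<in> rat_adjoin T"
    and "x \<in> rat_adjoin T \<Longrightarrow> y \<in> rat_adjoin T \<Longrightarrow> x * y \<in> rat_adjoin T"
    and "x \<in> rat_adjoin T \<Longrightarrow> - x \<in> rat_adjoin T"
    and "x \<in> rat_adjoin T \<Longrightarrow> inverse x \<in> rat_adjoin T"
    and "x \<in> rat_adjoin T \<Longrightarrow> y \<in> rat_adjoin T \<Longrightarrow> x - y \<in> rat_adjoin T"
    and "x \<in> rat_adjoin T \<Longrightarrow> y \<in> rat_adjoin T \<Longrightarrow> x / y \<in> rat_adjoin T"
    and "q \<in> \<rat> \<Longrightarrow> q \<in> rat_adjoin T"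
proof -
  show add: "x \<in> rat_adjoin T \<Longrightarrow> y \<in> rat_adjoin T \<Longrightarrow> x + y \<in> rat_adjoin T" for x y
    unfolding rat_adjoin_def by (drule (1) generate_field.eng_add) (simp add: complex_field_simps)
  show mult: "x \<in> rat_adjoin T \<Longrightarrow> y \<in> rat_adjoin T \<Longrightarrow> x * y \<in> rat_adjoin T" for x y
    unfolding rat_adjoin_def by (drule (1) generate_field.eng_mult) (simp add: complex_field_simps)
  show minus: "x \<in> rat_adjoin T \<Longrightarrow> - x \<in> rat_adjoin T" for x
    unfolding rat_adjoin_def by (drule generate_field.a_inv) (simp add: complex_field_minus)
  show inverse: "x \<in> rat_adjoin T \<Longrightarrow> inverse x \<in> rat_adjoin T" for x
    unfolding rat_adjoin_def
    using generate_field.m_inv[of x complex_field "\<rat> \<union> T"]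
    by (cases "x = 0") (auto simp: complex_field_simps complex_field_inv)
  show "x \<in> rat_adjoin T \<Longrightarrow> y \<in> rat_adjoin T \<Longrightarrow> x - y \<in> rat_adjoin T"
    using add[of x "- y"] minus[of y] by simp
  show "x \<in> rat_adjoin T \<Longrightarrow> y \<in> rat_adjoin T \<Longrightarrow> x / y \<in> rat_adjoin T"
    using mult[of x "inverse y"] inverse[of y] by (simp add: field_simps)
  show "q \<in> \<rat> \<Longrightarrow> q \<in> rat_adjoin T"
    using rat_adjoin_superset by blast
qed

lemma rat_adjoin_induct [consumes 1, case_names rat incl uminus inverse add mult]:
  assumes "x \<in> rat_adjoin T"
    and "\<And>q. q \<in> \<rat> \<Longrightarrow> P q" "\<And>y. y \<in> T \<Longrightarrow> P y"
    and "\<And>y. y \<in> rat_adjoin T \<Longrightarrow> P y \<Longrightarrow> P (- y)"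
    and "\<And>y. y \<in> rat_adjoin T \<Longrightarrow> y \<noteq> 0 \<Longrightarrow> P y \<Longrightarrow> P (inverse y)"
    and "\<And>y z. y \<in> rat_adjoin T \<Longrightarrow> z \<in> rat_adjoin T \<Longrightarrow> P y \<Longrightarrow> P z \<Longrightarrow> P (y + z)"
    and "\<And>y z. y \<in> rat_adjoin T \<Longrightarrow> z \<in> rat_adjoin T \<Longrightarrow> P y \<Longrightarrow> P z \<Longrightarrow> P (y * z)"
  shows "P x"
  using assms(1) unfolding rat_adjoin_def
proof (induction rule: generate_field.induct)
  case one
  show ?case
    by (simp add: complex_field_simps assms(2))
next
  case (incl h)
  then show ?case
    using assms(2,3) by blast
next
  case (a_inv h)
  then show ?case
    using assms(4) by (simp add: complex_field_minus rat_adjoin_def)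
next
  case (m_inv h)
  then show ?case
    using assms(5) by (simp add: complex_field_inv complex_field_simps rat_adjoin_def)
next
  case (eng_add h1 h2)
  then show ?case
    using assms(6) by (simp add: complex_field_simps rat_adjoin_def)
next
  case (eng_mult h1 h2)
  then show ?case
    using assms(7) by (simp add: complex_field_simps rat_adjoin_def)
qed

lemma poly_in_rat_adjoin: "z \<in> rat_adjoin T \<Longrightarrow> poly (complex_poly g) z \<in> rat_adjoin T"
  by (induction g) (simp_all add: rat.map_poly_pCons' rat_adjoin_closed)

lemma rat_adjoin_mono: "T \<subseteq> rat_adjoin Y \<Longrightarrow> rat_adjoin T \<subseteq> rat_adjoin Y"
proof
  fix x
  assume "T \<subseteq> rat_adjoin Y" "x \<in> rat_adjoin T"
  show "x \<in> rat_adjoin Y"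
    using \<open>x \<in> rat_adjoin T\<close>
    by (induction rule: rat_adjoin_induct)
      (use \<open>T \<subseteq> rat_adjoin Y\<close> in \<open>auto intro: rat_adjoin_closed\<close>)
qed

text \<open>For \<open>m\<close> of least degree vanishing at \<open>z\<close>, the gcd of
  \<open>m\<close> and \<open>h\<close> does not vanish at \<open>z\<close>, so its cofactor in
  \<open>m\<close> does, and minimality makes the gcd constant. Bezout then gives the
  inverse.\<close>

lemma algebraic_inverse_is_poly:
  assumes "g \<noteq> 0" "poly (complex_poly g) z = 0" "poly (complex_poly h) z \<noteq> 0"
  shows "\<exists>k. poly (complex_poly k) z * poly (complex_poly h) z = 1"
proof -
  have "\<exists>g. g \<noteq> 0 \<and> poly (complex_poly g) z = 0"
    using assms by blast
  then obtain m where m: "m \<noteq> 0" "poly (complex_poly m) z = 0"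
      and min: "\<And>g. g \<noteq> 0 \<Longrightarrow> poly (complex_poly g) z = 0 \<Longrightarrow> degree m \<le> degree g"
    using ex_has_least_nat[of "\<lambda>g. g \<noteq> 0 \<and> poly (complex_poly g) z = 0" _ degree] by metis
  obtain a b where ab: "bezout_coefficients m h = (a, b)"
    by fastforce
  have "a * m + b * h = gcd m h"
    using bezout_coefficients[OF ab] .
  then have *: "poly (complex_poly b) z * poly (complex_poly h) z = poly (complex_poly (gcd m h)) z"
    using m(2) by (metis add_0 cpoly.map_add cpoly.map_mult mult_zero_right poly_add poly_mult)
  have h: "complex_poly h = complex_poly (gcd m h) * complex_poly (h div gcd m h)"
    by (simp flip: cpoly.map_mult)
  have nz: "poly (complex_poly (gcd m h)) z \<noteq> 0"
  proof
    assume "poly (complex_poly (gcd m h)) z = 0"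
    then have "poly (complex_poly h) z = 0"
      by (simp add: h)
    with assms(3) show False
      by simp
  qed
  have "degree (gcd m h) = 0"
  proof -
    have mm: "m = gcd m h * (m div gcd m h)"
      by simp
    then have "poly (complex_poly (gcd m h)) z * poly (complex_poly (m div gcd m h)) z = 0"
      using m(2) by (metis cpoly.map_mult poly_mult)
    moreover have "m div gcd m h \<noteq> 0"
      using mm m(1) by (metis mult_zero_right)
    ultimately have "degree m \<le> degree (m div gcd m h)"
      using nz by (intro min) simp_all
    moreover have "degree m = degree (gcd m h) + degree (m div gcd m h)"
      using mm m(1) by (metis degree_mult_eq mult_eq_0_iff)
    ultimately show ?thesis
      by simp
  qed
  then obtain c where c: "gcd m h = [:c:]"
    using degree_eq_zeroE by blast
  have "poly (complex_poly (smult (inverse c) b)) z * poly (complex_poly h) z = 1"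
    using * nz c by (simp add: rat.map_poly_smult' rat.map_poly_pCons' of_rat_divide field_simps)
  then show ?thesis
    by blast
qed

section \<open>The Frobenius group as a group of affine permutations\<close>

text \<open>Replaces the definite description by an explicit set: by Lagrange's theorem the subgroup
  lies among the roots of \<open>X ^ n - 1\<close>, of which a field has at most
  \<open>n\<close>.\<close>

lemma frobenius_complement_eq:
  assumes "prime p" "n dvd p - 1"
  shows "frobenius_complement p n = {x \<in> {1..int p - 1}. [x ^ n = 1] (mod int p)}"
proof -
  define R where "R = residue_ring (int p)"
  interpret R: residues_prime p R
    using assms by unfold_locales (simp_all add: R_def)
  interpret G: group "Multiplicative_Group.mult_of R"
    by (rule R.field_mult_group)
  define U where "U = frobenius_complement p n"
  let ?S = "{x \<in> carrier R. x [^]\<^bsub>R\<^esub> n = \<one>\<^bsub>R\<^esub>}"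
  have U: "subgroup U (Multiplicative_Group.mult_of R)" "card U = n"
    using subgroup_frobenius_complement[OF assms] card_frobenius_complement[OF assms]
    by (simp_all add: U_def R_def)
  have p1: "p > 1"
    using prime_gt_1_nat[OF assms(1)] .
  then have n0: "n \<noteq> 0"
    using assms(2) by (intro notI) simp
  have pow: "x [^]\<^bsub>R\<^esub> n = x ^ n mod int p" if "x \<in> carrier R" for x
    using R.pow_cong[of x n] that by (simp add: R.res_carrier_eq)
  have one: "\<one>\<^bsub>R\<^esub> = 1"
    by (simp add: R.res_one_eq)
  have "U = ?S"
  proof (rule card_seteq)
    show "finite ?S"
      by simp
    show "U \<subseteq> ?S"
    proof
      fix x assume x: "x \<in> U"
      interpret GU: group "(Multiplicative_Group.mult_of R)\<lparr>carrier := U\<rparr>"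
        using U(1) by (rule G.subgroup_imp_group)
      have "x [^]\<^bsub>(Multiplicative_Group.mult_of R)\<lparr>carrier := U\<rparr>\<^esub> n = \<one>\<^bsub>Multiplicative_Group.mult_of R\<^esub>"
        using GU.pow_order_eq_1[of x] x U(2) by (simp add: Coset.order_def)
      then have "x [^]\<^bsub>Multiplicative_Group.mult_of R\<^esub> n = \<one>\<^bsub>Multiplicative_Group.mult_of R\<^esub>"
        by (simp add: nat_pow_def)
      then show "x \<in> ?S"
        using subgroup.mem_carrier[OF U(1) x] by (simp add: Multiplicative_Group.nat_pow_mult_of)
    qed
    show "card ?S \<le> card U"
      using R.num_roots_le_deg[OF R.finite n0] U(2) by simp
  qed
  also have "?S = {x \<in> {1..int p - 1}. [x ^ n = 1] (mod int p)}"
  proof -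
    have "x \<in> carrier R \<and> x [^]\<^bsub>R\<^esub> n = \<one>\<^bsub>R\<^esub> \<longleftrightarrow> x \<in> {1..int p - 1} \<and> [x ^ n = 1] (mod int p)" for x
    proof (cases "x = 0")
      case True
      then show ?thesis
        using n0 p1 pow[of 0] by (auto simp: one R.res_carrier_eq power_0_left)
    next
      case False
      then show ?thesis
        using p1 pow[of x] by (auto simp: one R.res_carrier_eq Cong.cong_def)
    qed
    then show ?thesis
      by blast
  qed
  finally show ?thesis
    by (simp add: U_def)
qed

lemma eq_if_dvd_diff:
  fixes x y m :: int
  assumes "m dvd x - y" "x \<in> {0..m - 1}" "y \<in> {0..m - 1}"
  shows "x = y"
proof -
  have "x mod m = y mod m"
    using assms(1) by (simp add: mod_eq_dvd_iff)
  then show ?thesis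
    using assms(2,3) by simp
qed

context
  fixes p n :: nat
  assumes p: "prime p" and n: "n dvd p - 1"
begin

lemma affine_map_apply:
  "i \<in> {0..int p - 1} \<Longrightarrow> affine_map p a b i = (a * i + b) mod int p"
  by (simp add: affine_map_def residue_ring_def mod_add_left_eq)

lemma affine_map_extensional: "affine_map p a b \<in> extensional {0..int p - 1}"
  by (simp add: affine_map_def residue_ring_def)

lemma frobenius_group_carrier:
  "carrier (frobenius_group p n) =
     {affine_map p a b | a b. a \<in> frobenius_complement p n \<and> b \<in> {0..int p - 1}}"
  by (simp add: frobenius_group_def residue_ring_def)

lemma frobenius_complement_coprime:
  "a \<in> frobenius_complement p n \<Longrightarrow> \<not> int p dvd a"
  unfolding frobenius_complement_eq[OF p n] using zdvd_imp_le[of "int p" a] by force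

lemma affine_mem_frobenius:
  assumes "[a ^ n = 1] (mod int p)"
  shows "affine_map p (a mod int p) (b mod int p) \<in> carrier (frobenius_group p n)"
proof -
  have p1: "p > 1"
    using prime_gt_1_nat[OF p] .
  have n0: "n \<noteq> 0"
    using n p1 by (intro notI) simp
  have "\<not> int p dvd a"
  proof
    assume "int p dvd a"
    then have "int p dvd a ^ n"
      using n0 dvd_trans[OF _ dvd_power[of n a]] by blast
    then have "int p dvd 1"
      using assms cong_dvd_iff by blast
    then show False
      using p1 by simp
  qed
  then have "a mod int p \<noteq> 0"
    by auto
  then have "a mod int p \<ge> 1"
    using p1 pos_mod_sign[of "int p" a] by linarith
  moreover have "a mod int p < int p" "b mod int p \<ge> 0" "b mod int p < int p"
    using p1 by simp_all
  moreover have "[(a mod int p) ^ n = 1] (mod int p)"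
    using assms by (simp add: Cong.cong_def power_mod)
  ultimately have "a mod int p \<in> frobenius_complement p n" "b mod int p \<in> {0..int p - 1}"
    unfolding frobenius_complement_eq[OF p n] by auto
  then show ?thesis
    unfolding frobenius_group_carrier by blast
qed

lemma frobenius_memE:
  assumes "\<pi> \<in> carrier (frobenius_group p n)"
  obtains a b where "\<pi> = affine_map p a b" "[a ^ n = 1] (mod int p)" "\<not> int p dvd a"
    "a \<in> {0..int p - 1}" "b \<in> {0..int p - 1}"
proof -
  obtain a b where ab: "\<pi> = affine_map p a b" "a \<in> frobenius_complement p n" "b \<in> {0..int p - 1}"
    using assms unfolding frobenius_group_carrier by blast
  with frobenius_complement_coprime[OF ab(2)] show ?thesis
    using that[OF ab(1)] ab(2,3) unfolding frobenius_complement_eq[OF p n] by auto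
qed

text \<open>Two agreements give \<open>(a - c) * (i - j) = 0\<close> modulo \<open>p\<close>, so the
  slopes coincide. This rigidity is what lets two roots generate the whole splitting field.\<close>

lemma frobenius_eqI:
  assumes "\<pi> \<in> carrier (frobenius_group p n)" "\<pi>' \<in> carrier (frobenius_group p n)"
    and ij: "i \<in> {0..int p - 1}" "j \<in> {0..int p - 1}" "i \<noteq> j"
    and eq: "\<pi> i = \<pi>' i" "\<pi> j = \<pi>' j"
  shows "\<pi> = \<pi>'"
proof -
  obtain a b where ab: "\<pi> = affine_map p a b" "a \<in> {0..int p - 1}" "b \<in> {0..int p - 1}"
    using frobenius_memE[OF assms(1)] by metis
  obtain c d where cd: "\<pi>' = affine_map p c d" "c \<in> {0..int p - 1}" "d \<in> {0..int p - 1}"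
    using frobenius_memE[OF assms(2)] by metis
  have 1: "[a * i + b = c * i + d] (mod int p)" "[a * j + b = c * j + d] (mod int p)"
    using eq ij ab cd by (simp_all add: affine_map_apply Cong.cong_def)
  then have "[(a * i + b) - (a * j + b) = (c * i + d) - (c * j + d)] (mod int p)"
    by (rule cong_diff)
  then have "int p dvd (a - c) * (i - j)"
    by (simp add: cong_iff_dvd_diff algebra_simps)
  then have "int p dvd a - c \<or> int p dvd i - j"
    using p by (simp add: prime_dvd_mult_iff)
  then have "a = c"
    using ij ab(2) cd(2) eq_if_dvd_diff by blast
  with 1(1) have "int p dvd b - d"
    by (simp add: cong_iff_dvd_diff)
  then have "b = d"
    using eq_if_dvd_diff ab(3) cd(3) by blast
  with \<open>a = c\<close> ab(1) cd(1) show ?thesis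
    by simp
qed

lemma bij_affine_map:
  assumes "\<not> int p dvd a"
  shows "bij_betw (affine_map p a b) {0..int p - 1} {0..int p - 1}"
proof -
  have p1: "p > 1"
    using prime_gt_1_nat[OF p] .
  have into: "affine_map p a b ` {0..int p - 1} \<subseteq> {0..int p - 1}"
    using p1 by (auto simp: affine_map_apply)
  have "inj_on (affine_map p a b) {0..int p - 1}"
  proof (rule inj_onI)
    fix x y
    assume xy: "x \<in> {0..int p - 1}" "y \<in> {0..int p - 1}" "affine_map p a b x = affine_map p a b y"
    then have "[a * x + b = a * y + b] (mod int p)"
      by (simp add: affine_map_apply Cong.cong_def)
    then have "int p dvd a * (x - y)"
      by (simp add: cong_iff_dvd_diff algebra_simps)
    then have "int p dvd x - y"
      using assms p by (simp add: prime_dvd_mult_iff)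
    with xy show "x = y"
      using eq_if_dvd_diff by blast
  qed
  then show ?thesis
    using into by (simp add: bij_betw_def endo_inj_surj)
qed

lemma frobenius_bij:
  "\<pi> \<in> carrier (frobenius_group p n) \<Longrightarrow> bij_betw \<pi> {0..int p - 1} {0..int p - 1}"
  using bij_affine_map by (metis frobenius_memE)

lemma frobenius_Bij: "\<pi> \<in> carrier (frobenius_group p n) \<Longrightarrow> \<pi> \<in> Bij {0..int p - 1}"
  using frobenius_bij affine_map_extensional by (auto simp: Bij_def elim: frobenius_memE)

lemma frobenius_mult:
  assumes "\<pi> \<in> carrier (frobenius_group p n)" "\<pi>' \<in> carrier (frobenius_group p n)"
  shows "\<pi> \<otimes>\<^bsub>frobenius_group p n\<^esub> \<pi>' = compose {0..int p - 1} \<pi> \<pi>'"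
  using frobenius_Bij[OF assms(1)] frobenius_Bij[OF assms(2)]
  by (simp add: frobenius_group_def BijGroup_def residue_ring_def)

lemma frobenius_compose:
  assumes "\<pi> \<in> carrier (frobenius_group p n)" "\<pi>' \<in> carrier (frobenius_group p n)"
  shows "compose {0..int p - 1} \<pi> \<pi>' \<in> carrier (frobenius_group p n)"
proof -
  obtain a b where ab: "\<pi> = affine_map p a b" "[a ^ n = 1] (mod int p)"
    using frobenius_memE[OF assms(1)] by metis
  obtain c d where cd: "\<pi>' = affine_map p c d" "[c ^ n = 1] (mod int p)"
    using frobenius_memE[OF assms(2)] by metis
  have p1: "p > 1"
    using prime_gt_1_nat[OF p] .
  have "[(a * c) ^ n = 1] (mod int p)"
    using cong_mult[OF ab(2) cd(2)] by (simp add: power_mult_distrib)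
  then have "affine_map p ((a * c) mod int p) ((a * d + b) mod int p) \<in> carrier (frobenius_group p n)"
    by (rule affine_mem_frobenius)
  also have "affine_map p ((a * c) mod int p) ((a * d + b) mod int p) = compose {0..int p - 1} \<pi> \<pi>'"
  proof (rule extensionalityI[OF affine_map_extensional compose_extensional])
    fix x assume x: "x \<in> {0..int p - 1}"
    then have "(c * x + d) mod int p \<in> {0..int p - 1}"
      using p1 by simp
    moreover have "((a * c) mod int p * x + (a * d + b) mod int p) mod int p = (a * (c * x + d) + b) mod int p"
    proof -
      have "((a * c) mod int p * x + (a * d + b) mod int p) mod int p = (a * c * x + (a * d + b)) mod int p"
        unfolding Cong.cong_def[symmetric] by (intro cong_add cong_mult) simp_all
      also have "a * c * x + (a * d + b) = a * (c * x + d) + b"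
        by (simp add: algebra_simps)
      finally show ?thesis .
    qed
    moreover have "(a * ((c * x + d) mod int p) + b) mod int p = (a * (c * x + d) + b) mod int p"
      unfolding Cong.cong_def[symmetric] by (intro cong_add cong_mult) simp_all
    ultimately show "affine_map p ((a * c) mod int p) ((a * d + b) mod int p) x = compose {0..int p - 1} \<pi> \<pi>' x"
      using x by (simp add: compose_def affine_map_apply ab(1) cd(1))
  qed
  finally show ?thesis .
qed

lemma finite_frobenius: "finite (carrier (frobenius_group p n))"
proof -
  have "carrier (frobenius_group p n) \<subseteq> (\<lambda>(a, b). affine_map p a b) ` ({0..int p - 1} \<times> {0..int p - 1})"
    unfolding frobenius_group_carrier frobenius_complement_eq[OF p n] by auto
  then show ?thesis
    by (rule finite_subset) simp
qed

lemma frobenius_one: "(\<lambda>x\<in>{0..int p - 1}. x) \<in> carrier (frobenius_group p n)"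
proof -
  have p1: "p > 1"
    using prime_gt_1_nat[OF p] .
  have "affine_map p (1 mod int p) (0 mod int p) = (\<lambda>x\<in>{0..int p - 1}. x)"
    using p1 by (intro extensionalityI[OF affine_map_extensional]) (auto simp: affine_map_apply)
  moreover have "affine_map p (1 mod int p) (0 mod int p) \<in> carrier (frobenius_group p n)"
    by (rule affine_mem_frobenius) simp
  ultimately show ?thesis
    by simp
qed

text \<open>Left translation is injective on a finite set closed under composition, hence onto. This
  provides inverses and allows sums and products over the group to be reindexed.\<close>

lemma frobenius_compose_bij:
  assumes "\<pi> \<in> carrier (frobenius_group p n)"
  shows "bij_betw (compose {0..int p - 1} \<pi>) (carrier (frobenius_group p n)) (carrier (frobenius_group p n))"
proof -
  let ?F = "carrier (frobenius_group p n)" and ?I = "{0..int p - 1}"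
  have "inj_on (compose ?I \<pi>) ?F"
  proof (rule inj_onI)
    fix x y
    assume xy: "x \<in> ?F" "y \<in> ?F" "compose ?I \<pi> x = compose ?I \<pi> y"
    show "x = y"
    proof (rule extensionalityI)
      show "x \<in> extensional ?I" "y \<in> extensional ?I"
        using frobenius_Bij xy by (auto simp: Bij_def)
      fix i assume i: "i \<in> ?I"
      then have "\<pi> (x i) = \<pi> (y i)"
        using fun_cong[OF xy(3), of i] by (simp add: compose_def)
      moreover have "x i \<in> ?I" "y i \<in> ?I"
        using bij_betwE[OF frobenius_bij] xy(1,2) i by blast+
      ultimately show "x i = y i"
        using inj_onD[OF bij_betw_imp_inj_on[OF frobenius_bij[OF assms]]] by blast
    qed
  qed
  moreover have "compose ?I \<pi> ` ?F \<subseteq> ?F"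
    using frobenius_compose[OF assms] by auto
  ultimately show ?thesis
    by (simp add: bij_betw_def endo_inj_surj finite_frobenius)
qed

lemma frobenius_inverse:
  assumes "\<pi> \<in> carrier (frobenius_group p n)"
  obtains \<pi>' where "\<pi>' \<in> carrier (frobenius_group p n)"
    "\<And>i. i \<in> {0..int p - 1} \<Longrightarrow> \<pi> (\<pi>' i) = i" "\<And>i. i \<in> {0..int p - 1} \<Longrightarrow> \<pi>' (\<pi> i) = i"
proof -
  let ?I = "{0..int p - 1}"
  have "(\<lambda>x\<in>?I. x) \<in> compose ?I \<pi> ` carrier (frobenius_group p n)"
    using frobenius_one by (simp only: bij_betw_imp_surj_on[OF frobenius_compose_bij[OF assms]])
  then obtain \<pi>' where \<pi>': "\<pi>' \<in> carrier (frobenius_group p n)" "compose ?I \<pi> \<pi>' = (\<lambda>x\<in>?I. x)"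
    by (metis imageE)
  have 1: "\<pi> (\<pi>' i) = i" if "i \<in> ?I" for i
    using fun_cong[OF \<pi>'(2), of i] that by (simp add: compose_def)
  have "\<pi>' (\<pi> i) = i" if "i \<in> ?I" for i
  proof -
    have "\<pi> i \<in> ?I"
      using bij_betwE[OF frobenius_bij[OF assms]] that by blast
    moreover from this have "\<pi>' (\<pi> i) \<in> ?I"
      using bij_betwE[OF frobenius_bij[OF \<pi>'(1)]] by blast
    ultimately show ?thesis
      using 1[of "\<pi> i"] that inj_onD[OF bij_betw_imp_inj_on[OF frobenius_bij[OF assms]]] by blast
  qed
  with 1 \<pi>'(1) show ?thesis
    using that by blast
qed

lemma group_frobenius: "group (frobenius_group p n)"
proof -
  let ?I = "{0..int p - 1}"
  have eq: "frobenius_group p n = (BijGroup ?I)\<lparr>carrier := carrier (frobenius_group p n)\<rparr>"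
    by (simp add: frobenius_group_def residue_ring_def)
  have one: "\<one>\<^bsub>frobenius_group p n\<^esub> = (\<lambda>x\<in>?I. x)"
    by (simp add: frobenius_group_def BijGroup_def residue_ring_def)
  show ?thesis
  proof (rule groupI)
    fix x y z
    assume *: "x \<in> carrier (frobenius_group p n)" "y \<in> carrier (frobenius_group p n)"
      "z \<in> carrier (frobenius_group p n)"
    then show "x \<otimes>\<^bsub>frobenius_group p n\<^esub> y \<otimes>\<^bsub>frobenius_group p n\<^esub> z =
        x \<otimes>\<^bsub>frobenius_group p n\<^esub> (y \<otimes>\<^bsub>frobenius_group p n\<^esub> z)"
      using Bij_imp_funcset[OF frobenius_Bij[OF *(3)]]
      by (simp add: frobenius_mult frobenius_compose compose_assoc)
  next
    fix x assume x: "x \<in> carrier (frobenius_group p n)"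
    then show "\<one>\<^bsub>frobenius_group p n\<^esub> \<otimes>\<^bsub>frobenius_group p n\<^esub> x = x"
      using Bij_imp_funcset[OF frobenius_Bij[OF x]] Bij_imp_extensional[OF frobenius_Bij[OF x]]
      by (simp add: one frobenius_mult frobenius_one Id_compose)
    obtain y where y: "y \<in> carrier (frobenius_group p n)"
        "\<And>i. i \<in> ?I \<Longrightarrow> x (y i) = i" "\<And>i. i \<in> ?I \<Longrightarrow> y (x i) = i"
      using frobenius_inverse[OF x] by metis
    then have "y \<otimes>\<^bsub>frobenius_group p n\<^esub> x = \<one>\<^bsub>frobenius_group p n\<^esub>"
      using x unfolding frobenius_mult[OF y(1) x] one compose_def by (intro restrict_ext) simp
    with y(1) show "\<exists>y\<in>carrier (frobenius_group p n). y \<otimes>\<^bsub>frobenius_group p n\<^esub> x = \<one>\<^bsub>frobenius_group p n\<^esub>"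
      by blast
  qed (simp_all add: one frobenius_one frobenius_mult frobenius_compose)
qed

lemma frobenius_transitive:
  assumes "i \<in> {0..int p - 1}" "j \<in> {0..int p - 1}"
  obtains \<pi> where "\<pi> \<in> carrier (frobenius_group p n)" "\<pi> i = j"
proof -
  have p1: "p > 1"
    using prime_gt_1_nat[OF p] .
  have "affine_map p (1 mod int p) ((j - i) mod int p) \<in> carrier (frobenius_group p n)"
    by (rule affine_mem_frobenius) simp
  moreover have "affine_map p (1 mod int p) ((j - i) mod int p) i = j"
    using p1 assms by (simp add: affine_map_apply mod_simps)
  ultimately show ?thesis
    using that by blast
qed

end

section \<open>Galois theory of an affine action on the roots\<close>

text \<open>
  Elements of the Galois extension are represented in a ring \<open>'r\<close>: \<open>ev e r\<close> is the number represented by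
  \<open>r\<close> and \<open>ev \<gamma> r\<close> is its image under the automorphism \<open>\<gamma>\<close>. In this way the automorphisms are total ring
  maps and can be applied to coefficients of polynomials.
\<close>

locale frobenius_action =
  fixes p n :: nat
    and \<Gamma> :: "'g set" and e :: 'g
    and ev :: "'g \<Rightarrow> 'r::comm_ring_1 \<Rightarrow> complex"
    and emb :: "rat \<Rightarrow> 'r"
    and A :: "int \<Rightarrow> 'r"
    and act :: "'g \<Rightarrow> int \<Rightarrow> int"
  assumes p: "prime p" and p3: "p \<ge> 3" and n: "n dvd p - 1"
    and e: "e \<in> \<Gamma>"
    and ring_map_emb: "ring_map emb"
    and ring_map_ev: "\<gamma> \<in> \<Gamma> \<Longrightarrow> ring_map (ev \<gamma>)"
    and ev_emb: "\<gamma> \<in> \<Gamma> \<Longrightarrow> ev \<gamma> (emb q) = of_rat q"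
    and ev_zero: "\<gamma> \<in> \<Gamma> \<Longrightarrow> ev e r = 0 \<Longrightarrow> ev \<gamma> r = 0"
    and ev_invariant: "(\<And>\<gamma>. \<gamma> \<in> \<Gamma> \<Longrightarrow> ev \<gamma> r = ev e r) \<Longrightarrow> ev e r \<in> \<rat>"
    and act_mem: "\<gamma> \<in> \<Gamma> \<Longrightarrow> act \<gamma> \<in> carrier (frobenius_group p n)"
    and ev_act: "\<gamma> \<in> \<Gamma> \<Longrightarrow> i \<in> {0..int p - 1} \<Longrightarrow> ev \<gamma> (A i) = ev e (A (act \<gamma> i))"
    and act_surj: "\<pi> \<in> carrier (frobenius_group p n) \<Longrightarrow> \<exists>\<gamma>\<in>\<Gamma>. act \<gamma> = \<pi>"
    and inj: "inj_on (\<lambda>i. ev e (A i)) {0..int p - 1}"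
    and conj_act: "\<exists>\<pi>\<in>carrier (frobenius_group p n).
      (\<exists>i\<in>{0..int p - 1}. \<pi> i \<noteq> i) \<and> (\<forall>i\<in>{0..int p - 1}. cnj (ev e (A i)) = ev e (A (\<pi> i)))"
begin

section \<open>The rational polynomial whose roots are permuted\<close>

definition I :: "int set" where "I = {0..int p - 1}"
definition F :: "(int \<Rightarrow> int) set" where "F = carrier (frobenius_group p n)"
definition \<alpha> :: "int \<Rightarrow> complex" where "\<alpha> i = ev e (A i)"

lemmas ring_map_ev_e = ring_map_ev[OF e]

lemma finite_I: "finite I" and card_I: "card I = p"
  by (simp_all add: I_def)

lemma finite_F: "finite F"
  using finite_frobenius[OF p n] by (simp add: F_def)

lemma act_F: "\<gamma> \<in> \<Gamma> \<Longrightarrow> act \<gamma> \<in> F"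
  using act_mem by (simp add: F_def)

lemma F_bij: "\<pi> \<in> F \<Longrightarrow> bij_betw \<pi> I I"
  using frobenius_bij[OF p n] by (simp add: F_def I_def)

lemma F_I: "\<pi> \<in> F \<Longrightarrow> i \<in> I \<Longrightarrow> \<pi> i \<in> I"
  using bij_betwE[OF F_bij] by blast

lemma ev_A: "\<gamma> \<in> \<Gamma> \<Longrightarrow> i \<in> I \<Longrightarrow> ev \<gamma> (A i) = \<alpha> (act \<gamma> i)"
  using ev_act by (simp add: \<alpha>_def I_def)

lemma \<alpha>_inj: "i \<in> I \<Longrightarrow> j \<in> I \<Longrightarrow> \<alpha> i = \<alpha> j \<longleftrightarrow> i = j"
  using inj unfolding inj_on_def \<alpha>_def I_def by blast

text \<open>The hypothesis says that \<open>g\<close> evaluated at \<open>r\<close> inside the ring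
  \<open>'r\<close> represents 0; \<open>ev_zero\<close> carries this to every
  \<open>\<gamma>\<close>.\<close>

lemma conjugate_root:
  assumes "poly (complex_poly g) (ev e r) = 0" "\<gamma> \<in> \<Gamma>"
  shows "poly (complex_poly g) (ev \<gamma> r) = 0"
proof -
  have "poly (complex_poly g) (ev \<delta> r) = ev \<delta> (poly (map_poly emb g) r)" if "\<delta> \<in> \<Gamma>" for \<delta>
  proof -
    interpret E: ring_map emb
      by (rule ring_map_emb)
    interpret ring_map "ev \<delta>"
      using that by (rule ring_map_ev)
    have "map_poly (ev \<delta>) (map_poly emb g) = complex_poly g"
      using that by (intro poly_eqI) (simp add: coeff_map_poly' E.coeff_map_poly' rat.coeff_map_poly' ev_emb)
    then show ?thesis
      by (metis poly_map_poly')
  qed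
  then show ?thesis
    using assms ev_zero e by simp
qed

text \<open>The descent to rational coefficients used for all polynomials below:
  \<open>ev_invariant\<close> is applied to each coefficient.\<close>

lemma invariant_poly:
  assumes "\<And>\<gamma>. \<gamma> \<in> \<Gamma> \<Longrightarrow> map_poly (ev \<gamma>) Q = map_poly (ev e) Q"
  shows "\<exists>g. map_poly (ev e) Q = complex_poly g"
proof (rule rational_coeffs_imp_complex_poly)
  fix k
  have "ev e (coeff Q k) \<in> \<rat>"
  proof (rule ev_invariant)
    fix \<gamma> assume "\<gamma> \<in> \<Gamma>"
    then show "ev \<gamma> (coeff Q k) = ev e (coeff Q k)"
      using assms ring_map.coeff_map_poly'[OF ring_map_ev] e by metis
  qed
  then show "coeff (map_poly (ev e) Q) k \<in> \<rat>"
    by (simp add: ring_map.coeff_map_poly'[OF ring_map_ev_e])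
qed

lemma ex_root_poly: "\<exists>f. complex_poly f = (\<Prod>i\<in>I. [:- \<alpha> i, 1:])"
proof -
  define Q where "Q = (\<Prod>i\<in>I. [:- A i, 1:])"
  have ev: "map_poly (ev \<gamma>) Q = (\<Prod>i\<in>I. [:- ev \<gamma> (A i), 1:])" if "\<gamma> \<in> \<Gamma>" for \<gamma>
  proof -
    interpret ring_map "ev \<gamma>"
      using that by (rule ring_map_ev)
    interpret P: ring_map "map_poly (ev \<gamma>)"
      by (rule ring_map_map_poly)
    show ?thesis
      by (simp add: Q_def P.map_prod map_poly_pCons' map_uminus map_one)
  qed
  have "map_poly (ev \<gamma>) Q = map_poly (ev e) Q" if "\<gamma> \<in> \<Gamma>" for \<gamma>
  proof -
    have "map_poly (ev \<gamma>) Q = (\<Prod>i\<in>I. [:- \<alpha> (act \<gamma> i), 1:])"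
      using ev[OF that] ev_A[OF that] by simp
    also have "\<dots> = (\<Prod>i\<in>I. [:- \<alpha> i, 1:])"
      by (rule prod.reindex_bij_betw[OF F_bij[OF act_F[OF that]]])
    finally show ?thesis
      using ev[OF e] by (simp add: \<alpha>_def)
  qed
  then obtain g where "map_poly (ev e) Q = complex_poly g"
    using invariant_poly by blast
  then show ?thesis
    using ev[OF e] by (auto simp: \<alpha>_def)
qed

definition f :: "rat poly" where "f = (SOME f. complex_poly f = (\<Prod>i\<in>I. [:- \<alpha> i, 1:]))"

lemma f: "complex_poly f = (\<Prod>i\<in>I. [:- \<alpha> i, 1:])"
  unfolding f_def by (rule someI_ex[OF ex_root_poly])

lemma f_root_iff: "poly (complex_poly f) z = 0 \<longleftrightarrow> z \<in> \<alpha> ` I"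
  by (auto simp: f poly_prod finite_I prod_zero_iff)

lemma degree_f: "degree f = p"
proof -
  have "degree (complex_poly f) = p"
    unfolding f by (subst degree_prod_eq_sum_degree) (simp_all add: card_I)
  then show ?thesis
    by (simp add: degree_complex_poly)
qed

text \<open>By transitivity a rational polynomial vanishing at one root vanishes at all
  \<open>p\<close> of them; if nonzero it has degree at least \<open>p\<close>, which leaves degree
  0 for the other factor.\<close>

lemma irreducible_f: "irreducible f"
proof (rule Factorial_Ring.irreducibleI)
  show "f \<noteq> 0"
    using degree_f p3 by auto
  show "\<not> is_unit f"
    using degree_f p3 by (simp add: is_unit_iff_degree \<open>f \<noteq> 0\<close>)
  fix a b assume ab: "f = a * b"
  then have nz: "a \<noteq> 0" "b \<noteq> 0"
    using \<open>f \<noteq> 0\<close> by auto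
  have "0 \<in> I"
    using p3 by (simp add: I_def)
  have big: "degree c \<ge> p" if c: "c \<noteq> 0" "poly (complex_poly c) (\<alpha> 0) = 0" for c
  proof -
    have "poly (complex_poly c) (\<alpha> i) = 0" if i: "i \<in> I" for i
    proof -
      obtain \<pi> where "\<pi> \<in> carrier (frobenius_group p n)" "\<pi> 0 = i"
        using frobenius_transitive[OF p n] \<open>0 \<in> I\<close> i unfolding I_def by metis
      then obtain \<gamma> where \<gamma>: "\<gamma> \<in> \<Gamma>" "act \<gamma> 0 = i"
        using act_surj by metis
      then show ?thesis
        using conjugate_root[OF _ \<gamma>(1), of c "A 0"] c(2) ev_A[OF \<gamma>(1) \<open>0 \<in> I\<close>]
        by (simp add: \<alpha>_def)
    qed
    then have "\<alpha> ` I \<subseteq> {z. poly (complex_poly c) z = 0}"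
      by auto
    then have "card (\<alpha> ` I) \<le> card {z. poly (complex_poly c) z = 0}"
      using c(1) by (intro card_mono poly_roots_finite) (simp_all add: complex_poly_eq_0_iff)
    also have "\<dots> \<le> degree (complex_poly c)"
      using c(1) by (intro card_poly_roots_bound) (simp add: complex_poly_eq_0_iff)
    also have "card (\<alpha> ` I) = p"
      using \<alpha>_inj by (subst card_image) (auto simp: inj_on_def card_I)
    finally show ?thesis
      by (simp add: degree_complex_poly)
  qed
  have "poly (complex_poly f) (\<alpha> 0) = 0"
    using \<open>0 \<in> I\<close> by (auto simp: f_root_iff)
  then have "poly (complex_poly a) (\<alpha> 0) = 0 \<or> poly (complex_poly b) (\<alpha> 0) = 0"
    by (simp add: ab cpoly.map_mult)
  then have "degree a \<ge> p \<or> degree b \<ge> p"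
    using big nz by blast
  moreover have "degree a + degree b = p"
    using degree_f nz by (simp add: ab degree_mult_eq)
  ultimately have "degree b = 0 \<or> degree a = 0"
    by linarith
  then show "is_unit a \<or> is_unit b"
    using nz by (auto simp: is_unit_iff_degree)
qed

text \<open>A coincidence between permutations that differ at \<open>j\<close> determines
  \<open>k\<close>, so finitely many pairs exclude finitely many \<open>k\<close>. Permutations that
  agree at \<open>j\<close> must then agree at \<open>i\<close> as well and are equal.\<close>

lemma ex_separating_multiplier:
  assumes "i \<in> I" "j \<in> I" "i \<noteq> j"
  shows "\<exists>k::nat. inj_on (\<lambda>\<pi>. \<alpha> (\<pi> i) + of_nat k * \<alpha> (\<pi> j)) F"
proof -
  \<comment> \<open>Pairs that agree at \<open>j\<close> contribute the value 0 of a division by 0,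
    which only excludes \<open>k = 0\<close>.\<close>
  define Bad where "Bad = (\<lambda>(\<pi>, \<pi>'). (\<alpha> (\<pi> i) - \<alpha> (\<pi>' i)) / (\<alpha> (\<pi>' j) - \<alpha> (\<pi> j))) ` (F \<times> F)"
  have "finite Bad"
    unfolding Bad_def using finite_F by simp
  moreover have "infinite (range (of_nat :: nat \<Rightarrow> complex))"
    by (rule range_inj_infinite) (simp add: inj_on_def)
  ultimately obtain k where k: "of_nat k \<notin> Bad"
    by (metis finite_subset image_subsetI)
  have "inj_on (\<lambda>\<pi>. \<alpha> (\<pi> i) + of_nat k * \<alpha> (\<pi> j)) F"
  proof (rule inj_onI)
    fix \<pi> \<pi>' assume *: "\<pi> \<in> F" "\<pi>' \<in> F" "\<alpha> (\<pi> i) + of_nat k * \<alpha> (\<pi> j) = \<alpha> (\<pi>' i) + of_nat k * \<alpha> (\<pi>' j)"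
    have "\<pi> j = \<pi>' j"
    proof (rule ccontr)
      assume "\<pi> j \<noteq> \<pi>' j"
      then have "\<alpha> (\<pi>' j) - \<alpha> (\<pi> j) \<noteq> 0"
        using \<alpha>_inj F_I *(1,2) assms by simp
      moreover have "of_nat k * (\<alpha> (\<pi>' j) - \<alpha> (\<pi> j)) = \<alpha> (\<pi> i) - \<alpha> (\<pi>' i)"
        using *(3) by (simp add: algebra_simps)
      ultimately have "of_nat k = (\<alpha> (\<pi> i) - \<alpha> (\<pi>' i)) / (\<alpha> (\<pi>' j) - \<alpha> (\<pi> j))"
        by (simp add: field_simps)
      then have "of_nat k \<in> Bad"
        unfolding Bad_def using *(1,2) by (intro image_eqI[of _ _ "(\<pi>, \<pi>')"]) auto
      with k show False ..
    qed
    with *(3) have "\<pi> i = \<pi>' i"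
      using \<alpha>_inj F_I *(1,2) assms by simp
    with \<open>\<pi> j = \<pi>' j\<close> show "\<pi> = \<pi>'"
      using frobenius_eqI[OF p n] *(1,2) assms unfolding F_def I_def by blast
  qed
  then show ?thesis
    by blast
qed

text \<open>
  Lagrange interpolation at the conjugates of a generic combination of two roots shows that this
  combination generates the splitting field.
\<close>

lemma ex_interpolation:
  fixes c :: "(int \<Rightarrow> int) \<Rightarrow> 'r"
  assumes ij: "i \<in> I" "j \<in> I"
    and \<delta>: "inj_on \<delta> F" "\<And>\<pi>. \<delta> \<pi> = \<alpha> (\<pi> i) + of_nat k * \<alpha> (\<pi> j)"
    and c: "\<And>\<gamma> \<pi>. \<gamma> \<in> \<Gamma> \<Longrightarrow> \<pi> \<in> F \<Longrightarrow> ev \<gamma> (c \<pi>) = ev e (c (compose I (act \<gamma>) \<pi>))"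
  shows "\<exists>g. \<forall>\<pi>\<in>F. poly (complex_poly g) (\<delta> \<pi>) = ev e (c \<pi>) * (\<Prod>\<pi>'\<in>F - {\<pi>}. \<delta> \<pi> - \<delta> \<pi>')"
proof -
  define D where "D \<pi> = A (\<pi> i) + of_nat k * A (\<pi> j)" for \<pi>
  define Q where "Q = (\<Sum>\<pi>\<in>F. smult (c \<pi>) (\<Prod>\<pi>'\<in>F - {\<pi>}. [:- D \<pi>', 1:]))"
  define G where "G \<pi> = smult (ev e (c \<pi>)) (\<Prod>\<pi>'\<in>F - {\<pi>}. [:- \<delta> \<pi>', 1:])" for \<pi>
  have ev_D: "ev \<gamma> (D \<pi>) = \<delta> (compose I (act \<gamma>) \<pi>)" if "\<gamma> \<in> \<Gamma>" "\<pi> \<in> F" for \<gamma> \<pi>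
  proof -
    interpret ring_map "ev \<gamma>"
      using that(1) by (rule ring_map_ev)
    show ?thesis
      using that ij F_I
      by (simp add: D_def \<delta>(2) map_add map_mult map_of_nat ev_A compose_def)
  qed
  have ev_Q: "map_poly (ev \<gamma>) Q = (\<Sum>\<pi>\<in>F. G \<pi>)" if \<gamma>: "\<gamma> \<in> \<Gamma>" for \<gamma>
  proof -
    interpret ring_map "ev \<gamma>"
      using that(1) by (rule ring_map_ev)
    interpret P: ring_map "map_poly (ev \<gamma>)"
      by (rule ring_map_map_poly)
    \<comment> \<open>Applying \<open>\<gamma>\<close> translates the index by
      \<open>act \<gamma>\<close>. As the sum runs over the whole group, \<open>Q\<close> is
      invariant.\<close>
    define h where "h = compose I (act \<gamma>)"
    have h: "bij_betw h F F"
      unfolding h_def F_def I_def using frobenius_compose_bij[OF p n act_mem[OF \<gamma>]] .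
    have "map_poly (ev \<gamma>) Q =
        (\<Sum>\<pi>\<in>F. smult (ev \<gamma> (c \<pi>)) (\<Prod>\<pi>'\<in>F - {\<pi>}. [:- ev \<gamma> (D \<pi>'), 1:]))"
      by (simp add: Q_def P.map_sum map_poly_smult' P.map_prod map_poly_pCons' map_uminus map_one)
    also have "\<dots> = (\<Sum>\<pi>\<in>F. smult (ev e (c (h \<pi>))) (\<Prod>\<pi>'\<in>F - {\<pi>}. [:- \<delta> (h \<pi>'), 1:]))"
      using ev_D[OF \<gamma>] c[OF \<gamma>] by (simp add: h_def)
    also have "\<dots> = (\<Sum>\<pi>\<in>F. G (h \<pi>))"
    proof (rule sum.cong[OF refl])
      fix \<pi> assume "\<pi> \<in> F"
      then have "bij_betw h (F - {\<pi>}) (F - {h \<pi>})"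
        using h by (intro bij_betw_DiffI) (auto simp: bij_betw_def)
      then have "(\<Prod>\<pi>'\<in>F - {\<pi>}. [:- \<delta> (h \<pi>'), 1:]) = (\<Prod>\<pi>'\<in>F - {h \<pi>}. [:- \<delta> \<pi>', 1:])"
        by (rule prod.reindex_bij_betw)
      then show "smult (ev e (c (h \<pi>))) (\<Prod>\<pi>'\<in>F - {\<pi>}. [:- \<delta> (h \<pi>'), 1:]) = G (h \<pi>)"
        by (simp add: G_def)
    qed
    also have "\<dots> = (\<Sum>\<pi>\<in>F. G \<pi>)"
      by (rule sum.reindex_bij_betw[OF h])
    finally show ?thesis .
  qed
  then obtain g where g: "complex_poly g = (\<Sum>\<pi>\<in>F. G \<pi>)"
    using invariant_poly[of Q] e by metis
  have "poly (complex_poly g) (\<delta> \<pi>) = ev e (c \<pi>) * (\<Prod>\<pi>'\<in>F - {\<pi>}. \<delta> \<pi> - \<delta> \<pi>')" if \<pi>: "\<pi> \<in> F" for \<pi>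
  proof -
    have "poly (G \<pi>') (\<delta> \<pi>) = 0" if "\<pi>' \<in> F - {\<pi>}" for \<pi>'
      using that \<pi> finite_F by (auto simp: G_def poly_prod intro!: bexI[of _ \<pi>])
    then have "poly (complex_poly g) (\<delta> \<pi>) = poly (G \<pi>) (\<delta> \<pi>)"
      using \<pi> finite_F by (simp add: g poly_sum sum.remove)
    then show ?thesis
      by (simp add: G_def poly_prod algebra_simps)
  qed
  then show ?thesis
    by blast
qed

text \<open>The same polynomial \<open>G l\<close> recovers \<open>\<alpha> (\<pi> l)\<close> from
  \<open>\<delta> \<pi>\<close> for every \<open>\<pi>\<close>. This uniformity later turns the
  substitution of \<open>\<delta> \<pi>\<close> for the generator into an automorphism.\<close>

lemma primitive_element:
  assumes ij: "i \<in> I" "j \<in> I" "i \<noteq> j"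
  shows "\<exists>G \<delta> P. \<exists>k::nat. (\<forall>\<pi>\<in>F. \<forall>l\<in>I. \<alpha> (\<pi> l) = poly (complex_poly (G l)) (\<delta> \<pi>)) \<and>
    (\<forall>z. poly (complex_poly P) z = 0 \<longleftrightarrow> z \<in> \<delta> ` F) \<and>
    (\<forall>g. \<forall>\<pi>\<in>F. poly (complex_poly g) (\<delta> (\<lambda>x\<in>I. x)) = 0 \<longrightarrow> poly (complex_poly g) (\<delta> \<pi>) = 0) \<and>
    (\<forall>\<pi>. \<delta> \<pi> = \<alpha> (\<pi> i) + of_nat k * \<alpha> (\<pi> j))"
proof -
  obtain k :: nat where k: "inj_on (\<lambda>\<pi>. \<alpha> (\<pi> i) + of_nat k * \<alpha> (\<pi> j)) F"
    using ex_separating_multiplier[OF ij] by blast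
  define \<delta> where "\<delta> \<pi> = \<alpha> (\<pi> i) + of_nat k * \<alpha> (\<pi> j)" for \<pi>
  have \<delta>: "inj_on \<delta> F"
    using k by (simp add: \<delta>_def[abs_def])
  define one where "one = (\<lambda>x\<in>I. x)"
  have one: "one \<in> F"
    using frobenius_one[OF p n] by (simp add: one_def F_def I_def)
  have conj: "poly (complex_poly g) (\<delta> \<pi>) = 0" if "poly (complex_poly g) (\<delta> one) = 0" "\<pi> \<in> F" for g \<pi>
  proof -
    obtain \<gamma> where \<gamma>: "\<gamma> \<in> \<Gamma>" "act \<gamma> = \<pi>"
      using act_surj \<open>\<pi> \<in> F\<close> F_def by blast
    have "ev \<delta>' (A i + of_nat k * A j) = \<alpha> (act \<delta>' i) + of_nat k * \<alpha> (act \<delta>' j)" if "\<delta>' \<in> \<Gamma>" for \<delta>'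
    proof -
      interpret ring_map "ev \<delta>'"
        using that by (rule ring_map_ev)
      show ?thesis
        using that ij by (simp add: map_add map_mult map_of_nat ev_A)
    qed
    moreover have "ev e (A i + of_nat k * A j) = \<delta> one"
    proof -
      interpret ring_map "ev e"
        by (rule ring_map_ev_e)
      show ?thesis
        using ij by (simp add: map_add map_mult map_of_nat \<alpha>_def one_def \<delta>_def)
    qed
    ultimately show ?thesis
      using conjugate_root[OF _ \<gamma>(1), of g "A i + of_nat k * A j"] that(1) \<gamma> by (simp add: \<delta>_def)
  qed
  \<comment> \<open>Constant data 1 yields a polynomial \<open>d\<close> whose value at
    \<open>\<delta> \<pi>\<close> is the derivative there of the polynomial with the roots
    \<open>\<delta> \<pi>\<close>. This is the common denominator of all interpolations, and it is
    inverted as a polynomial in the generator.\<close>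
  have "\<exists>d. \<forall>\<pi>\<in>F. poly (complex_poly d) (\<delta> \<pi>) = ev e 1 * (\<Prod>\<pi>'\<in>F - {\<pi>}. \<delta> \<pi> - \<delta> \<pi>')"
    by (rule ex_interpolation[OF ij(1,2) \<delta>, where c = "\<lambda>_. 1" and k = k])
      (simp_all add: \<delta>_def ring_map.map_one[OF ring_map_ev] e)
  then obtain d where d: "\<And>\<pi>. \<pi> \<in> F \<Longrightarrow> poly (complex_poly d) (\<delta> \<pi>) = (\<Prod>\<pi>'\<in>F - {\<pi>}. \<delta> \<pi> - \<delta> \<pi>')"
    using ring_map.map_one[OF ring_map_ev_e] by auto
  have "\<exists>P. complex_poly P = (\<Prod>\<pi>\<in>F. [:- \<delta> \<pi>, 1:])"
  proof -
    define Q where "Q = (\<Prod>\<pi>\<in>F. [:- (A (\<pi> i) + of_nat k * A (\<pi> j)), 1:])"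
    have ev_Q: "map_poly (ev \<gamma>) Q = (\<Prod>\<pi>\<in>F. [:- \<delta> \<pi>, 1:])" if \<gamma>: "\<gamma> \<in> \<Gamma>" for \<gamma>
    proof -
      interpret ring_map "ev \<gamma>"
        using \<gamma> by (rule ring_map_ev)
      interpret P: ring_map "map_poly (ev \<gamma>)"
        by (rule ring_map_map_poly)
      have "map_poly (ev \<gamma>) Q = (\<Prod>\<pi>\<in>F. [:- \<delta> (compose I (act \<gamma>) \<pi>), 1:])"
        unfolding Q_def P.map_prod
      proof (rule prod.cong[OF refl])
        fix \<pi> assume "\<pi> \<in> F"
        then show "map_poly (ev \<gamma>) [:- (A (\<pi> i) + of_nat k * A (\<pi> j)), 1:] = [:- \<delta> (compose I (act \<gamma>) \<pi>), 1:]"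
          using \<gamma> ij F_I
          by (simp add: map_poly_pCons' map_diff map_uminus map_one map_add map_mult map_of_nat ev_A \<delta>_def compose_def)
      qed
      also have "\<dots> = (\<Prod>\<pi>\<in>F. [:- \<delta> \<pi>, 1:])"
        using frobenius_compose_bij[OF p n act_mem[OF \<gamma>]]
        by (intro prod.reindex_bij_betw) (simp add: F_def I_def)
      finally show ?thesis .
    qed
    then show ?thesis
      using invariant_poly[of Q] e by metis
  qed
  then obtain P where P: "complex_poly P = (\<Prod>\<pi>\<in>F. [:- \<delta> \<pi>, 1:])"
    by blast
  have roots: "poly (complex_poly P) z = 0 \<longleftrightarrow> z \<in> \<delta> ` F" for z
    using finite_F by (auto simp: P poly_prod)
  have "poly (complex_poly P) (\<delta> one) = 0"
    using one by (simp only: roots) blast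
  moreover have "P \<noteq> 0"
    using finite_F P by (auto simp: prod_zero_iff)
  moreover have "poly (complex_poly d) (\<delta> one) \<noteq> 0"
    using one \<delta> finite_F by (auto simp: d dest: inj_onD)
  ultimately obtain u where u: "poly (complex_poly u) (\<delta> one) * poly (complex_poly d) (\<delta> one) = 1"
    using algebraic_inverse_is_poly by blast
  \<comment> \<open>\<open>u * d = 1\<close> at the generator is a rational relation, so it holds at
    every conjugate.\<close>
  then have "poly (complex_poly (u * d - 1)) (\<delta> one) = 0"
    by (simp add: cpoly.map_mult cpoly.map_diff)
  then have u: "poly (complex_poly u) (\<delta> \<pi>) * poly (complex_poly d) (\<delta> \<pi>) = 1" if "\<pi> \<in> F" for \<pi>
    using conj[OF _ that, of "u * d - 1"] by (simp add: cpoly.map_mult cpoly.map_diff)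
  have "\<exists>g. \<forall>\<pi>\<in>F. \<alpha> (\<pi> l) = poly (complex_poly g) (\<delta> \<pi>)" if l: "l \<in> I" for l
  proof -
    have "\<exists>g. \<forall>\<pi>\<in>F. poly (complex_poly g) (\<delta> \<pi>) = ev e (A (\<pi> l)) * (\<Prod>\<pi>'\<in>F - {\<pi>}. \<delta> \<pi> - \<delta> \<pi>')"
      by (rule ex_interpolation[OF ij(1,2) \<delta>, where k = k])
        (use l F_I in \<open>simp_all add: \<delta>_def ev_A compose_def \<alpha>_def[symmetric]\<close>)
    then obtain g where g: "\<And>\<pi>. \<pi> \<in> F \<Longrightarrow> poly (complex_poly g) (\<delta> \<pi>) = \<alpha> (\<pi> l) * poly (complex_poly d) (\<delta> \<pi>)"
      using d by (auto simp: \<alpha>_def)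
    then have "\<alpha> (\<pi> l) = poly (complex_poly (u * g)) (\<delta> \<pi>)" if "\<pi> \<in> F" for \<pi>
      using u[OF that] g[OF that] by (simp add: cpoly.map_mult algebra_simps)
    then show ?thesis
      by blast
  qed
  then obtain G where "\<And>l \<pi>. l \<in> I \<Longrightarrow> \<pi> \<in> F \<Longrightarrow> \<alpha> (\<pi> l) = poly (complex_poly (G l)) (\<delta> \<pi>)"
    by metis
  then show ?thesis
    using roots conj[unfolded one_def]
    by (intro exI[of _ G] exI[of _ \<delta>] exI[of _ P] exI[of _ k]) (simp add: \<delta>_def)
qed

section \<open>The splitting field and its automorphisms\<close>

definition S :: "complex set" where "S = rat_adjoin (\<alpha> ` I)"

lemma splitting_field_f: "splitting_field f = S"
  by (simp add: splitting_field_def f_root_iff S_def)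

text \<open>The primitive element is a combination of \<open>\<alpha> i\<close> and
  \<open>\<alpha> j\<close> and already lies in the field on the right.\<close>

lemma S_eq_rat_adjoin_two:
  assumes ij: "i \<in> I" "j \<in> I" "i \<noteq> j"
  shows "S = rat_adjoin {\<alpha> i, \<alpha> j}"
proof
  obtain G \<delta> P and k :: nat where *:
      "(\<forall>\<pi>\<in>F. \<forall>l\<in>I. \<alpha> (\<pi> l) = poly (complex_poly (G l)) (\<delta> \<pi>))"
      "(\<forall>z. poly (complex_poly P) z = 0 \<longleftrightarrow> z \<in> \<delta> ` F)"
      "(\<forall>g. \<forall>\<pi>\<in>F. poly (complex_poly g) (\<delta> (\<lambda>x\<in>I. x)) = 0 \<longrightarrow> poly (complex_poly g) (\<delta> \<pi>) = 0)"
      "(\<forall>\<pi>. \<delta> \<pi> = \<alpha> (\<pi> i) + of_nat k * \<alpha> (\<pi> j))"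
    using primitive_element[OF ij] by blast
  note G = *(1)[rule_format] and P = *(2)[rule_format] and conj = *(3)[rule_format] and k = *(4)[rule_format]
  define one where "one = (\<lambda>x\<in>I. x)"
  have one: "one \<in> F"
    using frobenius_one[OF p n] by (simp add: one_def F_def I_def)
  have gen: "\<alpha> i \<in> rat_adjoin {\<alpha> i, \<alpha> j}" "\<alpha> j \<in> rat_adjoin {\<alpha> i, \<alpha> j}"
    using rat_adjoin_superset[of "{\<alpha> i, \<alpha> j}"] by auto
  have "\<delta> one \<in> rat_adjoin {\<alpha> i, \<alpha> j}"
    using ij gen by (simp add: k one_def rat_adjoin_closed)
  then have "\<alpha> (one l) \<in> rat_adjoin {\<alpha> i, \<alpha> j}" if "l \<in> I" for l
    using that one by (simp add: G poly_in_rat_adjoin)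
  then show "S \<subseteq> rat_adjoin {\<alpha> i, \<alpha> j}"
    unfolding S_def by (intro rat_adjoin_mono) (auto simp: one_def)
  show "rat_adjoin {\<alpha> i, \<alpha> j} \<subseteq> S"
    unfolding S_def using ij rat_adjoin_superset[of "\<alpha> ` I"] by (intro rat_adjoin_mono) auto
qed

text \<open>Only an endomorphism of \<open>S\<close> over the rationals, with no demand on values
  outside \<open>S\<close>; bijectivity and extensionality come from \<open>Bij S\<close>.\<close>

definition field_aut :: "(complex \<Rightarrow> complex) \<Rightarrow> bool" where
  "field_aut \<tau> \<longleftrightarrow> \<tau> ` S \<subseteq> S \<and> (\<forall>x\<in>S. \<forall>y\<in>S. \<tau> (x + y) = \<tau> x + \<tau> y \<and> \<tau> (x * y) = \<tau> x * \<tau> y) \<and>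
     (\<forall>q\<in>\<rat>. \<tau> q = q)"

lemma \<alpha>_S: "i \<in> I \<Longrightarrow> \<alpha> i \<in> S"
  unfolding S_def using rat_adjoin_superset[of "\<alpha> ` I"] by auto

lemmas S_closed = rat_adjoin_closed[where T = "\<alpha> ` I", folded S_def]

lemma field_autD:
  assumes "field_aut \<tau>"
  shows "x \<in> S \<Longrightarrow> \<tau> x \<in> S" "x \<in> S \<Longrightarrow> y \<in> S \<Longrightarrow> \<tau> (x + y) = \<tau> x + \<tau> y"
    "x \<in> S \<Longrightarrow> y \<in> S \<Longrightarrow> \<tau> (x * y) = \<tau> x * \<tau> y" "q \<in> \<rat> \<Longrightarrow> \<tau> q = q"
  using assms unfolding field_aut_def by blast+

lemma field_aut_eqI:
  assumes \<tau>: "field_aut \<tau>" "field_aut \<tau>'" "\<And>i. i \<in> I \<Longrightarrow> \<tau> (\<alpha> i) = \<tau>' (\<alpha> i)" and x: "x \<in> S"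
  shows "\<tau> x = \<tau>' x"
  using x unfolding S_def
proof (induction rule: rat_adjoin_induct)
  case (uminus y)
  then have "y \<in> S" "- 1 \<in> S"
    using S_closed(7)[of "- 1"] by (simp_all add: S_def)
  then have "\<tau> (- 1 * y) = \<tau> (- 1) * \<tau> y" "\<tau>' (- 1 * y) = \<tau>' (- 1) * \<tau>' y"
    using field_autD(3) \<tau>(1,2) by blast+
  moreover have "\<tau> (- 1) = - 1" "\<tau>' (- 1) = - 1"
    using field_autD(4) \<tau>(1,2) by simp_all
  ultimately show ?case
    using uminus by simp
next
  case (inverse y)
  have yS: "y \<in> S" "inverse y \<in> S"
    using inverse S_closed(4) by (simp_all add: S_def)
  have "\<tau> y * \<tau> (inverse y) = 1" "\<tau>' y * \<tau>' (inverse y) = 1"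
    using field_autD(3)[OF \<tau>(1) yS] field_autD(3)[OF \<tau>(2) yS] inverse(2)
      field_autD(4)[OF \<tau>(1), of 1] field_autD(4)[OF \<tau>(2), of 1] by simp_all
  then show ?case
    using inverse_unique inverse(3) by metis
qed (use \<tau> in \<open>auto simp: field_autD S_def[symmetric]\<close>)

lemma field_aut_poly:
  assumes "field_aut \<tau>" "x \<in> S"
  shows "\<tau> (poly (complex_poly g) x) = poly (complex_poly g) (\<tau> x)"
proof (induction g)
  case (pCons a g)
  have "poly (complex_poly g) x \<in> S"
    using assms(2) poly_in_rat_adjoin by (simp add: S_def)
  with pCons assms show ?case
    by (simp add: rat.map_poly_pCons' field_aut_def S_closed)
qed (use assms in \<open>simp add: field_aut_def\<close>)

lemma zero_one_I: "0 \<in> I" "1 \<in> I"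
  using p3 by (simp_all add: I_def)

text \<open>Every element of \<open>S\<close> is a polynomial in \<open>\<delta> one\<close>.
  Replacing \<open>\<delta> one\<close> by its conjugate \<open>\<delta> \<pi>\<close> is well
  defined because rational relations pass to conjugates.\<close>

lemma ex_field_aut:
  assumes \<pi>: "\<pi> \<in> F"
  shows "\<exists>\<tau>. field_aut \<tau> \<and> (\<forall>i\<in>I. \<tau> (\<alpha> i) = \<alpha> (\<pi> i))"
proof -
  define one where "one = (\<lambda>x\<in>I. x)"
  have one: "one \<in> F"
    using frobenius_one[OF p n] by (simp add: one_def F_def I_def)
  obtain G \<delta> P and k :: nat where *:
      "(\<forall>\<pi>\<in>F. \<forall>l\<in>I. \<alpha> (\<pi> l) = poly (complex_poly (G l)) (\<delta> \<pi>))"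
      "(\<forall>z. poly (complex_poly P) z = 0 \<longleftrightarrow> z \<in> \<delta> ` F)"
      "(\<forall>g. \<forall>\<pi>\<in>F. poly (complex_poly g) (\<delta> (\<lambda>x\<in>I. x)) = 0 \<longrightarrow> poly (complex_poly g) (\<delta> \<pi>) = 0)"
      "(\<forall>\<pi>. \<delta> \<pi> = \<alpha> (\<pi> 0) + of_nat k * \<alpha> (\<pi> 1))"
    using primitive_element[OF zero_one_I zero_neq_one] by blast
  note G = *(1)[rule_format] and P = *(2)[rule_format] and conj = *(3)[rule_format] and k = *(4)[rule_format]
  have \<delta>S: "\<delta> \<pi> \<in> S" if "\<pi> \<in> F" for \<pi>
    using zero_one_I F_I[OF that] \<alpha>_S by (simp add: k S_closed)
  have "P \<noteq> 0"
  proof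
    assume "P = 0"
    then have "\<delta> ` F = UNIV"
      using P by auto
    then show False
      using finite_F infinite_UNIV_char_0 by (metis finite_imageI)
  qed
  have S_poly: "\<exists>g. x = poly (complex_poly g) (\<delta> one)" if "x \<in> S" for x
    using that unfolding S_def
  proof (induction rule: rat_adjoin_induct)
    case (rat q)
    then obtain r where "q = of_rat r"
      by (auto elim: Rats_cases)
    then have "q = poly (complex_poly [:r:]) (\<delta> one)"
      by (simp add: rat.map_poly_pCons')
    then show ?case
      by blast
  next
    case (incl y)
    then obtain i where i: "i \<in> I" "y = \<alpha> (one i)"
      by (auto simp: one_def)
    then have "y = poly (complex_poly (G i)) (\<delta> one)"
      using G[OF one i(1)] by simp
    then show ?case
      by blast
  next
    case (uminus y)
    then show ?case
      by (metis cpoly.map_uminus poly_minus)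
  next
    case (inverse y)
    then obtain g where g: "y = poly (complex_poly g) (\<delta> one)"
      by blast
    obtain h where "poly (complex_poly h) (\<delta> one) * poly (complex_poly g) (\<delta> one) = 1"
      using algebraic_inverse_is_poly[OF \<open>P \<noteq> 0\<close>, of "\<delta> one" g] one inverse(2) g P by blast
    then have "inverse y = poly (complex_poly h) (\<delta> one)"
      using inverse_unique[of y] by (simp add: g mult.commute)
    then show ?case
      by blast
  next
    case (add y z)
    then show ?case
      by (metis cpoly.map_add poly_add)
  next
    case (mult y z)
    then show ?case
      by (metis cpoly.map_mult poly_mult)
  qed
  define \<tau> where "\<tau> x = poly (complex_poly (SOME g. x = poly (complex_poly g) (\<delta> one))) (\<delta> \<pi>)" for x
  have \<tau>: "\<tau> (poly (complex_poly g) (\<delta> one)) = poly (complex_poly g) (\<delta> \<pi>)" for g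
  proof -
    define h where "h = (SOME h. poly (complex_poly g) (\<delta> one) = poly (complex_poly h) (\<delta> one))"
    have "poly (complex_poly g) (\<delta> one) = poly (complex_poly h) (\<delta> one)"
      unfolding h_def by (rule someI_ex) blast
    then have "poly (complex_poly (g - h)) (\<delta> one) = 0"
      by (simp add: cpoly.map_diff)
    then have "poly (complex_poly (g - h)) (\<delta> \<pi>) = 0"
      using conj[OF \<pi>] by (simp add: one_def)
    then show ?thesis
      by (simp add: \<tau>_def h_def[symmetric] cpoly.map_diff)
  qed
  have "field_aut \<tau>"
    unfolding field_aut_def
  proof (intro conjI ballI)
    show "\<tau> ` S \<subseteq> S"
      using S_poly \<tau> poly_in_rat_adjoin \<delta>S[OF \<pi>] by (fastforce simp: S_def)
    fix x y assume "x \<in> S" "y \<in> S"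
    then obtain g h where gh: "x = poly (complex_poly g) (\<delta> one)" "y = poly (complex_poly h) (\<delta> one)"
      using S_poly by meson
    show "\<tau> (x + y) = \<tau> x + \<tau> y"
      using \<tau>[of "g + h"] by (simp add: gh \<tau> cpoly.map_add)
    show "\<tau> (x * y) = \<tau> x * \<tau> y"
      using \<tau>[of "g * h"] by (simp add: gh \<tau> cpoly.map_mult)
  next
    fix q :: complex assume "q \<in> \<rat>"
    then obtain r where "q = of_rat r"
      by (auto elim: Rats_cases)
    then show "\<tau> q = q"
      using \<tau>[of "[:r:]"] by (simp add: rat.map_poly_pCons')
  qed
  moreover have "\<tau> (\<alpha> i) = \<alpha> (\<pi> i)" if "i \<in> I" for i
    using G[OF one that] G[OF \<pi> that] \<tau>[of "G i"] that by (simp add: one_def)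
  ultimately show ?thesis
    by blast
qed

text \<open>\<open>\<tau>\<close> maps the primitive element to a root of \<open>P\<close>, that is
  to some \<open>\<delta> \<pi>\<close>, and the polynomials \<open>G l\<close> then dictate the
  images of all roots.\<close>

lemma field_aut_permutes:
  assumes \<tau>: "field_aut \<tau>"
  shows "\<exists>\<pi>\<in>F. \<forall>i\<in>I. \<tau> (\<alpha> i) = \<alpha> (\<pi> i)"
proof -
  define one where "one = (\<lambda>x\<in>I. x)"
  have one: "one \<in> F"
    using frobenius_one[OF p n] by (simp add: one_def F_def I_def)
  obtain G \<delta> P and k :: nat where *:
      "(\<forall>\<pi>\<in>F. \<forall>l\<in>I. \<alpha> (\<pi> l) = poly (complex_poly (G l)) (\<delta> \<pi>))"
      "(\<forall>z. poly (complex_poly P) z = 0 \<longleftrightarrow> z \<in> \<delta> ` F)"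
      "(\<forall>g. \<forall>\<pi>\<in>F. poly (complex_poly g) (\<delta> (\<lambda>x\<in>I. x)) = 0 \<longrightarrow> poly (complex_poly g) (\<delta> \<pi>) = 0)"
      "(\<forall>\<pi>. \<delta> \<pi> = \<alpha> (\<pi> 0) + of_nat k * \<alpha> (\<pi> 1))"
    using primitive_element[OF zero_one_I zero_neq_one] by blast
  note G = *(1)[rule_format] and P = *(2)[rule_format] and conj = *(3)[rule_format] and k = *(4)[rule_format]
  have \<delta>S: "\<delta> one \<in> S"
    using zero_one_I \<alpha>_S by (simp add: k one_def S_closed)
  have "poly (complex_poly P) (\<tau> (\<delta> one)) = \<tau> 0"
    using field_aut_poly[OF \<tau> \<delta>S, of P] P[of "\<delta> one"] one by simp
  also have "\<tau> 0 = 0"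
    using \<tau> by (simp add: field_aut_def)
  finally obtain \<pi> where \<pi>: "\<pi> \<in> F" "\<tau> (\<delta> one) = \<delta> \<pi>"
    using P by auto
  have "\<tau> (\<alpha> i) = \<alpha> (\<pi> i)" if i: "i \<in> I" for i
  proof -
    have "\<alpha> i = poly (complex_poly (G i)) (\<delta> one)"
      using G[OF one i] i by (simp add: one_def)
    then show ?thesis
      using field_aut_poly[OF \<tau> \<delta>S] G[OF \<pi>(1) i] \<pi>(2) by simp
  qed
  with \<pi>(1) show ?thesis
    by blast
qed

lemma carrier_galois_group: "carrier (poly_galois_group f) = {\<sigma> \<in> Bij S. field_aut \<sigma>}"
proof -
  have "1 \<in> S"
    by (rule S_closed) simp
  then show ?thesis
    by (auto simp: poly_galois_group_def galois_group_def splitting_field_f field_aut_def ring_hom_def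
        complex_field_simps ring_of_type_algebra_def)
qed

lemma galois_group_mult:
  "\<sigma> \<in> Bij S \<Longrightarrow> \<tau> \<in> Bij S \<Longrightarrow> \<sigma> \<otimes>\<^bsub>poly_galois_group f\<^esub> \<tau> = compose S \<sigma> \<tau>"
  by (simp add: poly_galois_group_def galois_group_def splitting_field_f BijGroup_def)

text \<open>Uniqueness of the extension from the roots to \<open>S\<close>, by
  \<open>field_aut_eqI\<close>, yields the homomorphism property, the bijectivity of each
  \<open>\<Phi> \<pi>\<close> and, with \<open>field_aut_permutes\<close>, surjectivity of
  \<open>\<Phi>\<close>.\<close>

lemma galois_group_iso: "poly_galois_group f \<cong> frobenius_group p n"
proof -
  define \<Phi> where "\<Phi> \<pi> = restrict (SOME \<tau>. field_aut \<tau> \<and> (\<forall>i\<in>I. \<tau> (\<alpha> i) = \<alpha> (\<pi> i))) S" for \<pi>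
  have \<Phi>: "field_aut (\<Phi> \<pi>)" "\<And>i. i \<in> I \<Longrightarrow> \<Phi> \<pi> (\<alpha> i) = \<alpha> (\<pi> i)" "\<Phi> \<pi> \<in> extensional S" if "\<pi> \<in> F" for \<pi>
  proof -
    define \<tau> where "\<tau> = (SOME \<tau>. field_aut \<tau> \<and> (\<forall>i\<in>I. \<tau> (\<alpha> i) = \<alpha> (\<pi> i)))"
    have \<tau>: "field_aut \<tau> \<and> (\<forall>i\<in>I. \<tau> (\<alpha> i) = \<alpha> (\<pi> i))"
      unfolding \<tau>_def by (rule someI_ex[OF ex_field_aut[OF that]])
    have "\<Phi> \<pi> = restrict \<tau> S"
      by (simp add: \<Phi>_def \<tau>_def)
    with \<tau> show "field_aut (\<Phi> \<pi>)" "\<And>i. i \<in> I \<Longrightarrow> \<Phi> \<pi> (\<alpha> i) = \<alpha> (\<pi> i)" "\<Phi> \<pi> \<in> extensional S"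
      by (auto simp: field_aut_def S_closed \<alpha>_S)
  qed
  have comp: "field_aut (compose S \<sigma> \<tau>)" if "field_aut \<sigma>" "field_aut \<tau>" for \<sigma> \<tau>
    using that S_closed unfolding field_aut_def compose_def by (auto simp: image_subset_iff)
  have id: "field_aut (\<lambda>x\<in>S. x)"
    using S_closed by (simp add: field_aut_def)
  have inverse: "\<Phi> \<pi> (\<Phi> \<pi>' x) = x"
    if "\<pi> \<in> F" "\<pi>' \<in> F" "\<And>i. i \<in> I \<Longrightarrow> \<pi> (\<pi>' i) = i" "x \<in> S" for \<pi> \<pi>' x
  proof -
    have "compose S (\<Phi> \<pi>) (\<Phi> \<pi>') x = (\<lambda>x\<in>S. x) x"
      using that(4)
      by (rule field_aut_eqI[OF comp[OF \<Phi>(1)[OF that(1)] \<Phi>(1)[OF that(2)]] id, rotated])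
        (use that \<Phi> F_I in \<open>simp add: compose_def \<alpha>_S\<close>)
    then show ?thesis
      using that(4) by (simp add: compose_def)
  qed
  have Bij: "\<Phi> \<pi> \<in> Bij S" if \<pi>: "\<pi> \<in> F" for \<pi>
  proof -
    obtain \<pi>' where \<pi>': "\<pi>' \<in> F" "\<And>i. i \<in> I \<Longrightarrow> \<pi> (\<pi>' i) = i" "\<And>i. i \<in> I \<Longrightarrow> \<pi>' (\<pi> i) = i"
      using frobenius_inverse[OF p n] \<pi> unfolding F_def I_def by metis
    have "bij_betw (\<Phi> \<pi>) S S"
      by (rule bij_betw_byWitness[of _ "\<Phi> \<pi>'"])
        (use inverse \<pi> \<pi>' \<Phi>(1) in \<open>auto simp: field_aut_def\<close>)
    then show ?thesis
      using \<Phi>(3)[OF \<pi>] by (simp add: Bij_def)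
  qed
  have hom: "\<Phi> (compose I \<pi> \<pi>') = compose S (\<Phi> \<pi>) (\<Phi> \<pi>')" if "\<pi> \<in> F" "\<pi>' \<in> F" for \<pi> \<pi>'
  proof -
    have c: "compose I \<pi> \<pi>' \<in> F"
      using that frobenius_compose[OF p n] by (simp add: F_def I_def)
    show ?thesis
    proof (rule extensionalityI[OF \<Phi>(3)[OF c] compose_extensional])
      fix x assume "x \<in> S"
      then show "\<Phi> (compose I \<pi> \<pi>') x = compose S (\<Phi> \<pi>) (\<Phi> \<pi>') x"
        by (rule field_aut_eqI[OF \<Phi>(1)[OF c] comp[OF \<Phi>(1)[OF that(1)] \<Phi>(1)[OF that(2)]], rotated])
          (use that \<Phi> c F_I in \<open>simp add: compose_def \<alpha>_S\<close>)
    qed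
  qed
  have inj: "inj_on \<Phi> F"
  proof (rule inj_onI)
    fix \<pi> \<pi>' assume *: "\<pi> \<in> F" "\<pi>' \<in> F" "\<Phi> \<pi> = \<Phi> \<pi>'"
    have "\<pi> i = \<pi>' i" if "i \<in> I" for i
      using \<Phi>(2)[OF *(1) that] \<Phi>(2)[OF *(2) that] *(3) \<alpha>_inj F_I *(1,2) that by metis
    then show "\<pi> = \<pi>'"
      using frobenius_eqI[OF p n] *(1,2) zero_one_I zero_neq_one unfolding F_def I_def by metis
  qed
  have surj: "\<Phi> ` F = {\<sigma> \<in> Bij S. field_aut \<sigma>}"
  proof
    show "\<Phi> ` F \<subseteq> {\<sigma> \<in> Bij S. field_aut \<sigma>}"
      using Bij \<Phi>(1) by blast
    show "{\<sigma> \<in> Bij S. field_aut \<sigma>} \<subseteq> \<Phi> ` F"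
    proof
      fix \<sigma> assume "\<sigma> \<in> {\<sigma> \<in> Bij S. field_aut \<sigma>}"
      then have \<sigma>: "\<sigma> \<in> extensional S" "field_aut \<sigma>"
        by (auto simp: Bij_def)
      obtain \<pi> where \<pi>: "\<pi> \<in> F" "\<forall>i\<in>I. \<sigma> (\<alpha> i) = \<alpha> (\<pi> i)"
        using field_aut_permutes[OF \<sigma>(2)] by blast
      have "\<sigma> = \<Phi> \<pi>"
      proof (rule extensionalityI[OF \<sigma>(1) \<Phi>(3)[OF \<pi>(1)]])
        fix x assume "x \<in> S"
        then show "\<sigma> x = \<Phi> \<pi> x"
          by (rule field_aut_eqI[OF \<sigma>(2) \<Phi>(1)[OF \<pi>(1)], rotated]) (use \<pi> \<Phi> in simp)
      qed
      with \<pi>(1) show "\<sigma> \<in> \<Phi> ` F"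
        by blast
    qed
  qed
  have "\<Phi> \<in> iso (frobenius_group p n) (poly_galois_group f)"
  proof (rule isoI)
    show "\<Phi> \<in> hom (frobenius_group p n) (poly_galois_group f)"
      unfolding hom_def carrier_galois_group F_def[symmetric]
      using surj hom Bij frobenius_mult[OF p n]
      by (auto simp: galois_group_mult F_def[symmetric] I_def[symmetric])
    show "bij_betw \<Phi> (carrier (frobenius_group p n)) (carrier (poly_galois_group f))"
      using inj surj by (simp add: bij_betw_def F_def carrier_galois_group)
  qed
  then show ?thesis
    using group.iso_sym[OF group_frobenius[OF p n] is_isoI] by blast
qed

text \<open>Conjugation moves a nonreal root \<open>\<alpha> j\<close> to a different root
  \<open>\<alpha> (\<pi> j)\<close>, and these two generate \<open>S\<close>. Half their sum and
  half their difference are \<open>a\<close> and \<open>\<i> * b\<close>.\<close>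

lemma realization:
  "\<exists>f :: rat poly.
     irreducible f \<and> degree f = p \<and>
     (\<exists>z. poly (complex_poly f) z = 0 \<and> z \<notin> \<real>) \<and>
     poly_galois_group f \<cong> frobenius_group p n \<and>
     (\<forall>a b :: real.
        poly (complex_poly f) (complex_of_real a + \<i> * complex_of_real b) = 0 \<and>
        complex_of_real a + \<i> * complex_of_real b \<notin> \<real> \<longrightarrow>
        splitting_field f = rat_adjoin {complex_of_real a, \<i> * complex_of_real b})"
proof (intro exI[of _ f] conjI allI impI)
  show "irreducible f" "degree f = p" "poly_galois_group f \<cong> frobenius_group p n"
    using irreducible_f degree_f galois_group_iso by auto
  obtain \<pi> where "\<pi> \<in> F \<and> (\<exists>i\<in>I. \<pi> i \<noteq> i) \<and> (\<forall>i\<in>I. cnj (\<alpha> i) = \<alpha> (\<pi> i))"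
    using conj_act unfolding F_def I_def \<alpha>_def by blast
  then have \<pi>: "\<pi> \<in> F" "\<exists>i\<in>I. \<pi> i \<noteq> i" "\<And>i. i \<in> I \<Longrightarrow> cnj (\<alpha> i) = \<alpha> (\<pi> i)"
    by blast+
  then obtain i where i: "i \<in> I" "\<pi> i \<noteq> i"
    by blast
  then have "cnj (\<alpha> i) \<noteq> \<alpha> i"
    using \<pi> F_I \<alpha>_inj by simp
  then have "\<alpha> i \<notin> \<real>"
    by (simp add: Reals_cnj_iff)
  then show "\<exists>z. poly (complex_poly f) z = 0 \<and> z \<notin> \<real>"
    using i f_root_iff by blast
  fix a b :: real
  define z where "z = complex_of_real a + \<i> * complex_of_real b"
  assume *: "poly (complex_poly f) (complex_of_real a + \<i> * complex_of_real b) = 0 \<and>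
    complex_of_real a + \<i> * complex_of_real b \<notin> \<real>"
  then obtain j where j: "j \<in> I" "z = \<alpha> j" "cnj z \<noteq> z"
    unfolding z_def[symmetric] by (auto simp: f_root_iff Reals_cnj_iff)
  then have "S = rat_adjoin {\<alpha> j, \<alpha> (\<pi> j)}"
    using \<pi> F_I by (intro S_eq_rat_adjoin_two) auto
  then have S: "S = rat_adjoin {z, cnj z}"
    using \<pi>(3)[OF j(1)] j(2) by simp
  let ?K = "rat_adjoin {complex_of_real a, \<i> * complex_of_real b}"
  have K: "complex_of_real a \<in> ?K" "\<i> * complex_of_real b \<in> ?K"
    using rat_adjoin_superset[of "{complex_of_real a, \<i> * complex_of_real b}"] by auto
  have zz: "z \<in> rat_adjoin {z, cnj z}" "cnj z \<in> rat_adjoin {z, cnj z}"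
    using rat_adjoin_superset[of "{z, cnj z}"] by auto
  have "cnj z = complex_of_real a - \<i> * complex_of_real b"
    by (simp add: z_def)
  then have "{z, cnj z} \<subseteq> ?K"
    using K by (simp add: z_def rat_adjoin_closed)
  moreover have "{complex_of_real a, \<i> * complex_of_real b} \<subseteq> rat_adjoin {z, cnj z}"
  proof -
    have "(2::complex) \<in> rat_adjoin {z, cnj z}"
      by (rule rat_adjoin_closed(7)) simp
    then have "(z + cnj z) / 2 \<in> rat_adjoin {z, cnj z}" "(z - cnj z) / 2 \<in> rat_adjoin {z, cnj z}"
      using rat_adjoin_closed(1,5)[OF zz] rat_adjoin_closed(6) by blast+
    moreover have "complex_of_real a = (z + cnj z) / 2" "\<i> * complex_of_real b = (z - cnj z) / 2"
      by (simp_all add: z_def)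
    ultimately show ?thesis
      by (simp only: insert_subset empty_subsetI)
  qed
  ultimately have "rat_adjoin {z, cnj z} = ?K"
    by (intro antisym rat_adjoin_mono)
  then show "splitting_field f = ?K"
    by (simp add: splitting_field_f S)
qed

end

section \<open>Conjugates of roots of unity\<close>

abbreviation int_eval :: "int poly \<Rightarrow> complex \<Rightarrow> complex" where
  "int_eval g z \<equiv> poly (map_poly of_int g) z"

text \<open>A nonzero integer polynomial of least degree is made primitive; pseudo-division and
  Gauss's lemma then give divisibility over the integers and not just over the rationals. Dividing
  the monic \<open>f\<close> forces the leading coefficient to be a unit.\<close>

lemma ex_int_minimal_poly:
  assumes "int_eval f z = 0" "lead_coeff f = 1"
  obtains m where "lead_coeff m = 1" "int_eval m z = 0" "\<And>g. int_eval g z = 0 \<Longrightarrow> m dvd g"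
proof -
  have "f \<noteq> 0"
    using assms(2) by auto
  then have "\<exists>g. g \<noteq> 0 \<and> int_eval g z = 0"
    using assms by blast
  then obtain h where h: "h \<noteq> 0" "int_eval h z = 0"
      and min: "\<And>g. g \<noteq> 0 \<Longrightarrow> int_eval g z = 0 \<Longrightarrow> degree h \<le> degree g"
    using ex_has_least_nat[of "\<lambda>g. g \<noteq> 0 \<and> int_eval g z = 0" _ degree] by metis
  define m where "m = primitive_part h"
  have hm: "h = smult (content h) m"
    by (simp add: m_def)
  have m: "m \<noteq> 0" "content m = 1" "degree m = degree h"
    using h(1) by (simp_all add: m_def)
  have "of_int (content h) * int_eval m z = int_eval h z"
    by (subst (2) hm) (simp add: cint.map_poly_smult')
  then have mz: "int_eval m z = 0"
    using h by simp
  have dvd: "m dvd g" if g: "int_eval g z = 0" for g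
  proof -
    obtain q r where qr: "pseudo_divmod g m = (q, r)"
      by fastforce
    define c where "c = coeff m (degree m) ^ (Suc (degree g) - degree m)"
    have c: "c \<noteq> 0"
      using m(1) by (simp add: c_def)
    have eq: "smult c g = m * q + r" "r = 0 \<or> degree r < degree m"
      using pseudo_divmod[OF m(1) qr] by (simp_all add: c_def)
    have "int_eval (smult c g) z = int_eval (m * q + r) z"
      by (simp only: eq(1))
    then have "int_eval r z = 0"
      using g mz by (simp add: cint.map_poly_smult' ipoly.map_add ipoly.map_mult)
    then have "r = 0"
      using min[of r] eq(2) m(3) by force
    then have cg: "smult c g = m * q"
      using eq(1) by simp
    \<comment> \<open>As \<open>m\<close> is primitive, the scalar \<open>c\<close> introduced by
      pseudo-division divides the content of \<open>q\<close> and can be cancelled.\<close>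
    then have "content q = normalize c * content g"
      using content_mult[of m q] m(2) by (metis content_smult mult_1)
    then have "[:c:] dvd q"
      by (simp add: const_poly_dvd_iff_dvd_content)
    then obtain q' where "q = [:c:] * q'" ..
    then have "smult c g = smult c (m * q')"
      using cg by simp
    then have "g = m * q'"
      by (rule smult_cancel[OF c])
    then show ?thesis
      by simp
  qed
  obtain q where "f = m * q"
    using dvd[OF assms(1)] ..
  then have unit: "lead_coeff m * lead_coeff q = 1"
    using assms(2) by (simp add: lead_coeff_mult)
  then have u: "lead_coeff m * lead_coeff m = 1"
    by (metis zmult_eq_1_iff mult_minus1_right mult_1 minus_minus)
  show ?thesis
  proof (rule that[of "smult (lead_coeff m) m"])
    show "lead_coeff (smult (lead_coeff m) m) = 1"
      using u by auto
    show "int_eval (smult (lead_coeff m) m) z = 0"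
      using mz by (simp add: cint.map_poly_smult')
    fix g assume "int_eval g z = 0"
    then obtain k where "g = m * k"
      using dvd by blast
    then have "g = smult (lead_coeff m) m * smult (lead_coeff m) k"
      using u by (simp add: mult.assoc[symmetric])
    then show "smult (lead_coeff m) m dvd g" ..
  qed
qed

lemma int_minimal_poly_degree_pos:
  assumes "lead_coeff m = 1" "int_eval m z = 0"
  shows "degree m > 0"
proof (rule ccontr)
  assume "\<not> degree m > 0"
  then obtain c where c: "m = [:c:]"
    using degree_eq_zeroE by blast
  then show False
    using assms by (simp add: cint.map_poly_pCons')
qed

lemma prime_binomial:
  fixes u v :: "'a::comm_ring_1"
  assumes "prime l"
  shows "\<exists>w. (u + v) ^ l = u ^ l + v ^ l + of_nat l * w"
proof -
  have l: "l > 0" "l \<noteq> 1"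
    using assms prime_gt_0_nat by auto
  have "\<exists>w. of_nat (l choose k) * u ^ k * v ^ (l - k) = of_nat l * w" if "k \<in> {1..<l}" for k
  proof -
    have "l dvd (l choose k)"
      using that assms by (intro dvd_choose_prime) auto
    then obtain t where "l choose k = l * t" ..
    then show ?thesis
      by (intro exI[of _ "of_nat t * u ^ k * v ^ (l - k)"]) (simp add: mult_ac)
  qed
  then obtain w where w: "\<And>k. k \<in> {1..<l} \<Longrightarrow> of_nat (l choose k) * u ^ k * v ^ (l - k) = of_nat l * w k"
    by metis
  have "{..l} = insert 0 (insert l {1..<l})"
    using l by auto
  then have "(u + v) ^ l = v ^ l + (u ^ l + (\<Sum>k\<in>{1..<l}. of_nat (l choose k) * u ^ k * v ^ (l - k)))"
    using l by (simp add: binomial_ring)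
  also have "\<dots> = u ^ l + v ^ l + of_nat l * (\<Sum>k\<in>{1..<l}. w k)"
    using w by (simp add: sum_distrib_left algebra_simps)
  finally show ?thesis
    by blast
qed

lemma int_fermat:
  assumes l: "prime l"
  shows "[a ^ l = a] (mod int l)"
proof -
  have l0: "l > 0"
    using l prime_gt_0_nat by blast
  define b where "b = nat (a mod int l)"
  have b: "[a = int b] (mod int l)"
    using l0 by (simp add: b_def Cong.cong_def)
  have "[b ^ l = b] (mod l)"
  proof (cases "l dvd b")
    case True
    then show ?thesis
      using l0 by (metis cong_0_iff cong_sym cong_trans dvd_power dvd_trans)
  next
    case False
    then have "[b ^ (l - 1) * b = 1 * b] (mod l)"
      using fermat_theorem[OF l] cong_scalar_right by blast
    then show ?thesis
      by (simp only: power_minus_mult[OF l0] mult_1)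
  qed
  then have "[int b ^ l = int b] (mod int l)"
    by (metis cong_int_iff of_nat_power)
  then show ?thesis
    using b cong_pow cong_sym cong_trans by metis
qed

text \<open>Induction along Horner's rule: \<open>prime_binomial\<close> splits off each
  coefficient, and Fermat's congruence replaces \<open>a ^ l\<close> by \<open>a\<close>.\<close>

lemma poly_frobenius:
  fixes g :: "int poly"
  assumes l: "prime l"
  shows "\<exists>G. pcompose g (monom 1 l) = g ^ l + of_nat l * G"
proof (induction g)
  case 0
  show ?case
    using prime_gt_0_nat[OF l] by (intro exI[of _ 0]) (simp add: power_0_left)
next
  case (pCons a g)
  then obtain G where G: "pcompose g (monom 1 l) = g ^ l + of_nat l * G"
    by blast
  obtain w where w: "([:a:] + monom 1 1 * g) ^ l = [:a:] ^ l + (monom 1 1 * g) ^ l + of_nat l * w"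
    using prime_binomial[OF l] by blast
  have "int l dvd a ^ l - a"
    using int_fermat[OF l] by (simp add: cong_iff_dvd_diff)
  then obtain b where "a ^ l - a = int l * b"
    by (auto elim: dvdE)
  then have b: "[:a:] ^ l = [:a:] + of_nat l * [:b:]"
    by (simp add: poly_const_pow of_nat_poly algebra_simps)
  have "pCons a g = [:a:] + monom 1 1 * g"
    by (simp add: monom_altdef)
  then have "pCons a g ^ l = [:a:] + of_nat l * [:b:] + monom 1 l * g ^ l + of_nat l * w"
    by (simp only: w b) (simp add: power_mult_distrib monom_power)
  moreover have "pcompose (pCons a g) (monom 1 l) = [:a:] + monom 1 l * (g ^ l + of_nat l * G)"
    by (simp add: pcompose_pCons G)
  ultimately have "pcompose (pCons a g) (monom 1 l) = pCons a g ^ l + of_nat l * (monom 1 l * G - [:b:] - w)"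
    by (simp add: algebra_simps)
  then show ?case
    by blast
qed

lemma int_eval_unity_poly: "int_eval (monom 1 N - 1) z = z ^ N - 1"
  by (simp add: ipoly.map_diff cint.map_poly_monom' poly_monom)

lemma lead_coeff_unity_poly: "N > 0 \<Longrightarrow> lead_coeff (monom 1 N - 1 :: int poly) = 1"
proof -
  assume "N > 0"
  then have "degree (monom 1 N - 1 :: int poly) = N"
    using degree_add_eq_left[of "- 1 :: int poly" "monom 1 N"] by (simp add: degree_monom_eq)
  then show ?thesis
    using \<open>N > 0\<close> by simp
qed

text \<open>
  Schur's argument: if \<open>m (z ^ l)\<close> were nonzero, then differentiating \<open>X ^ N - 1 = m * h\<close> at \<open>z ^ l\<close> would
  make \<open>N\<close> divisible by \<open>l\<close> in the ring of integer polynomials in \<open>z\<close>.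
\<close>

lemma int_conjugate_prime_power:
  assumes N: "N > 0" "z ^ N = 1" and l: "prime l" "\<not> l dvd N"
    and g: "int_eval g z = 0"
  shows "int_eval g (z ^ l) = 0"
proof -
  have "int_eval (monom 1 N - 1) z = 0"
    using N by (simp add: int_eval_unity_poly)
  then obtain m where m: "lead_coeff m = 1" "int_eval m z = 0" "\<And>g. int_eval g z = 0 \<Longrightarrow> m dvd g"
    using ex_int_minimal_poly lead_coeff_unity_poly[OF N(1)] by metis
  have "int_eval m (z ^ l) = 0"
  proof (rule ccontr)
    assume nz: "int_eval m (z ^ l) \<noteq> 0"
    obtain h where h: "monom 1 N - 1 = m * h"
      using m(3) N by (metis dvdE int_eval_unity_poly eq_iff_diff_eq_0)
    have zlN: "(z ^ l) ^ N = 1"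
      using N(2) by (metis mult.commute power_mult power_one)
    have "int_eval m (z ^ l) * int_eval h (z ^ l) = 0"
      using int_eval_unity_poly[of N "z ^ l"] zlN by (simp add: h ipoly.map_mult)
    then have h0: "int_eval h (z ^ l) = 0"
      using nz by simp
    obtain G where G: "pcompose m (monom 1 l) = m ^ l + of_nat l * G"
      using poly_frobenius[OF l(1)] by blast
    have comp: "int_eval (pcompose f (monom 1 l)) z = int_eval f (z ^ l)" for f
    proof (induction f)
      case (pCons a f)
      then show ?case
        by (simp add: pcompose_pCons ipoly.map_add ipoly.map_mult cint.map_poly_pCons'
            cint.map_poly_monom' poly_monom)
    qed simp
    have "l > 0"
      using l(1) prime_gt_0_nat by blast
    \<comment> \<open>\<open>m ^ l\<close> vanishes at \<open>z\<close>, so only the multiple of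
      \<open>l\<close> survives.\<close>
    then have ml: "int_eval m (z ^ l) = of_nat l * int_eval G z"
      unfolding comp[symmetric] G
      by (simp add: ipoly.map_add ipoly.map_mult ipoly.map_power ipoly.map_of_nat m(2) power_0_left)
    have "pderiv (monom 1 N - 1 :: int poly) = pderiv m * h + m * pderiv h"
      by (simp add: h pderiv_mult algebra_simps)
    then have "int_eval (monom (int N) (N - 1)) (z ^ l) = int_eval (pderiv m * h + m * pderiv h) (z ^ l)"
      by (simp add: pderiv_diff pderiv_monom)
    then have "of_nat N * (z ^ l) ^ (N - 1) = int_eval m (z ^ l) * int_eval (pderiv h) (z ^ l)"
      using h0 by (simp add: ipoly.map_add ipoly.map_mult cint.map_poly_monom' poly_monom)
    then have "of_nat N * (z ^ l) ^ (N - 1) * z ^ l = of_nat l * int_eval G z * int_eval (pderiv h) (z ^ l) * z ^ l"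
      by (simp add: ml)
    moreover have "(z ^ l) ^ (N - 1) * z ^ l = 1"
      using zlN N(1) by (metis power_minus_mult)
    ultimately have N_eq: "of_nat N = of_nat l * int_eval (G * pcompose (pderiv h) (monom 1 l) * monom 1 l) z"
      unfolding ipoly.map_mult poly_mult comp cint.map_poly_monom' poly_monom
      by (metis mult.assoc mult.right_neutral mult_1 of_int_1)
    define K where "K = G * pcompose (pderiv h) (monom 1 l) * monom 1 l"
    \<comment> \<open>Below the degree of \<open>m\<close> an integer polynomial is determined by
      its value at \<open>z\<close>, so after reduction modulo the monic \<open>m\<close> constant
      coefficients can be compared.\<close>
    obtain Q R where QR: "K = m * Q + R" "degree R < degree m"
      using monic_division'[OF m(1) int_minimal_poly_degree_pos[OF m(1,2)]] by blast
    define E where "E = [:int N:] - smult (int l) R"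
    have "int_eval K z = int_eval R z"
      using m(2) by (simp add: QR(1) ipoly.map_add ipoly.map_mult)
    then have "int_eval E z = 0"
      using N_eq by (simp add: E_def K_def[symmetric] ipoly.map_diff cint.map_poly_pCons' cint.map_poly_smult')
    then have "m dvd E"
      by (rule m(3))
    moreover have "degree E < degree m"
      unfolding E_def using QR(2) by (intro degree_diff_less) (auto intro: le_less_trans)
    ultimately have "E = 0"
      using dvd_imp_degree_le[of m E] by force
    then have "coeff E 0 = 0"
      by simp
    then have "int N = int l * coeff R 0"
      by (simp add: E_def)
    then have "l dvd N"
      by (metis dvd_triv_left int_dvd_int_iff)
    with l(2) show False ..
  qed
  moreover obtain k where "g = m * k"
    using m(3)[OF g] ..
  ultimately show ?thesis
    by (simp add: ipoly.map_mult)
qed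

text \<open>Induction over the prime factors of \<open>s\<close>. The root \<open>z\<close> must
  vary, as \<open>z ^ l\<close> is again an \<open>N\<close>-th root of unity at which
  \<open>g\<close> vanishes.\<close>

lemma int_conjugate_power:
  assumes N: "N > 0" and "z ^ N = 1" and "coprime s N" "s > 0"
    and g: "int_eval g z = 0"
  shows "int_eval g (z ^ s) = 0"
  using assms(2-5)
proof (induction s arbitrary: z rule: prime_divisors_induct)
  case (unit s)
  then show ?case
    by simp
next
  case (factor l s)
  have "\<not> l dvd N"
    using factor.hyps factor.prems(2) by (metis coprime_common_divisor_nat dvd_triv_left not_prime_1)
  then have "int_eval g (z ^ l) = 0"
    using int_conjugate_prime_power[OF N factor.prems(1) factor.hyps] factor.prems by blast
  moreover have "(z ^ l) ^ N = 1"
    using factor.prems(1) by (metis mult.commute power_mult power_one)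
  ultimately have "int_eval g ((z ^ l) ^ s) = 0"
    using factor.prems by (intro factor.IH) auto
  then show ?case
    by (simp add: power_mult)
qed simp

lemma rat_conjugate_power:
  assumes "N > 0" "z ^ N = 1" "coprime s N" "s > 0" "poly (complex_poly g) z = 0"
  shows "poly (complex_poly g) (z ^ s) = 0"
proof -
  obtain d h where dh: "d > 0" "map_poly of_int h = smult (of_int d) g"
    using ex_int_poly_multiple by blast
  have *: "int_eval h w = of_int d * poly (complex_poly g) w" for w
    unfolding complex_poly_of_int_poly[symmetric] dh(2) by (simp add: rat.map_poly_smult')
  then have "int_eval h (z ^ s) = 0"
    using assms by (intro int_conjugate_power) auto
  then show ?thesis
    using * dh(1) by simp
qed

section \<open>A Kummer element that is not a power\<close>

lemma power_add_cong:
  fixes a q :: int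
  shows "[(a + q) ^ N = a ^ N + of_nat N * a ^ (N - 1) * q] (mod q ^ 2)"
proof (induction N)
  case (Suc N)
  have "[(a + q) ^ Suc N = (a ^ N + of_nat N * a ^ (N - 1) * q) * (a + q)] (mod q ^ 2)"
    using cong_mult[OF Suc cong_refl[of "a + q"]] by (simp add: mult.commute)
  also have "(a ^ N + of_nat N * a ^ (N - 1) * q) * (a + q) =
      a ^ Suc N + of_nat (Suc N) * a ^ (Suc N - 1) * q + q ^ 2 * (of_nat N * a ^ (N - 1))"
    by (cases N) (simp_all add: algebra_simps power2_eq_square)
  also have "[\<dots> = a ^ Suc N + of_nat (Suc N) * a ^ (Suc N - 1) * q] (mod q ^ 2)"
    by (simp add: Cong.cong_def)
  finally show ?case .
qed simp

lemma poly_cong_int: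
  fixes f :: "int poly"
  assumes "[x = y] (mod m)"
  shows "[poly f x = poly f y] (mod m)"
  using assms by (induction f) (auto intro!: cong_add cong_mult)

locale primitive_unity_root =
  fixes N :: nat and \<zeta> :: complex
  assumes N: "N \<ge> 2" and \<zeta>: "\<zeta> ^ N = 1" "\<And>d. 0 < d \<Longrightarrow> d < N \<Longrightarrow> \<zeta> ^ d \<noteq> 1"
begin

text \<open>The \<open>N\<close>-th cyclotomic polynomial, characterised as the integer minimal
  polynomial of \<open>\<zeta>\<close>.\<close>

definition m :: "int poly" where
  "m = (SOME m. lead_coeff m = 1 \<and> int_eval m \<zeta> = 0 \<and> (\<forall>g. int_eval g \<zeta> = 0 \<longrightarrow> m dvd g))"

lemma m: "lead_coeff m = 1" "int_eval m \<zeta> = 0" "int_eval g \<zeta> = 0 \<Longrightarrow> m dvd g"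
proof -
  have "int_eval (monom 1 N - 1) \<zeta> = 0" "lead_coeff (monom 1 N - 1 :: int poly) = 1"
    using N \<zeta> lead_coeff_unity_poly by (simp_all add: int_eval_unity_poly)
  then have "\<exists>m. lead_coeff m = 1 \<and> int_eval m \<zeta> = 0 \<and> (\<forall>g. int_eval g \<zeta> = 0 \<longrightarrow> m dvd g)"
    using ex_int_minimal_poly by metis
  from someI_ex[OF this] show "lead_coeff m = 1" "int_eval m \<zeta> = 0" "int_eval g \<zeta> = 0 \<Longrightarrow> m dvd g"
    unfolding m_def by blast+
qed

lemma unity_poly_factor:
  obtains h where "monom 1 N - 1 = m * h"
  using m(3)[of "monom 1 N - 1"] \<zeta> by (auto simp: int_eval_unity_poly)

lemma poly_m_dvd: "poly m x dvd x ^ N - 1"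
proof -
  obtain h where "monom 1 N - 1 = m * h"
    using unity_poly_factor .
  then have "poly (monom 1 N - 1) x = poly m x * poly h x"
    by simp
  then show ?thesis
    by (simp add: poly_monom)
qed

text \<open>\<open>m\<close> is nonconstant, so its value at some multiple \<open>a\<close> of
  \<open>N\<close> is not 0, 1 or -1. A prime factor of this value divides \<open>a ^ N - 1\<close>
  and is therefore prime to \<open>a\<close> and to \<open>N\<close>.\<close>

lemma ex_prime_dvd_poly_m:
  obtains q a :: nat where "prime q" "int q dvd poly m (int a)" "\<not> q dvd N" "\<not> q dvd a"
proof -
  have "m \<noteq> 0" "degree m > 0"
    using m(1) int_minimal_poly_degree_pos[OF m(1,2)] by auto
  have fin: "finite {x. poly m x = c}" for c
  proof -
    have "m - [:c:] \<noteq> 0"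
      using \<open>degree m > 0\<close> by (metis degree_pCons_0 eq_iff_diff_eq_0 less_irrefl)
    then have "finite {x. poly (m - [:c:]) x = 0}"
      by (rule poly_roots_finite)
    then show ?thesis
      by simp
  qed
  have "{x. poly m x \<in> {-1, 0, 1}} = {x. poly m x = -1} \<union> {x. poly m x = 0} \<union> {x. poly m x = 1}"
    by auto
  then have "finite {x. poly m x \<in> {-1, 0, 1}}"
    using fin by simp
  moreover have "infinite (range (\<lambda>t::nat. int (N * t)))"
    using N by (intro range_inj_infinite) (simp add: inj_on_def)
  ultimately obtain t where t: "poly m (int (N * t)) \<notin> {-1, 0, 1}"
    by (metis (mono_tags, lifting) finite_subset image_subsetI mem_Collect_eq)
  then have "\<not> is_unit (poly m (int (N * t)))"
    by auto
  then obtain r where r: "r dvd poly m (int (N * t))" "prime r"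
    using prime_divisor_exists t by blast
  define q where "q = nat r"
  have q: "prime q" "r = int q"
    using r(2) by (simp_all add: q_def prime_ge_0_int)
  have dvd1: "int q dvd int (N * t) ^ N - 1"
    using r(1) poly_m_dvd dvd_trans unfolding q(2) by blast
  have "\<not> q dvd N * t"
  proof
    assume "q dvd N * t"
    then have "int q dvd int (N * t) ^ N"
      using N by (meson dvd_power dvd_trans int_dvd_int_iff less_le_trans pos2)
    then have "int q dvd 1"
      using dvd1 by (metis dvd_diff_right_iff dvd_diff_commute)
    then show False
      using q(1) by simp
  qed
  moreover from this have "\<not> q dvd N"
    by (metis dvd_mult2)
  ultimately show ?thesis
    using that[of q "N * t"] q(1) r(1) unfolding q(2) by blast
qed

text \<open>If the order of \<open>a\<close> modulo \<open>q\<close> were \<open>D < N\<close>, then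
  \<open>m\<close> would divide \<open>(X ^ N - 1) / (X ^ D - 1)\<close>, whose value at
  \<open>a\<close> is \<open>N / D\<close> modulo \<open>q\<close>, a nonzero residue.\<close>

lemma no_smaller_order:
  assumes q: "prime q" "int q dvd poly m a" "\<not> q dvd N" and d: "0 < d" "d < N"
  shows "\<not> int q dvd a ^ d - 1"
proof
  assume "int q dvd a ^ d - 1"
  define D where "D = (LEAST D. 0 < D \<and> int q dvd a ^ D - 1)"
  have D: "0 < D" "int q dvd a ^ D - 1" "D \<le> d"
    using LeastI[of "\<lambda>D. 0 < D \<and> int q dvd a ^ D - 1" d] Least_le[of "\<lambda>D. 0 < D \<and> int q dvd a ^ D - 1" d]
      d \<open>int q dvd a ^ d - 1\<close> unfolding D_def by auto
  have aN: "[a ^ N = 1] (mod int q)"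
    using q(2) poly_m_dvd dvd_trans by (auto simp: cong_iff_dvd_diff)
  have aD: "[a ^ D = 1] (mod int q)"
    using D(2) by (simp add: cong_iff_dvd_diff)
  have "[a ^ (N mod D) = 1] (mod int q)"
  proof -
    have "[(a ^ D) ^ (N div D) * a ^ (N mod D) = 1 ^ (N div D) * a ^ (N mod D)] (mod int q)"
      by (intro cong_mult cong_pow aD cong_refl)
    moreover have "(a ^ D) ^ (N div D) * a ^ (N mod D) = a ^ N"
      by (simp flip: power_mult power_add)
    ultimately show ?thesis
      using aN cong_sym cong_trans by fastforce
  qed
  then have "N mod D = 0"
    using not_less_Least[of "N mod D" "\<lambda>D. 0 < D \<and> int q dvd a ^ D - 1"] D(1)
    by (auto simp: D_def[symmetric] cong_iff_dvd_diff)
  then obtain k where k: "N = D * k"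
    by auto
  define E where "E = (\<Sum>j<k. monom 1 (D * j) :: int poly)"
  have "(\<zeta> ^ D - 1) * int_eval E \<zeta> = \<zeta> ^ N - 1"
    using power_diff_1_eq[of "\<zeta> ^ D" k]
    by (simp add: E_def ipoly.map_sum poly_sum cint.map_poly_monom' poly_monom power_mult k)
  then have "int_eval E \<zeta> = 0"
    using \<zeta> D d by simp
  then have "m dvd E"
    by (rule m(3))
  then have "poly m a dvd poly E a"
    by (auto elim!: dvdE)
  then have "int q dvd poly E a"
    using q(2) dvd_trans by blast
  moreover have "[poly E a = int k] (mod int q)"
  proof -
    have "[(\<Sum>j<k. (a ^ D) ^ j) = (\<Sum>j<k. 1 ^ j)] (mod int q)"
      by (intro cong_sum cong_pow aD)
    then show ?thesis
      by (simp add: E_def poly_sum poly_monom power_mult)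
  qed
  ultimately have "int q dvd int k"
    using cong_dvd_iff by blast
  then show False
    using q(3) k by auto
qed

text \<open>If \<open>q ^ 2\<close> divides \<open>b ^ N - 1\<close>, passing to
  \<open>b + q\<close> adds \<open>N * b ^ (N - 1) * q\<close> modulo \<open>q ^ 2\<close>, which is
  nonzero. In terms of ideals, \<open>(q, a - \<zeta>)\<close> is a prime that divides
  \<open>a - \<zeta>\<close> exactly once and none of its other conjugates.\<close>

lemma ex_unramified_prime:
  obtains q :: nat and a :: int where "prime q" "int q dvd poly m a" "\<not> q dvd N" "\<not> int q dvd a"
    "\<not> int q ^ 2 dvd a ^ N - 1" "\<And>d. 0 < d \<Longrightarrow> d < N \<Longrightarrow> \<not> int q dvd a ^ d - 1"
proof -
  obtain q b :: nat where qb: "prime q" "int q dvd poly m (int b)" "\<not> q dvd N" "\<not> q dvd b"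
    using ex_prime_dvd_poly_m .
  show ?thesis
  proof (cases "int q ^ 2 dvd int b ^ N - 1")
    case False
    then show ?thesis
      using that[of q "int b"] qb no_smaller_order by auto
  next
    case True
    define a where "a = int b + int q"
    have c: "[a = int b] (mod int q)"
      by (simp add: a_def Cong.cong_def)
    have "\<not> int q ^ 2 dvd a ^ N - 1"
    proof
      assume "int q ^ 2 dvd a ^ N - 1"
      then have "[1 = a ^ N] (mod int q ^ 2)"
        by (simp add: cong_iff_dvd_diff dvd_diff_commute)
      also have "[a ^ N = int b ^ N + int N * int b ^ (N - 1) * int q] (mod int q ^ 2)"
        unfolding a_def by (rule power_add_cong)
      also have "[int b ^ N + int N * int b ^ (N - 1) * int q = 1 + int N * int b ^ (N - 1) * int q] (mod int q ^ 2)"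
        using True by (intro cong_add cong_refl) (simp add: cong_iff_dvd_diff)
      finally have "int q ^ 2 dvd int N * int b ^ (N - 1) * int q"
        by (simp add: cong_iff_dvd_diff)
      then have "int q dvd int N * int b ^ (N - 1)"
        using qb(1) prime_gt_0_nat by (simp add: power2_eq_square)
      then have "q dvd N * b ^ (N - 1)"
        by (metis int_dvd_int_iff of_nat_mult of_nat_power)
      then show False
        using qb prime_dvd_power by (auto simp: prime_dvd_mult_iff)
    qed
    moreover have "int q dvd poly m a"
      using poly_cong_int[OF c] qb(2) cong_dvd_iff by blast
    moreover have "\<not> int q dvd a"
      using c qb(4) cong_dvd_iff[of a "int b" "int q"] by simp
    ultimately show ?thesis
      using that[of q a] qb no_smaller_order by blast
  qed
qed

text \<open>
  With \<open>q\<close> and \<open>a\<close> as below, reduction modulo \<open>q ^ k\<close> along \<open>\<zeta> \<mapsto> a ^ q ^ k\<close> acts like a valuation in which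
  \<open>a - \<zeta>\<close> has value 1 while its other conjugates are units.
\<close>

lemma conjugate_product_not_power:
  assumes q: "prime q" "int q dvd poly m a" "\<not> q dvd N" "\<not> int q dvd a" "\<not> int q ^ 2 dvd a ^ N - 1"
      "\<And>d. 0 < d \<Longrightarrow> d < N \<Longrightarrow> \<not> int q dvd a ^ d - 1"
    and A: "A \<subseteq> {1..<N}" "1 \<in> A"
    and c: "\<not> p dvd c 1" and "p > 0"
  shows "poly (complex_poly g) \<zeta> ^ p \<noteq> (\<Prod>s\<in>A. (of_int a - \<zeta> ^ s) ^ c s)"
proof
  assume eq: "poly (complex_poly g) \<zeta> ^ p = (\<Prod>s\<in>A. (of_int a - \<zeta> ^ s) ^ c s)"
  have finA: "finite A"
    using A(1) finite_subset by blast
  have q0: "q > 1"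
    using q(1) prime_gt_1_nat by blast
  have pq: "prime (int q)"
    using q(1) by simp
  obtain d h where dh: "d > 0" "map_poly of_int h = smult (of_int d) g"
    using ex_int_poly_multiple by blast
  have h: "int_eval h \<zeta> = of_int d * poly (complex_poly g) \<zeta>"
    unfolding complex_poly_of_int_poly[symmetric] dh(2) by (simp add: rat.map_poly_smult')
  define T where "T = (\<Prod>s\<in>A. ([:a:] - monom 1 s) ^ c s)"
  \<comment> \<open>One more than the valuation at \<open>q\<close> that \<open>d ^ p * T\<close>
    will have at \<open>r\<close>, so that a congruence modulo \<open>q ^ k\<close> still detects
    it.\<close>
  define k where "k = p * multiplicity (int q) d + c 1 + 1"
  \<comment> \<open>An approximate Teichmueller lift: congruent to \<open>a\<close> modulo
    \<open>q\<close> and an \<open>N\<close>-th root of unity modulo \<open>q ^ k\<close>.\<close>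
  define r where "r = a ^ (q ^ k)"
  have "int_eval (smult (d ^ p) T - h ^ p) \<zeta> = 0"
    using eq by (simp add: T_def ipoly.map_diff cint.map_poly_smult' ipoly.map_power ipoly.map_prod h
        poly_prod cint.map_poly_pCons' cint.map_poly_monom' poly_monom power_mult_distrib)
  then obtain w where w: "smult (d ^ p) T - h ^ p = m * w"
    using m(3) by blast
  have aN: "[a ^ N = 1] (mod int q)"
    using q(2) poly_m_dvd dvd_trans by (auto simp: cong_iff_dvd_diff)
  have ra: "[r = a] (mod int q)"
  proof -
    have "[a ^ (q ^ j) = a] (mod int q)" for j
    proof (induction j)
      case (Suc j)
      have "[(a ^ (q ^ j)) ^ q = a ^ (q ^ j)] (mod int q)"
        by (rule int_fermat[OF q(1)])
      with Suc show ?case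
        using cong_trans by (metis mult.commute power_Suc power_mult)
    qed simp
    then show ?thesis
      by (simp add: r_def)
  qed
  have rN: "[r ^ N = 1] (mod int q ^ k)"
  proof -
    \<comment> \<open>For \<open>x = 1\<close> modulo \<open>q\<close>, the cofactor of
      \<open>x - 1\<close> in \<open>x ^ q - 1\<close> is a sum of \<open>q\<close> terms congruent
      to 1, so each \<open>q\<close>-th power gains a factor \<open>q\<close>.\<close>
    have "int q ^ Suc j dvd (a ^ N) ^ (q ^ j) - 1" for j
    proof (induction j)
      case 0
      then show ?case
        using aN by (simp add: cong_iff_dvd_diff)
    next
      case (Suc j)
      define x where "x = (a ^ N) ^ (q ^ j)"
      have "int q dvd x - 1"
        using Suc dvd_trans[of "int q" "int q ^ Suc j"] by (simp add: x_def)
      then have x: "[x = 1] (mod int q)"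
        by (simp add: cong_iff_dvd_diff)
      have "[(\<Sum>i<q. x ^ i) = (\<Sum>i<q. 1 ^ i)] (mod int q)"
        by (intro cong_sum cong_pow x)
      then have "int q dvd (\<Sum>i<q. x ^ i)"
        using cong_dvd_iff by fastforce
      then have "int q ^ Suc j * int q dvd (x - 1) * (\<Sum>i<q. x ^ i)"
        using Suc by (intro mult_dvd_mono) (simp_all add: x_def)
      also have "(x - 1) * (\<Sum>i<q. x ^ i) = (a ^ N) ^ (q ^ Suc j) - 1"
        unfolding power_diff_1_eq[symmetric] x_def by (simp flip: power_mult add: mult_ac)
      finally show ?case
        by (simp add: mult.commute)
    qed
    then have "int q ^ Suc k dvd r ^ N - 1"
      unfolding r_def by (metis mult.commute power_mult)
    then show ?thesis
      by (meson cong_iff_dvd_diff dvd_trans le_imp_power_dvd lessI less_imp_le)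
  qed
  have rq: "\<not> int q dvd r"
    using ra q(4) cong_dvd_iff by blast
  \<comment> \<open>\<open>X ^ N - 1\<close> has no double roots modulo \<open>q\<close>, so the
    whole divisibility of \<open>r ^ N - 1\<close> by \<open>q ^ k\<close> falls on the factor
    \<open>m\<close>.\<close>
  have mr: "int q ^ k dvd poly m r"
  proof -
    obtain f where f: "monom 1 N - 1 = m * f"
      using unity_poly_factor .
    have "\<not> int q dvd poly f r"
    proof
      assume fr: "int q dvd poly f r"
      have mrq: "int q dvd poly m r"
        using poly_cong_int[OF ra] q(2) cong_dvd_iff by blast
      have "pderiv (monom 1 N - 1 :: int poly) = pderiv m * f + m * pderiv f"
        by (simp add: f pderiv_mult algebra_simps)
      then have "poly (monom (int N) (N - 1)) r = poly (pderiv m * f + m * pderiv f) r"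
        by (simp add: pderiv_diff pderiv_monom)
      then have "int N * r ^ (N - 1) = poly (pderiv m) r * poly f r + poly m r * poly (pderiv f) r"
        by (simp add: poly_monom)
      then have "int q dvd int N * r ^ (N - 1)"
        using fr mrq by simp
      then have "int q dvd int N \<or> int q dvd r ^ (N - 1)"
        using pq by (simp add: prime_dvd_mult_iff)
      then show False
        using q(3) rq prime_dvd_power[OF pq] by fastforce
    qed
    then have "coprime (int q ^ k) (poly f r)"
      using pq by (simp add: prime_imp_coprime)
    moreover have "r ^ N - 1 = poly m r * poly f r"
      using arg_cong[OF f, of "\<lambda>u. poly u r"] by (simp add: poly_monom)
    ultimately show ?thesis
      using rN by (simp add: cong_iff_dvd_diff coprime_dvd_mult_left_iff)
  qed
  \<comment> \<open>A second factor \<open>q\<close> in \<open>a - r\<close> would give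
    \<open>a ^ N = r ^ N = 1\<close> modulo \<open>q ^ 2\<close>.\<close>
  have v1: "multiplicity (int q) (a - r) = 1"
  proof (rule multiplicity_eqI)
    show "int q ^ 1 dvd a - r"
      using ra by (simp add: cong_iff_dvd_diff dvd_diff_commute)
    show "\<not> int q ^ Suc 1 dvd a - r"
    proof
      assume "int q ^ Suc 1 dvd a - r"
      then have "[a = r] (mod int q ^ 2)"
        by (simp add: cong_iff_dvd_diff power2_eq_square)
      then have "[a ^ N = r ^ N] (mod int q ^ 2)"
        by (rule cong_pow)
      also have "[r ^ N = 1] (mod int q ^ 2)"
      proof (rule cong_dvd_modulus[OF rN])
        \<comment> \<open>This makes \<open>k\<close> at least 2.\<close>
        have "c 1 \<noteq> 0"
          using c by (intro notI) simp
        then show "int q ^ 2 dvd int q ^ k"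
          by (intro le_imp_power_dvd) (simp add: k_def)
      qed
      finally show False
        using q(5) by (simp add: cong_iff_dvd_diff)
    qed
  qed
  \<comment> \<open>\<open>a = a ^ s\<close> modulo \<open>q\<close> would make the order of
    \<open>a\<close> a divisor of \<open>s - 1 < N\<close>.\<close>
  have v0: "\<not> int q dvd a - r ^ s" if s: "s \<in> A - {1}" for s
  proof
    assume "int q dvd a - r ^ s"
    then have "[a = r ^ s] (mod int q)"
      by (simp add: cong_iff_dvd_diff)
    also have "[r ^ s = a ^ s] (mod int q)"
      using ra by (rule cong_pow)
    finally have "int q dvd a ^ s - a"
      by (simp add: cong_iff_dvd_diff dvd_diff_commute)
    moreover have s': "s > 1" "s < N"
      using s A(1) by force+
    then have "a ^ s - a = a * (a ^ (s - 1) - 1)"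
      by (simp add: algebra_simps power_eq_if)
    ultimately have "int q dvd a ^ (s - 1) - 1"
      using pq q(4) by (simp add: prime_dvd_mult_iff)
    then show False
      using q(6)[of "s - 1"] s' by linarith
  qed
  have Tr: "poly T r = (\<Prod>s\<in>A. (a - r ^ s) ^ c s)"
    by (simp add: T_def poly_prod poly_monom)
  have nz1: "a - r \<noteq> 0"
    using v1 by auto
  have nz: "a - r ^ s \<noteq> 0" if "s \<in> A" for s
    using v0[of s] nz1 that by (cases "s = 1") auto
  have "multiplicity (int q) (poly T r) = (\<Sum>s\<in>A. c s * multiplicity (int q) (a - r ^ s))"
    unfolding Tr using finA pq nz
    by (subst prime_elem_multiplicity_prod_distrib) (auto simp: prime_elem_multiplicity_power_distrib)
  also have "\<dots> = c 1 * multiplicity (int q) (a - r ^ 1) + (\<Sum>s\<in>A - {1}. c s * multiplicity (int q) (a - r ^ s))"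
    using finA A(2) by (rule sum.remove)
  also have "\<dots> = c 1"
    using v1 v0 by (simp add: not_dvd_imp_multiplicity_0)
  finally have "multiplicity (int q) (poly T r) = c 1" .
  moreover have "poly T r \<noteq> 0"
    unfolding Tr using finA nz by simp
  ultimately have ml: "multiplicity (int q) (d ^ p * poly T r) = k - 1"
    using dh(1) pq by (simp add: prime_elem_multiplicity_mult_distrib prime_elem_multiplicity_power_distrib k_def)
  have "d ^ p * poly T r - poly h r ^ p = poly m r * poly w r"
    using arg_cong[OF w, of "\<lambda>u. poly u r"] by simp
  then have diff: "int q ^ k dvd d ^ p * poly T r - poly h r ^ p"
    using mr by simp
  have nunit: "\<not> is_unit (int q)" and nzT: "d ^ p * poly T r \<noteq> 0"
    using q0 \<open>poly T r \<noteq> 0\<close> dh(1) by auto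
  have k1: "k = Suc (k - 1)"
    by (simp add: k_def)
  have "multiplicity (int q) (poly h r ^ p) = k - 1"
  proof (rule multiplicity_eqI)
    have "int q ^ (k - 1) dvd d ^ p * poly T r"
      using multiplicity_dvd[of "int q" "d ^ p * poly T r"] ml by simp
    moreover have "int q ^ (k - 1) dvd d ^ p * poly T r - poly h r ^ p"
      using diff dvd_trans[OF le_imp_power_dvd[of "k - 1" k "int q"]] by simp
    ultimately show "int q ^ (k - 1) dvd poly h r ^ p"
      by (metis dvd_diff_right_iff)
    show "\<not> int q ^ Suc (k - 1) dvd poly h r ^ p"
    proof
      assume "int q ^ Suc (k - 1) dvd poly h r ^ p"
      then have "int q ^ Suc (k - 1) dvd d ^ p * poly T r"
        using diff k1 by (metis dvd_diff_left_iff)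
      then have "Suc (k - 1) \<le> multiplicity (int q) (d ^ p * poly T r)"
        using nunit nzT by (metis multiplicity_geI)
      then show False
        using ml by simp
    qed
  qed
  moreover have "poly h r \<noteq> 0"
  proof
    assume "poly h r = 0"
    then have "int q ^ k dvd d ^ p * poly T r"
      using diff \<open>p > 0\<close> by (simp add: zero_power)
    then have "int q ^ Suc (k - 1) dvd d ^ p * poly T r"
      using k1 by metis
    then have "Suc (k - 1) \<le> multiplicity (int q) (d ^ p * poly T r)"
      using nunit nzT by (metis multiplicity_geI)
    then show False
      using ml by simp
  qed
  \<comment> \<open>A \<open>p\<close>-th power has a valuation divisible by \<open>p\<close>, while
    \<open>k - 1\<close> is \<open>c 1\<close> modulo \<open>p\<close>.\<close>
  ultimately have "p * multiplicity (int q) (poly h r) = k - 1"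
    using pq by (simp add: prime_elem_multiplicity_power_distrib)
  then have "p dvd p * multiplicity (int q) d + c 1"
    by (metis add_diff_cancel_right' dvd_triv_left k_def)
  then show False
    using c by (simp add: dvd_add_right_iff)
qed

end

section \<open>Rationality of Galois invariants\<close>

context primitive_unity_root
begin

lemma power_eq_one_iff: "\<zeta> ^ k = 1 \<longleftrightarrow> N dvd k"
proof -
  have "\<zeta> ^ k = (\<zeta> ^ N) ^ (k div N) * \<zeta> ^ (k mod N)"
    by (simp flip: power_mult power_add)
  also have "\<dots> = \<zeta> ^ (k mod N)"
    by (simp add: \<zeta>(1))
  finally show ?thesis
    using \<zeta>(2)[of "k mod N"] N by (auto simp: mod_eq_0_iff_dvd)
qed

lemma nonzero: "\<zeta> \<noteq> 0"
  using \<zeta>(1) N by (auto simp: power_0_left)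

lemma power_cong: "[j = k] (mod N) \<Longrightarrow> \<zeta> ^ j = \<zeta> ^ k"
proof -
  have "\<zeta> ^ k = \<zeta> ^ (k mod N)" for k
  proof -
    have "\<zeta> ^ k = (\<zeta> ^ N) ^ (k div N) * \<zeta> ^ (k mod N)"
      by (simp flip: power_mult power_add)
    then show ?thesis
      by (simp add: \<zeta>(1))
  qed
  then show "[j = k] (mod N) \<Longrightarrow> \<zeta> ^ j = \<zeta> ^ k"
    unfolding Cong.cong_def by metis
qed

text \<open>If \<open>i\<close> and \<open>N\<close> share a factor, then \<open>z ^ d = 1\<close>
  with \<open>d < N\<close>, so the minimal polynomial \<open>mz\<close> of \<open>z\<close> divides
  \<open>m\<close> without vanishing at \<open>\<zeta>\<close>. The cofactor would vanish at
  \<open>\<zeta>\<close> and be a nonzero multiple of \<open>m\<close> of smaller degree.\<close>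

lemma roots_of_m:
  assumes "int_eval m z = 0" "z ^ N = 1" "z = \<zeta> ^ i" "i > 0"
  shows "coprime i N"
proof (rule ccontr)
  assume "\<not> coprime i N"
  define g where "g = gcd i N"
  have "g \<noteq> 1" "g \<noteq> 0"
    using \<open>\<not> coprime i N\<close> N by (auto simp: g_def coprime_iff_gcd_eq_1)
  then have "g > 1"
    by linarith
  then have g: "g > 1" "g dvd i" "g dvd N"
    by (simp_all add: g_def)
  define d where "d = N div g"
  have d: "N = g * d"
    using g by (simp add: d_def)
  have d0: "d > 0" "d < N"
    using N g(1) by (auto simp: d intro: gr0I)
  obtain j where j: "i = g * j"
    using g(2) ..
  have "z ^ d = (\<zeta> ^ N) ^ j"
    by (simp add: assms(3) j d mult_ac flip: power_mult)
  then have zd: "int_eval (monom 1 d - 1) z = 0"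
    by (simp add: int_eval_unity_poly \<zeta>(1))
  obtain mz where mz: "lead_coeff mz = 1" "int_eval mz z = 0" "\<And>g. int_eval g z = 0 \<Longrightarrow> mz dvd g"
    using ex_int_minimal_poly[OF zd lead_coeff_unity_poly[OF d0(1)]] by blast
  obtain k where k: "m = mz * k"
    using mz(3)[OF assms(1)] ..
  have "int_eval mz \<zeta> \<noteq> 0"
  proof
    assume "int_eval mz \<zeta> = 0"
    then have "m dvd monom 1 d - 1"
      using m(3) mz(3)[OF zd] dvd_trans by blast
    then obtain f where "monom 1 d - 1 = m * f" ..
    then have "int_eval (monom 1 d - 1) \<zeta> = 0"
      using m(2) by (simp add: ipoly.map_mult)
    then show False
      using \<zeta>(2)[OF d0] by (simp add: int_eval_unity_poly)
  qed
  then have "int_eval k \<zeta> = 0"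
    using m(2) by (simp add: k ipoly.map_mult)
  then have "m dvd k"
    by (rule m(3))
  moreover have "k \<noteq> 0" "mz \<noteq> 0"
    using m(1) k by auto
  ultimately have "degree m \<le> degree k"
    by (simp add: dvd_imp_degree_le)
  moreover have "degree m = degree mz + degree k"
    using \<open>k \<noteq> 0\<close> \<open>mz \<noteq> 0\<close> by (simp add: k degree_mult_eq)
  ultimately show False
    using int_minimal_poly_degree_pos[OF mz(1,2)] by simp
qed

text \<open>\<open>m\<close> divides \<open>X ^ N - 1\<close>, whose derivative
  \<open>N * X ^ (N - 1)\<close> does not vanish at its roots, so all roots of \<open>m\<close> are
  simple.\<close>

lemma card_roots_of_m: "card {z. int_eval m z = 0} = degree m"
proof -
  obtain h where h: "monom 1 N - 1 = m * h"
    using unity_poly_factor .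
  define M where "M = map_poly complex_of_int m"
  have pd: "pderiv (map_poly complex_of_int f) = map_poly of_int (pderiv f)" for f
    by (rule poly_eqI) (simp add: coeff_pderiv cint.coeff_map_poly')
  have "\<not> (poly M z = 0 \<and> poly (pderiv M) z = 0)" for z
  proof
    assume *: "poly M z = 0 \<and> poly (pderiv M) z = 0"
    then have z: "int_eval m z = 0" "int_eval (pderiv m) z = 0"
      by (simp_all add: M_def pd)
    have "int_eval (monom 1 N - 1) z = 0"
      using z by (simp add: h ipoly.map_mult)
    then have zN: "z ^ N = 1"
      by (simp add: int_eval_unity_poly)
    have "pderiv (monom 1 N - 1 :: int poly) = pderiv m * h + m * pderiv h"
      by (simp add: h pderiv_mult algebra_simps)
    then have "int_eval (monom (int N) (N - 1)) z = int_eval (pderiv m * h + m * pderiv h) z"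
      by (simp add: pderiv_diff pderiv_monom)
    then have "of_nat N * z ^ (N - 1) = 0"
      using z by (simp add: ipoly.map_add ipoly.map_mult cint.map_poly_monom' poly_monom)
    then show False
      using zN N by (auto simp: power_0_left split: if_splits)
  qed
  then have "rsquarefree M"
    by (simp add: rsquarefree_roots)
  then have M: "smult (lead_coeff M) (\<Prod>z | poly M z = 0. [:- z, 1:]) = M" and "M \<noteq> 0"
    using complex_poly_decompose_rsquarefree by (auto simp: rsquarefree_def)
  have "degree M = degree (\<Prod>z | poly M z = 0. [:- z, 1:])"
    using arg_cong[OF M, of degree] \<open>M \<noteq> 0\<close> by simp
  also have "\<dots> = card {z. poly M z = 0}"
    by (subst degree_prod_eq_sum_degree) simp_all
  finally have "degree M = card {z. poly M z = 0}" .
  then show ?thesis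
    by (simp add: M_def degree_of_int_poly)
qed

text \<open>The remainder \<open>R\<close> of \<open>g\<close> modulo \<open>m\<close> takes the
  same value at all \<open>degree m\<close> roots of \<open>m\<close>, since each of them is
  \<open>\<zeta> ^ i\<close> with \<open>i\<close> prime to \<open>N\<close>. Having smaller degree
  it is constant, and its coefficients are rational.\<close>

lemma rational_if_invariant:
  assumes "\<And>t. t > 0 \<Longrightarrow> coprime t N \<Longrightarrow> poly (complex_poly g) (\<zeta> ^ t) = poly (complex_poly g) \<zeta>"
  shows "poly (complex_poly g) \<zeta> \<in> \<rat>"
proof -
  define mq where "mq = map_poly (of_int :: int \<Rightarrow> rat) m"
  have degree_mq: "degree mq = degree m"
    unfolding mq_def by (intro degree_map_poly) auto
  have "lead_coeff mq = 1" "degree mq > 0"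
    using m(1) int_minimal_poly_degree_pos[OF m(1,2)]
    by (simp_all add: degree_mq) (simp add: mq_def ratint.coeff_map_poly' degree_mq[unfolded mq_def])
  then obtain Q R where QR: "g = mq * Q + R" "degree R < degree m"
    using monic_division'[of mq g] degree_mq by metis
  define w where "w = poly (complex_poly g) \<zeta>"
  have mq: "poly (complex_poly mq) z = int_eval m z" for z
    by (simp add: mq_def complex_poly_of_int_poly)
  have "poly (complex_poly R) z = w" if z: "int_eval m z = 0" for z
  proof -
    obtain h where h: "monom 1 N - 1 = m * h"
      using unity_poly_factor .
    have "int_eval (monom 1 N - 1) z = 0"
      using z by (simp add: h ipoly.map_mult)
    then have zN: "z ^ N = 1"
      by (simp add: int_eval_unity_poly)
    obtain i where i: "i > 0" "z = \<zeta> ^ i"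
    proof -
      have inj: "inj_on (\<lambda>i. \<zeta> ^ i) {..<N}"
      proof (rule inj_onI)
        have *: "i = j" if "i \<le> j" "j < N" "\<zeta> ^ i = \<zeta> ^ j" for i j
        proof -
          have "\<zeta> ^ i * \<zeta> ^ (j - i) = \<zeta> ^ j"
            using \<open>i \<le> j\<close> by (simp flip: power_add)
          then have "\<zeta> ^ i * \<zeta> ^ (j - i) = \<zeta> ^ i * 1"
            using that(3) by simp
          then have "\<zeta> ^ (j - i) = 1"
            using nonzero by simp
          then have "N dvd j - i"
            by (simp add: power_eq_one_iff)
          then show "i = j"
            using that by (auto dest: dvd_imp_le)
        qed
        fix i j assume "i \<in> {..<N}" "j \<in> {..<N}" "\<zeta> ^ i = \<zeta> ^ j"
        then show "i = j"
          using *[of i j] *[of j i] by (cases "i \<le> j") auto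
      qed
      have "(\<lambda>i. \<zeta> ^ i) ` {..<N} = {z. z ^ N = 1}"
      proof (rule card_seteq)
        show "finite {z::complex. z ^ N = 1}"
          using N by (intro finite_roots_unity) simp
        show "(\<lambda>i. \<zeta> ^ i) ` {..<N} \<subseteq> {z. z ^ N = 1}"
          by (auto simp: power_eq_one_iff simp flip: power_mult)
        show "card {z::complex. z ^ N = 1} \<le> card ((\<lambda>i. \<zeta> ^ i) ` {..<N})"
          using N by (simp add: card_image[OF inj] card_roots_unity_eq)
      qed
      then obtain i where "z = \<zeta> ^ i"
        using zN by blast
      \<comment> \<open>Adding \<open>N\<close> makes the exponent positive.\<close>
      then have "z = \<zeta> ^ (i + N)"
        by (simp add: power_add \<zeta>(1))
      then show thesis
        using N by (intro that[of "i + N"]) auto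
    qed
    have "coprime i N"
      using roots_of_m[OF z zN i(2,1)] .
    then have "poly (complex_poly g) z = w"
      using assms i by (simp add: w_def)
    then show ?thesis
      by (simp add: QR(1) cpoly.map_add cpoly.map_mult mq z)
  qed
  then have sub: "{z. int_eval m z = 0} \<subseteq> {z. poly (complex_poly R - [:w:]) z = 0}"
    by auto
  have "complex_poly R - [:w:] = 0"
  proof (rule ccontr)
    assume nz: "complex_poly R - [:w:] \<noteq> 0"
    have "degree m \<le> card {z. poly (complex_poly R - [:w:]) z = 0}"
      unfolding card_roots_of_m[symmetric] using sub poly_roots_finite[OF nz] by (intro card_mono)
    also have "\<dots> \<le> degree (complex_poly R - [:w:])"
      by (rule card_poly_roots_bound[OF nz])
    also have "\<dots> < degree m"
      using QR(2) by (intro degree_diff_less) (simp_all add: degree_complex_poly)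
    finally show False
      by simp
  qed
  then have "coeff (complex_poly R) 0 = w"
    by simp
  then show ?thesis
    by (metis Rats_of_rat rat.coeff_map_poly' w_def)
qed

end

section \<open>Linear independence of radicals\<close>

text \<open>\<open>B\<close> splits into linear factors with constant terms \<open>- x\<close>, and
  \<open>(- x) ^ p = - \<theta>\<close> because \<open>p\<close> is odd.\<close>

lemma norm_of_radical_factor:
  fixes B :: "complex poly"
  assumes "lead_coeff B = 1" "\<And>z. poly B z = 0 \<Longrightarrow> z ^ p = \<theta>" "odd p"
  shows "poly B 0 ^ p = (- \<theta>) ^ degree B"
proof -
  have "B \<noteq> 0"
    using assms(1) by auto
  then obtain A where A: "size A = degree B" "B = smult (lead_coeff B) (\<Prod>x\<in>#A. [:- x, 1:])"
    using alg_closed_imp_factorization by blast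
  have B: "B = (\<Prod>x\<in>#A. [:- x, 1:])"
    using A(2) assms(1) by simp
  have "z ^ p = \<theta>" if "z \<in># A" for z
  proof (rule assms(2))
    have "[:- z, 1:] dvd B"
      unfolding B using that by (intro dvd_prod_mset) auto
    then show "poly B z = 0"
      by (simp add: poly_eq_0_iff_dvd)
  qed
  then have "(\<Prod>x\<in>#A. (- x) ^ p) = (\<Prod>x\<in>#A. - \<theta>)"
    using assms(3) by (intro arg_cong[of _ _ prod_mset] image_mset_cong) simp
  moreover have "poly B 0 = (\<Prod>x\<in>#A. - x)"
    unfolding B by (simp add: poly_prod_mset multiset.map_comp o_def)
  moreover have "(\<Prod>x\<in>#A. - x) ^ p = (\<Prod>x\<in>#A. (- x) ^ p)"
    by (induction A) (simp_all add: power_mult_distrib del: mult_minus_left)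
  ultimately show ?thesis
    by (simp add: A(1))
qed

text \<open>
  The constant coefficient of a monic factor of degree \<open>d\<close> of \<open>X ^ p - \<theta>\<close> has \<open>p\<close>-th power \<open>(- \<theta>) ^ d\<close>; for
  \<open>0 < d < p\<close> this makes \<open>\<theta>\<close> itself a \<open>p\<close>-th power.
\<close>

lemma radical_linearly_independent:
  fixes M :: "complex set"
  assumes M: "0 \<in> M" "1 \<in> M" "\<And>x y. x \<in> M \<Longrightarrow> y \<in> M \<Longrightarrow> x + y \<in> M" "\<And>x y. x \<in> M \<Longrightarrow> y \<in> M \<Longrightarrow> x * y \<in> M"
      "\<And>x. x \<in> M \<Longrightarrow> - x \<in> M" "\<And>x. x \<in> M \<Longrightarrow> inverse x \<in> M"
    and p: "prime p" "odd p"
    and \<beta>: "\<beta> ^ p = \<theta>" "\<theta> \<in> M" "\<theta> \<noteq> 0" "\<And>x. x \<in> M \<Longrightarrow> x ^ p \<noteq> \<theta>"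
    and P: "\<And>k. coeff P k \<in> M" "degree P < p" "poly P \<beta> = 0"
  shows "P = 0"
proof (rule ccontr)
  assume "P \<noteq> 0"
  define good where "good P \<longleftrightarrow> P \<noteq> 0 \<and> (\<forall>k. coeff P k \<in> M) \<and> poly P \<beta> = 0" for P
  have "good P"
    using P \<open>P \<noteq> 0\<close> by (simp add: good_def)
  then obtain B0 where B0: "good B0" "\<And>Q. good Q \<Longrightarrow> degree B0 \<le> degree Q"
    using ex_has_least_nat[of good P degree] by blast
  define B where "B = smult (inverse (lead_coeff B0)) B0"
  have B: "lead_coeff B = 1" "coeff B k \<in> M" "poly B \<beta> = 0" "degree B = degree B0" for k
    using B0(1) M(4,6) by (auto simp: B_def good_def)
  have "degree B < p"
    using B0(2)[OF \<open>good P\<close>] P(2) B(4) by simp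
  have "degree B > 0"
  proof (rule ccontr)
    assume "\<not> degree B > 0"
    then obtain c where c: "B = [:c:]"
      using degree_eq_zeroE by blast
    then show False
      using B(1,3) by simp
  qed
  define T where "T = monom 1 p - [:\<theta>:]"
  have p0: "p > 0"
    using p(1) prime_gt_0_nat by blast
  have T: "coeff T k \<in> M" for k
    using M(1,2,3,5) \<beta>(2) M(3)[OF M(2) M(5)[OF \<beta>(2)]] by (auto simp: T_def coeff_pCons split: nat.split)
  have "\<exists>Q R. T = B * Q + R \<and> degree R < degree B \<and> (\<forall>k. coeff Q k \<in> M) \<and> (\<forall>k. coeff R k \<in> M)"
    using M B(1,2) T \<open>degree B > 0\<close> by (intro monic_division) auto
  then obtain Q R where QR: "T = B * Q + R" "degree R < degree B" "\<And>k. coeff R k \<in> M"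
    by blast
  \<comment> \<open>By minimality of \<open>B\<close> the remainder is 0, so \<open>B\<close>
    divides \<open>X ^ p - \<theta>\<close>.\<close>
  have "poly R \<beta> = 0"
    using arg_cong[OF QR(1), of "\<lambda>u. poly u \<beta>"] B(3) \<beta>(1) by (simp add: T_def poly_monom)
  then have "R = 0"
    using B0(2)[of R] QR(2,3) B(4) by (force simp: good_def)
  have "z ^ p = \<theta>" if "poly B z = 0" for z
    using arg_cong[OF QR(1), of "\<lambda>u. poly u z"] that \<open>R = 0\<close> by (simp add: T_def poly_monom)
  then have norm: "poly B 0 ^ p = (- \<theta>) ^ degree B"
    using B(1) p(2) by (intro norm_of_radical_factor) auto
  have "coprime (degree B) p"
    using p(1) \<open>degree B > 0\<close> \<open>degree B < p\<close> by (metis coprime_commute dvd_imp_le not_le prime_imp_coprime)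
  then obtain u v where uv: "degree B * u = p * v + 1"
    using bezout_nat[of "degree B" p] \<open>degree B > 0\<close> by (auto simp: coprime_iff_gcd_eq_1)
  \<comment> \<open>As \<open>degree B * u = p * v + 1\<close>, the \<open>p\<close>-th power of
    \<open>poly B 0 ^ u\<close> is \<open>((- \<theta>) ^ v) ^ p * (- \<theta>)\<close>. Dividing by
    \<open>(- \<theta>) ^ v\<close> and changing the sign leaves a \<open>p\<close>-th root of
    \<open>\<theta>\<close>.\<close>
  define x where "x = - (poly B 0 ^ u * inverse ((- \<theta>) ^ v))"
  have Mpow: "y ^ k \<in> M" if "y \<in> M" for y k
    by (induction k) (use M that in auto)
  have "poly B 0 \<in> M"
    using B(2)[of 0] by (simp add: poly_0_coeff_0)
  then have "x \<in> M"
    unfolding x_def by (intro M(4,5,6) Mpow \<beta>(2))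
  moreover have "x ^ p = \<theta>"
  proof -
    have "(poly B 0 ^ u) ^ p = (poly B 0 ^ p) ^ u"
      by (simp add: mult.commute flip: power_mult)
    also have "\<dots> = (- \<theta>) ^ (p * v + 1)"
      by (simp only: norm uv flip: power_mult)
    finally have "(poly B 0 ^ u) ^ p = ((- \<theta>) ^ v) ^ p * (- \<theta>)"
      by (simp add: power_add mult.commute flip: power_mult)
    then have "(poly B 0 ^ u * inverse ((- \<theta>) ^ v)) ^ p = - \<theta>"
      using \<beta>(3) by (simp add: power_mult_distrib power_inverse)
    then show ?thesis
      using p(2) by (simp add: x_def)
  qed
  ultimately show False
    using \<beta>(4) by blast
qed

section \<open>Characters with values in a prime field\<close>

text \<open>A homomorphism from the units modulo \<open>N\<close> onto the \<open>d\<close>-torsion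
  of the units modulo \<open>p\<close>, given on representatives: values count only modulo
  \<open>p\<close>, and only arguments prime to \<open>N\<close> are constrained.\<close>

definition residue_character :: "nat \<Rightarrow> nat \<Rightarrow> nat \<Rightarrow> (nat \<Rightarrow> nat) \<Rightarrow> bool" where
  "residue_character p N d \<chi> \<longleftrightarrow>
     (\<forall>s t. coprime s N \<longrightarrow> coprime t N \<longrightarrow> [\<chi> (s * t) = \<chi> s * \<chi> t] (mod p)) \<and>
     (\<forall>s t. coprime s N \<longrightarrow> [s = t] (mod N) \<longrightarrow> [\<chi> s = \<chi> t] (mod p)) \<and>
     (\<forall>s. coprime s N \<longrightarrow> [\<chi> s ^ d = 1] (mod p)) \<and>
     (\<forall>u. [u ^ d = 1] (mod p) \<longrightarrow> (\<exists>s. coprime s N \<and> [\<chi> s = u] (mod p)))"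

lemma residue_characterD:
  assumes "residue_character p N d \<chi>"
  shows "coprime s N \<Longrightarrow> coprime t N \<Longrightarrow> [\<chi> (s * t) = \<chi> s * \<chi> t] (mod p)"
    and "coprime s N \<Longrightarrow> [s = t] (mod N) \<Longrightarrow> [\<chi> s = \<chi> t] (mod p)"
    and "coprime s N \<Longrightarrow> [\<chi> s ^ d = 1] (mod p)"
    and "[u ^ d = 1] (mod p) \<Longrightarrow> \<exists>s. coprime s N \<and> [\<chi> s = u] (mod p)"
  using assms unfolding residue_character_def by blast+

lemma cong_square_one_imp:
  fixes x p :: nat
  assumes p: "prime p" and x: "[x ^ 2 = 1] (mod p)"
  shows "[x = 1] (mod p) \<or> [x = p - 1] (mod p)"
proof -
  have p1: "p > 1"
    using p prime_gt_1_nat by blast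
  have "[int x ^ 2 = 1] (mod int p)"
    using x by (metis cong_int_iff of_nat_1 of_nat_power)
  then have "int p dvd (int x - 1) * (int x + 1)"
    by (simp add: cong_iff_dvd_diff power2_eq_square algebra_simps)
  then have "int p dvd int x - 1 \<or> int p dvd int x + 1"
    using p by (simp add: prime_dvd_mult_iff)
  then have "[int x = int 1] (mod int p) \<or> [int x = int (p - 1)] (mod int p)"
  proof
    assume "int p dvd int x + 1"
    then have "int p dvd (int x + 1) - int p"
      by (rule dvd_diff) simp
    then show ?thesis
      using p1 by (simp add: cong_iff_dvd_diff of_nat_diff algebra_simps)
  qed (simp add: cong_iff_dvd_diff)
  then show ?thesis
    by (simp only: cong_int_iff)
qed

lemma coprime_if_power_cong_one:
  fixes u m :: nat
  assumes "[u ^ d = 1] (mod m)" "d > 0"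
  shows "coprime u m"
proof -
  have "coprime (u ^ d) m"
    using cong_imp_coprime[OF cong_sym[OF assms(1)]] by simp
  then show ?thesis
    using assms(2) by simp
qed

lemma prime_generator:
  assumes "prime q"
  obtains g where "coprime q g" "ord q g = q - 1" "\<And>s. coprime s q \<Longrightarrow> \<exists>i. [g ^ i = s] (mod q)"
proof -
  have q1: "q > 1"
    using assms prime_gt_1_nat by blast
  obtain g where g: "residue_primroot q g"
    using prime_primitive_root_exists[OF q1 assms] by blast
  have "\<exists>i. [g ^ i = s] (mod q)" if "coprime s q" for s
  proof -
    have "s mod q \<noteq> 0"
      using that q1 by (metis coprime_common_divisor dvd_refl mod_0_imp_dvd nat_dvd_1_iff_1 less_irrefl)
    then have "s mod q \<in> totatives q"
      using that q1 by (auto simp: totatives_def)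
    then have "s mod q \<in> (\<lambda>i. g ^ i mod q) ` {..<totient q}"
      by (simp only: bij_betw_imp_surj_on[OF residue_primroot_is_generator[OF q1 g]])
    then obtain i where "g ^ i mod q = s mod q"
      by auto
    then show ?thesis
      by (auto simp: Cong.cong_def)
  qed
  then show ?thesis
    using that g assms by (auto simp: residue_primroot_def totient_prime)
qed

text \<open>\<open>\<chi>\<close> sends \<open>g ^ i\<close> to \<open>h ^ i\<close>, where
  \<open>g\<close> is a primitive root modulo \<open>q\<close> and \<open>h\<close> has order
  \<open>d\<close> modulo \<open>p\<close>. For odd \<open>q\<close>, -1 is \<open>g\<close> to the
  power \<open>(q - 1) / 2\<close>, so its value is -1 when \<open>d\<close> does not divide
  \<open>(q - 1) / 2\<close>; this is the parity condition on \<open>(q - 1) div d\<close>.\<close>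

lemma ex_prime_character:
  assumes p: "prime p" and q: "prime q" and d: "d dvd p - 1" "d dvd q - 1"
  shows "\<exists>\<chi>. residue_character p q d \<chi> \<and>
    (even d \<and> odd ((q - 1) div d) \<longrightarrow> [\<chi> (q - 1) = p - 1] (mod p))"
proof -
  have p1: "p > 1" "q > 1"
    using p q prime_gt_1_nat by blast+
  have d0: "d > 0"
    using d(1) p1 by (intro gr0I) auto
  obtain g where g: "coprime q g" "ord q g = q - 1" "\<And>s. coprime s q \<Longrightarrow> \<exists>i. [g ^ i = s] (mod q)"
    using prime_generator[OF q] by metis
  obtain b where b: "coprime p b" "ord p b = p - 1" "\<And>s. coprime s p \<Longrightarrow> \<exists>i. [b ^ i = s] (mod p)"
    using prime_generator[OF p] by metis
  obtain e where e: "p - 1 = d * e"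
    using d(1) ..
  have e0: "e > 0"
    using e p1 by (intro gr0I) auto
  have ord_b: "ord p b = d * e"
    using b(2) e by simp
  define h where "h = b ^ e"
  have h: "[h ^ i = h ^ j] (mod p) \<longleftrightarrow> [i = j] (mod d)" for i j
  proof -
    have "[h ^ i = h ^ j] (mod p) \<longleftrightarrow> [e * i = e * j] (mod d * e)"
      using order_divides_expdiff[OF b(1), of "e * i" "e * j"] by (simp add: h_def power_mult ord_b)
    also have "\<dots> \<longleftrightarrow> [i = j] (mod d)"
      using e0 by (simp add: Cong.cong_def mult.commute[of d] mult_mod_right[symmetric])
    finally show ?thesis .
  qed
  define ind where "ind s = (SOME i. [g ^ i = s] (mod q))" for s
  define \<chi> where "\<chi> s = h ^ ind s" for s
  have ind: "[g ^ ind s = s] (mod q)" if "coprime s q" for s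
    unfolding ind_def by (rule someI_ex[OF g(3)[OF that]])
  have \<chi>: "[\<chi> s = h ^ i] (mod p)" if "[g ^ i = s] (mod q)" for s i
  proof -
    have "coprime s q"
      using that g(1) by (metis cong_imp_coprime coprime_commute coprime_power_left_iff)
    then have "[g ^ ind s = g ^ i] (mod q)"
      using ind that cong_sym cong_trans by blast
    then have "[ind s = i] (mod q - 1)"
      using order_divides_expdiff[OF g(1)] g(2) by simp
    then have "[ind s = i] (mod d)"
      using d(2) cong_dvd_modulus_nat by blast
    then show ?thesis
      by (simp add: \<chi>_def h)
  qed
  have char: "residue_character p q d \<chi>"
    unfolding residue_character_def
  proof (intro conjI allI impI)
    fix s t assume "coprime s q" "coprime t q"
    then have "[g ^ (ind s + ind t) = s * t] (mod q)"
      unfolding power_add by (intro cong_mult ind)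
    then have "[\<chi> (s * t) = h ^ (ind s + ind t)] (mod p)"
      by (rule \<chi>)
    then show "[\<chi> (s * t) = \<chi> s * \<chi> t] (mod p)"
      by (simp add: \<chi>_def power_add)
  next
    fix s t assume "coprime s q" "[s = t] (mod q)"
    then have "[g ^ ind s = t] (mod q)"
      using ind cong_trans by blast
    then show "[\<chi> s = \<chi> t] (mod p)"
      using \<chi> cong_sym unfolding \<chi>_def[of s] by blast
  next
    fix s
    have "[ind s * d = 0] (mod d)"
      by (simp add: Cong.cong_def)
    then show "[\<chi> s ^ d = 1] (mod p)"
      using h[of "ind s * d" 0] by (simp add: \<chi>_def power_mult)
  next
    fix u assume u: "[u ^ d = 1] (mod p)"
    have "coprime u p"
      using coprime_if_power_cong_one[OF u d0] .
    then obtain j where j: "[b ^ j = u] (mod p)"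
      using b(3) by blast
    then have "[b ^ (j * d) = 1] (mod p)"
      using u cong_pow cong_trans by (metis power_mult)
    then have "ord p b dvd j * d"
      unfolding ord_divides .
    then have "d * e dvd j * d"
      by (simp only: ord_b)
    then have "e dvd j"
      using d0 by (simp add: mult.commute)
    then obtain i where "j = e * i" ..
    then have "[h ^ i = u] (mod p)"
      using j by (simp add: h_def power_mult)
    moreover have "coprime (g ^ i) q"
      using g(1) by (simp add: coprime_commute)
    ultimately show "\<exists>s. coprime s q \<and> [\<chi> s = u] (mod p)"
      using \<chi>[of i "g ^ i"] cong_trans cong_refl by blast
  qed
  have "[\<chi> (q - 1) = p - 1] (mod p)" if d2: "even d" and odd: "odd ((q - 1) div d)"
  proof -
    define i where "i = ind (q - 1)"
    obtain k where k: "q - 1 = d * k" "odd k"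
      using d(2) odd d0 by (metis dvd_mult_div_cancel)
    have q3: "q \<ge> 3"
      using d2 k p1 by (cases "q = 2") auto
    have cop: "coprime (q - 1) q"
      using p1 by (intro coprime_diff_one_left_nat) simp
    have gi: "[g ^ i = q - 1] (mod q)"
      unfolding i_def by (rule ind[OF cop])
    have "[int (q - 1) ^ 2 = 1] (mod int q)"
      using p1 by (simp add: cong_iff_dvd_diff power2_eq_square of_nat_diff algebra_simps)
    then have "[(q - 1) ^ 2 = 1] (mod q)"
      by (metis cong_int_iff of_nat_1 of_nat_power)
    then have "[g ^ (i * 2) = 1] (mod q)"
      using cong_pow[OF gi, of 2] cong_trans by (metis power_mult)
    then have dk: "d * k dvd i * 2"
      unfolding ord_divides g(2) k(1) .
    have "\<not> [\<chi> (q - 1) = 1] (mod p)"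
    proof
      assume "[\<chi> (q - 1) = 1] (mod p)"
      then have "[h ^ i = h ^ 0] (mod p)"
        by (simp add: \<chi>_def i_def)
      then have "[i = 0] (mod d)"
        by (simp only: h)
      then obtain t where t: "i = d * t"
        by (auto simp: cong_0_iff)
      then have "k dvd t * 2"
        using dk d0 by simp
      then have "k dvd t"
        using k(2) by (simp add: coprime_dvd_mult_left_iff)
      then have "q - 1 dvd i"
        by (simp only: k(1) t mult_dvd_mono dvd_refl)
      then have "[g ^ i = 1] (mod q)"
        unfolding ord_divides g(2) .
      then have "[q - 1 = 1] (mod q)"
        using gi cong_sym cong_trans by blast
      then show False
        using q3 by (simp add: Cong.cong_def)
    qed
    moreover have "[\<chi> (q - 1) ^ 2 = 1] (mod p)"
    proof -
      have "[i * 2 = 0] (mod d)"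
        using dk by (metis cong_0_iff dvd_mult_left)
      then show ?thesis
        using h[of "i * 2" 0] by (simp add: \<chi>_def i_def power_mult)
    qed
    ultimately show ?thesis
      using cong_square_one_imp[OF p] by blast
  qed
  with char show ?thesis
    by blast
qed

text \<open>By the Chinese remainder theorem both characters can be prescribed independently, and
  the target \<open>u\<close> splits as \<open>u ^ (d2 * x) * u ^ (d1 * y)\<close> into parts of
  order dividing \<open>d1\<close> and \<open>d2\<close>.\<close>

lemma residue_character_mult:
  assumes p: "prime p" and c1: "residue_character p N1 d1 \<chi>1" and c2: "residue_character p N2 d2 \<chi>2"
    and N: "coprime N1 N2" and d: "coprime d1 d2" "d1 > 0" "d2 > 0"
  shows "residue_character p (N1 * N2) (d1 * d2) (\<lambda>s. \<chi>1 s * \<chi>2 s)"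
  unfolding residue_character_def
proof (intro conjI allI impI)
  fix s t assume "coprime s (N1 * N2)" "coprime t (N1 * N2)"
  then have "[\<chi>1 (s * t) * \<chi>2 (s * t) = (\<chi>1 s * \<chi>1 t) * (\<chi>2 s * \<chi>2 t)] (mod p)"
    by (intro cong_mult residue_characterD(1)[OF c1] residue_characterD(1)[OF c2]) auto
  then show "[\<chi>1 (s * t) * \<chi>2 (s * t) = \<chi>1 s * \<chi>2 s * (\<chi>1 t * \<chi>2 t)] (mod p)"
    by (simp add: mult_ac)
next
  fix s t assume "coprime s (N1 * N2)" "[s = t] (mod N1 * N2)"
  then show "[\<chi>1 s * \<chi>2 s = \<chi>1 t * \<chi>2 t] (mod p)"
    by (intro cong_mult residue_characterD(2)[OF c1] residue_characterD(2)[OF c2])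
      (auto intro: cong_dvd_modulus_nat)
next
  fix s assume "coprime s (N1 * N2)"
  then have "[(\<chi>1 s ^ d1) ^ d2 * (\<chi>2 s ^ d2) ^ d1 = 1 ^ d2 * 1 ^ d1] (mod p)"
    by (intro cong_mult cong_pow residue_characterD(3)[OF c1] residue_characterD(3)[OF c2]) auto
  moreover have "(\<chi>1 s ^ d1) ^ d2 * (\<chi>2 s ^ d2) ^ d1 = (\<chi>1 s * \<chi>2 s) ^ (d1 * d2)"
    by (simp add: power_mult_distrib mult.commute[of d1] flip: power_mult)
  ultimately show "[(\<chi>1 s * \<chi>2 s) ^ (d1 * d2) = 1] (mod p)"
    by simp
next
  fix u assume u: "[u ^ (d1 * d2) = 1] (mod p)"
  have "coprime u p"
    using coprime_if_power_cong_one[OF u] d by simp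
  then have cop: "coprime p u"
    by (simp add: coprime_commute)
  obtain x where x: "[d2 * x = 1] (mod d1)"
    using cong_solve_coprime_nat[of d2 d1] d(1) by (auto simp: coprime_commute)
  obtain y where y: "[d1 * y = 1] (mod d2)"
    using cong_solve_coprime_nat[of d1 d2] d(1) by auto
  have "[d2 * x + d1 * y = 1 + 0] (mod d1)"
    by (intro cong_add x) (simp add: cong_0_iff)
  moreover have "[d2 * x + d1 * y = 0 + 1] (mod d2)"
    by (intro cong_add y) (simp add: cong_0_iff)
  ultimately have "[d2 * x + d1 * y = 1] (mod d1 * d2)"
    using d(1) by (intro coprime_cong_mult_nat) simp_all
  moreover have "ord p u dvd d1 * d2"
    using u unfolding ord_divides .
  ultimately have "[u ^ (d2 * x + d1 * y) = u ^ 1] (mod p)"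
    using order_divides_expdiff[OF cop] cong_dvd_modulus_nat by blast
  then have uu: "[u ^ (d2 * x) * u ^ (d1 * y) = u] (mod p)"
    by (simp add: power_add)
  have one: "[u ^ (d1 * d2 * z) = 1] (mod p)" for z
    using cong_pow[OF u, of z] by (simp add: power_mult)
  obtain s1 where s1: "coprime s1 N1" "[\<chi>1 s1 = u ^ (d2 * x)] (mod p)"
    using residue_characterD(4)[OF c1, of "u ^ (d2 * x)"] one[of x] by (auto simp: mult_ac simp flip: power_mult)
  obtain s2 where s2: "coprime s2 N2" "[\<chi>2 s2 = u ^ (d1 * y)] (mod p)"
    using residue_characterD(4)[OF c2, of "u ^ (d1 * y)"] one[of y] by (auto simp: mult_ac simp flip: power_mult)
  obtain s where s: "[s = s1] (mod N1)" "[s = s2] (mod N2)"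
    using binary_chinese_remainder_nat[OF N] by blast
  have cs: "coprime s N1" "coprime s N2"
    using s s1(1) s2(1) by (metis cong_imp_coprime cong_sym)+
  have "[\<chi>1 s * \<chi>2 s = u ^ (d2 * x) * u ^ (d1 * y)] (mod p)"
    using residue_characterD(2)[OF c1 cs(1) s(1)] residue_characterD(2)[OF c2 cs(2) s(2)] s1(2) s2(2)
    by (intro cong_mult) (blast intro: cong_trans)+
  then show "\<exists>s. coprime s (N1 * N2) \<and> [\<chi>1 s * \<chi>2 s = u] (mod p)"
    using uu cs cong_trans by (metis coprime_mult_right_iff)
qed

text \<open>Squaring \<open>1 + 2 ^ (j + 3) * u\<close> adds exactly one factor 2 to the difference
  from 1 and leaves an odd cofactor.\<close>

lemma three_power_two_power: "\<exists>u. odd u \<and> (3::nat) ^ (2 ^ Suc j) = 1 + 2 ^ (j + 3) * u"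
proof (induction j)
  case 0
  show ?case
    by (intro exI[of _ 1]) simp
next
  case (Suc j)
  then obtain u :: nat where u: "odd u" "(3::nat) ^ (2 ^ Suc j) = 1 + 2 ^ (j + 3) * u"
    by blast
  have "(3::nat) ^ (2 ^ Suc (Suc j)) = (3 ^ (2 ^ Suc j)) ^ 2"
    by (simp add: power_mult[symmetric] mult.commute)
  also have "\<dots> = (1 + 2 ^ (j + 3) * u) ^ 2"
    by (simp only: u(2))
  also have "\<dots> = 1 + 2 ^ (Suc j + 3) * (u + 2 ^ (j + 2) * u ^ 2)"
    by (simp add: power2_eq_square algebra_simps power_add)
  finally show ?case
    using u(1) by (intro exI[of _ "u + 2 ^ (j + 2) * u ^ 2"]) simp
qed

text \<open>
  For \<open>k \<ge> 2\<close> the number \<open>B = (3 ^ 2 ^ (k - 1) + 1) / 2\<close> equals \<open>1 + 2 ^ k * u\<close> with \<open>u\<close> odd. All its prime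
  factors are 1 modulo \<open>2 ^ k\<close>, hence not all of them are 1 modulo \<open>2 ^ Suc k\<close>.
\<close>

lemma ex_prime_two_adic:
  assumes "k \<ge> 1"
  shows "\<exists>q::nat. prime q \<and> 2 ^ k dvd q - 1 \<and> odd ((q - 1) div 2 ^ k)"
proof (cases "k = 1")
  \<comment> \<open>The number used for larger \<open>k\<close> would be 2 here; the prime 3 serves
    instead.\<close>
  case True
  have "prime (3::nat)"
    by simp
  then show ?thesis
    by (intro exI[of _ 3]) (simp add: True)
next
  case False
  define j where "j = k - 2"
  have k: "k = j + 2"
    using assms False by (simp add: j_def)
  obtain u :: nat where u: "odd u" "(3::nat) ^ (2 ^ Suc j) = 1 + 2 ^ (j + 3) * u"
    using three_power_two_power by blast
  define B where "B = 1 + 2 ^ k * u"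
  have B: "3 ^ (2 ^ Suc j) + 1 = 2 * B"
    unfolding u(2) B_def k by (simp add: power_add)
  have prime_factor: "2 ^ k dvd q - 1" if q: "prime q" "q dvd B" for q
  proof -
    have "odd B"
      by (simp add: B_def k)
    then have "odd q"
      using q(2) dvd_trans by blast
    then have q3: "q > 2"
      using q(1) prime_gt_1_nat[of q] by (cases "q = 2") auto
    have "q dvd 3 ^ (2 ^ Suc j) + 1"
      by (simp only: B dvd_mult q(2))
    then have "int q dvd 3 ^ (2 ^ Suc j) + 1"
      by (metis int_dvd_int_iff of_nat_1 of_nat_add of_nat_numeral of_nat_power)
    then have m1: "[(3::int) ^ (2 ^ Suc j) = -1] (mod int q)"
      by (simp add: cong_iff_dvd_diff)
    have "[((3::int) ^ (2 ^ Suc j)) ^ 2 = (-1) ^ 2] (mod int q)"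
      by (rule cong_pow[OF m1])
    then have "[int (3 ^ (2 ^ k)) = int 1] (mod int q)"
      by (simp add: k power_mult[symmetric] mult.commute)
    then have "[3 ^ (2 ^ k) = 1] (mod q)"
      by (simp only: cong_int_iff)
    then have dvd: "ord q 3 dvd 2 ^ k"
      unfolding ord_divides .
    then obtain i where i: "ord q 3 = 2 ^ i" "i \<le> k"
      using divides_primepow_nat[OF two_is_prime_nat] by blast
    \<comment> \<open>The order of 3 divides \<open>2 ^ k\<close> but not
      \<open>2 ^ (k - 1)\<close>, since 3 to the power \<open>2 ^ (k - 1)\<close> is -1 modulo
      \<open>q\<close>.\<close>
    have "i = k"
    proof (rule ccontr)
      assume "i \<noteq> k"
      then have "(2::nat) ^ i dvd 2 ^ Suc j"
        using i(2) k by (intro le_imp_power_dvd) simp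
      then have "[3 ^ (2 ^ Suc j) = 1] (mod q)"
        unfolding ord_divides i(1) .
      then have "[int (3 ^ (2 ^ Suc j)) = int 1] (mod int q)"
        by (simp only: cong_int_iff)
      then have "[-1 = (1::int)] (mod int q)"
        using m1 by (simp add: cong_sym_eq) (meson cong_sym cong_trans)
      then have "int q dvd 2"
        by (simp add: cong_iff_dvd_diff)
      then show False
        using q3 zdvd_imp_le by fastforce
    qed
    moreover have "coprime q 3"
      using i(1) by (metis ord_eq_0 power_not_zero zero_neq_numeral)
    then have "ord q 3 dvd q - 1"
      using order_divides_totient totient_prime[OF q(1)] by metis
    ultimately show ?thesis
      using i(1) by simp
  qed
  have "\<exists>q. prime q \<and> q dvd B \<and> \<not> 2 ^ Suc k dvd q - 1"
  proof (rule ccontr)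
    assume *: "\<nexists>q. prime q \<and> q dvd B \<and> \<not> 2 ^ Suc k dvd q - 1"
    \<comment> \<open>A product of primes congruent to 1 is congruent to 1 as well, whereas
      \<open>B\<close> differs from 1 by an odd multiple of \<open>2 ^ k\<close>.\<close>
    have "[b = 1] (mod 2 ^ Suc k)" if "b > 0" "\<And>q. prime q \<Longrightarrow> q dvd b \<Longrightarrow> 2 ^ Suc k dvd q - 1" for b :: nat
      using that
    proof (induction b rule: prime_divisors_induct)
      case (factor q b)
      have "[q = 1] (mod 2 ^ Suc k)"
        using factor.prems(2)[OF factor.hyps] prime_gt_0_nat[OF factor.hyps]
        by (subst cong_altdef_nat) simp_all
      moreover have "[b = 1] (mod 2 ^ Suc k)"
        using factor.prems by (intro factor.IH) auto
      ultimately have "[q * b = 1 * 1] (mod 2 ^ Suc k)"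
        by (rule cong_mult)
      then show ?case
        by simp
    qed auto
    then have "[B = 1] (mod 2 ^ Suc k)"
      using * by (simp add: B_def)
    then have "2 ^ Suc k dvd B - 1"
      by (subst (asm) cong_altdef_nat) (simp_all add: B_def)
    then have "2 ^ k * 2 dvd 2 ^ k * u"
      by (simp add: B_def mult.commute)
    with u(1) show False
      by simp
  qed
  then obtain q where q: "prime q" "q dvd B" "\<not> 2 ^ Suc k dvd q - 1"
    by blast
  then have "2 ^ k dvd q - 1"
    using prime_factor by blast
  moreover from this have "odd ((q - 1) div 2 ^ k)"
    using q(3) by (metis dvd_div_iff_mult power_Suc power_not_zero zero_neq_numeral mult.commute)
  ultimately show ?thesis
    using q(1) by blast
qed

text \<open>When \<open>(p - 1) / n\<close> is even, only a character of odd order \<open>m\<close>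
  is taken modulo \<open>p\<close>, where -1 maps to 1; the part of order \<open>2 ^ k\<close> comes
  from an auxiliary prime \<open>q\<close> and takes -1 to -1.\<close>

lemma ex_odd_character:
  assumes p: "prime p" and n: "n dvd p - 1" "even n"
  shows "\<exists>N \<chi>. p dvd N \<and> N > 0 \<and> residue_character p N n \<chi> \<and> [\<chi> (N - 1) = p - 1] (mod p)"
proof (cases "odd ((p - 1) div n)")
  case True
  then obtain \<chi> where "residue_character p p n \<chi>" "[\<chi> (p - 1) = p - 1] (mod p)"
    using ex_prime_character[OF p p n(1) n(1)] n(2) by blast
  then show ?thesis
    using prime_gt_0_nat[OF p] by (intro exI[of _ p] exI[of _ \<chi>]) simp
next
  case False
  have p1: "p > 1"
    using p prime_gt_1_nat by blast
  have n0: "n > 0"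
    using n(1) p1 by (intro gr0I) auto
  define k where "k = multiplicity 2 n"
  obtain m where km: "n = 2 ^ k * m" "odd m"
    using multiplicity_decompose'[of n "2::nat"] n0 unfolding k_def by auto
  have k: "k \<ge> 1"
    using n(2) km by (cases k) auto
  obtain q :: nat where q: "prime q" "2 ^ k dvd q - 1" "odd ((q - 1) div 2 ^ k)"
    using ex_prime_two_adic[OF k] by blast
  \<comment> \<open>\<open>q - 1\<close> contains the factor 2 exactly \<open>k\<close> times,
    \<open>p - 1\<close> more often.\<close>
  have "p \<noteq> q"
  proof
    assume "p = q"
    obtain t where t: "p - 1 = n * t"
      using n(1) ..
    have "(p - 1) div n = t"
      using n0 t by simp
    then have "even t"
      using False by simp
    moreover have "(q - 1) div 2 ^ k = m * t"
      using \<open>p = q\<close> t km by simp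
    ultimately show False
      using q(3) by simp
  qed
  then have pq: "coprime p q"
    using p q(1) primes_coprime by blast
  have dm: "m dvd p - 1" "2 ^ k dvd p - 1"
    using n(1) km by (auto intro: dvd_trans)
  obtain \<chi>1 where c1: "residue_character p p m \<chi>1"
    using ex_prime_character[OF p p dm(1) dm(1)] by blast
  obtain \<chi>2 where c2: "residue_character p q (2 ^ k) \<chi>2" "[\<chi>2 (q - 1) = p - 1] (mod p)"
    using ex_prime_character[OF p q(1) dm(2) q(2)] q(3) k by auto
  have m0: "m > 0"
    using km(2) by (intro gr0I) auto
  have char: "residue_character p (p * q) n (\<lambda>s. \<chi>1 s * \<chi>2 s)"
    using residue_character_mult[OF p c1 c2(1) pq] km m0 by (simp add: mult.commute)
  define s where "s = p * q - 1"
  have q1: "q > 1"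
    using q(1) prime_gt_1_nat by blast
  have cs: "coprime s (p * q)"
    unfolding s_def using p1 q1 by (intro coprime_diff_one_left_nat) simp
  have "[s * s = 1] (mod p * q)"
  proof -
    have "[int s * int s = 1] (mod int (p * q))"
      using p1 q1 by (simp add: s_def cong_iff_dvd_diff of_nat_diff algebra_simps)
    then show ?thesis
      by (metis cong_int_iff of_nat_1 of_nat_mult)
  qed
  then have ss: "[s * s = 1] (mod p)"
    using cong_dvd_modulus_nat by (metis dvd_triv_left)
  have csp: "coprime s p" "coprime s q"
    using cs by simp_all
  have one: "[\<chi>1 1 = 1] (mod p)"
  proof -
    have "[\<chi>1 1 * 1 = \<chi>1 1 * \<chi>1 1] (mod p)"
      using residue_characterD(1)[OF c1, of 1 1] by simp
    moreover have "coprime (\<chi>1 1) p"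
      using coprime_if_power_cong_one[OF residue_characterD(3)[OF c1, of 1] m0] by simp
    ultimately show ?thesis
      by (metis cong_mult_lcancel_nat cong_sym)
  qed
  have "[\<chi>1 s * \<chi>1 s = 1] (mod p)"
    using residue_characterD(1)[OF c1 csp(1) csp(1)] residue_characterD(2)[OF c1 _ ss] csp(1) one
    by (metis cong_sym cong_trans coprime_mult_left_iff)
  then have sq: "[(\<chi>1 s) ^ 2 = 1] (mod p)"
    by (simp add: power2_eq_square)
  \<comment> \<open>A value whose square and whose \<open>m\<close>-th power are 1 is 1, as
    \<open>m\<close> is odd.\<close>
  obtain t where t: "m = Suc (2 * t)"
    using km(2) by (metis oddE Suc_eq_plus1)
  have "[((\<chi>1 s) ^ 2) ^ t * \<chi>1 s = 1 ^ t * \<chi>1 s] (mod p)"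
    by (intro cong_mult cong_pow sq cong_refl)
  moreover have "((\<chi>1 s) ^ 2) ^ t * \<chi>1 s = \<chi>1 s ^ m"
    by (simp add: t mult.commute flip: power_mult)
  ultimately have "[\<chi>1 s ^ m = \<chi>1 s] (mod p)"
    by simp
  then have x1: "[\<chi>1 s = 1] (mod p)"
    using residue_characterD(3)[OF c1 csp(1)] cong_sym cong_trans by blast
  have "[s = q - 1] (mod q)"
  proof -
    have "[int s = int (q - 1)] (mod int q)"
      using p1 q1 by (simp add: s_def cong_iff_dvd_diff of_nat_diff)
    then show ?thesis
      by (simp only: cong_int_iff)
  qed
  then have "[\<chi>2 s = p - 1] (mod p)"
    using residue_characterD(2)[OF c2(1) csp(2)] c2(2) cong_trans by blast
  then have "[\<chi>1 s * \<chi>2 s = 1 * (p - 1)] (mod p)"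
    using x1 by (rule cong_mult[rotated])
  then show ?thesis
    using char p1 q1 unfolding s_def by (intro exI[of _ "p * q"] exI[of _ "\<lambda>s. \<chi>1 s * \<chi>2 s"]) auto
qed

section \<open>Kummer theory over a cyclotomic field\<close>

lemma poly_eq_sum_lessThan:
  fixes q :: "'a::comm_ring_1 poly"
  shows "degree q < p \<Longrightarrow> poly q x = (\<Sum>j<p. coeff q j * x ^ j)"
  unfolding poly_altdef by (intro sum.mono_neutral_left) (auto simp: coeff_eq_0)

locale kummer_setup =
  fixes p n N :: nat and \<chi> :: "nat \<Rightarrow> nat"
  assumes p: "prime p" "p \<ge> 3" and n: "n dvd p - 1" and N: "p dvd N" "N > 0"
    and character: "residue_character p N n \<chi>"
    and \<chi>_minus_one: "[\<chi> (N - 1) = p - 1] (mod p)"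
begin

lemma p_pos: "p > 0" and odd_p: "odd p" and n_pos: "n > 0" and N_ge: "N \<ge> 3"
proof -
  show "p > 0"
    using p by simp
  show "odd p"
    using prime_odd_nat[OF p(1)] p(2) by linarith
  show "n > 0"
    using n p by (intro gr0I) auto
  show "N \<ge> 3"
    using dvd_imp_le[OF N] p(2) by linarith
qed

definition \<zeta> :: complex where "\<zeta> = cis (2 * pi / N)"

sublocale cyc: primitive_unity_root N \<zeta>
proof
  show "N \<ge> 2"
    using N_ge by simp
  show "\<zeta> ^ N = 1"
    using N by (simp add: \<zeta>_def DeMoivre)
  fix d assume d: "0 < d" "d < N"
  have pow: "cis (2 * pi * real k / real N) = \<zeta> ^ k" for k
    by (simp add: \<zeta>_def DeMoivre mult_ac)
  have "inj_on (\<lambda>k. cis (2 * pi * real k / real N)) {..<N}"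
    using bij_betw_roots_unity[OF N(2)] by (rule bij_betw_imp_inj_on)
  then have "inj_on (\<lambda>k. \<zeta> ^ k) {..<N}"
    by (simp only: pow)
  then have "\<zeta> ^ d \<noteq> \<zeta> ^ 0"
    using d by (subst inj_on_eq_iff) auto
  then show "\<zeta> ^ d \<noteq> 1"
    by simp
qed

section \<open>Units modulo \<open>N\<close> and the twisted character\<close>

definition G :: "nat set" where "G = {s \<in> {1..<N}. coprime s N}"

lemma finite_G: "finite G"
  by (simp add: G_def)

lemma one_G: "1 \<in> G"
  using N_ge by (simp add: G_def)

lemma G_coprime: "s \<in> G \<Longrightarrow> coprime s N"
  by (simp add: G_def)

lemma coprime_p: "coprime s N \<Longrightarrow> coprime s p"
  using N(1) by (metis coprime_divisors dvd_refl)

lemma mod_in_G: "coprime s N \<Longrightarrow> s mod N \<in> G"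
proof -
  assume "coprime s N"
  then have c: "coprime (s mod N) N"
    using N(2) coprime_mod_left_iff[of N s] by simp
  then have "s mod N \<noteq> 0"
    using N_ge by (intro notI) simp
  with c show ?thesis
    using N(2) by (simp add: G_def)
qed

lemma G_times_bij:
  assumes "coprime t N"
  shows "bij_betw (\<lambda>s. (s * t) mod N) G G"
proof -
  have "inj_on (\<lambda>s. (s * t) mod N) G"
  proof (rule inj_onI)
    fix x y assume *: "x \<in> G" "y \<in> G" "(x * t) mod N = (y * t) mod N"
    then have "[x * t = y * t] (mod N)"
      by (simp add: Cong.cong_def)
    then have "[x = y] (mod N)"
      using assms by (simp add: cong_mult_rcancel_nat)
    then show "x = y"
      using *(1,2) by (simp add: G_def Cong.cong_def)
  qed
  moreover have "(\<lambda>s. (s * t) mod N) ` G \<subseteq> G"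
    using assms by (auto intro!: mod_in_G simp: G_coprime)
  ultimately show ?thesis
    by (simp add: bij_betw_def endo_inj_surj finite_G)
qed

text \<open>\<open>c s\<close> is \<open>\<chi> s / s\<close>, with the inverse of \<open>s\<close> modulo \<open>p\<close> taken from Fermat's theorem.\<close>

definition c :: "nat \<Rightarrow> nat" where "c s = (\<chi> s * s ^ (p - 2)) mod p"

lemma fermat_mult: "coprime s p \<Longrightarrow> [s ^ (p - 2) * s = 1] (mod p)"
proof -
  assume "coprime s p"
  then have "\<not> p dvd s"
    using p by (metis coprime_common_divisor dvd_refl not_prime_unit)
  then have "[s ^ (p - 1) = 1] (mod p)"
    by (rule fermat_theorem[OF p(1)])
  moreover have "s ^ (p - 1) = s ^ (p - 2) * s"
    using p(2) by (simp flip: power_Suc2 add: Suc_diff_Suc numeral_2_eq_2)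
  ultimately show ?thesis
    by simp
qed

lemma \<chi>_coprime: "coprime s N \<Longrightarrow> coprime (\<chi> s) p"
  using coprime_if_power_cong_one[OF residue_characterD(3)[OF character] n_pos] .

lemma c_mult_self: "coprime s N \<Longrightarrow> [c s * s = \<chi> s] (mod p)"
proof -
  assume s: "coprime s N"
  have "[c s * s = \<chi> s * s ^ (p - 2) * s] (mod p)"
    unfolding c_def by (intro cong_mult) simp_all
  also have "\<chi> s * s ^ (p - 2) * s = \<chi> s * (s ^ (p - 2) * s)"
    by (simp add: mult_ac)
  also have "[\<dots> = \<chi> s * 1] (mod p)"
    by (intro cong_mult fermat_mult coprime_p s cong_refl)
  finally show ?thesis
    by simp
qed

lemma c_less: "c s < p"
  using p_pos by (simp add: c_def)

lemma c_coprime: "coprime s N \<Longrightarrow> coprime (c s) p"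
proof -
  assume s: "coprime s N"
  have "coprime (c s * s) p"
    using c_mult_self[OF s] \<chi>_coprime[OF s] cong_imp_coprime cong_sym by blast
  then show ?thesis
    by simp
qed

lemma c_mult: "coprime s N \<Longrightarrow> coprime t N \<Longrightarrow> [c (s * t) = c s * c t] (mod p)"
proof -
  assume st: "coprime s N" "coprime t N"
  have "[c (s * t) * (s * t) = \<chi> (s * t)] (mod p)"
    using st by (intro c_mult_self) simp
  also have "[\<chi> (s * t) = \<chi> s * \<chi> t] (mod p)"
    by (rule residue_characterD(1)[OF character st])
  also have "[\<chi> s * \<chi> t = (c s * s) * (c t * t)] (mod p)"
    by (intro cong_mult cong_sym[OF c_mult_self] st)
  finally have "[c (s * t) * (s * t) = c s * c t * (s * t)] (mod p)"
    by (simp add: mult_ac)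
  then show ?thesis
    using coprime_p[OF st(1)] coprime_p[OF st(2)] by (simp add: cong_mult_rcancel_nat)
qed

lemma c_cong: "coprime s N \<Longrightarrow> [s = t] (mod N) \<Longrightarrow> c s = c t"
proof -
  assume st: "coprime s N" "[s = t] (mod N)"
  then have "[\<chi> s = \<chi> t] (mod p)" "[s = t] (mod p)"
    using residue_characterD(2)[OF character] N(1) cong_dvd_modulus_nat by blast+
  then have "[\<chi> s * s ^ (p - 2) = \<chi> t * t ^ (p - 2)] (mod p)"
    by (intro cong_mult cong_pow)
  then show ?thesis
    by (simp add: c_def Cong.cong_def)
qed

lemma c_one: "c 1 = 1"
proof -
  have "[c 1 * 1 = c 1 * c 1] (mod p)"
    using c_mult[of 1 1] by simp
  then have "[1 = c 1] (mod p)"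
    using c_coprime[of 1] by (simp only: cong_mult_lcancel_nat coprime_1_left)
  then have "1 mod p = c 1 mod p"
    by (simp only: Cong.cong_def)
  moreover have "c 1 mod p = c 1"
    by (rule mod_less[OF c_less])
  moreover have "1 mod p = 1"
    using p(2) by (intro mod_less) linarith
  ultimately show ?thesis
    by linarith
qed

definition ci :: "nat \<Rightarrow> nat" where "ci t = c t ^ (p - 2)"

lemma ci: "coprime t N \<Longrightarrow> [ci t * c t = 1] (mod p)"
  unfolding ci_def by (intro fermat_mult c_coprime)

lemma ci_one [simp]: "ci (Suc 0) = 1"
  using c_one by (simp add: ci_def)

section \<open>The Kummer generator and its reduced powers\<close>

definition qa :: "nat \<times> int" where
  "qa = (SOME (q, a). prime q \<and> int q dvd poly cyc.m a \<and> \<not> q dvd N \<and> \<not> int q dvd a \<and>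
     \<not> int q ^ 2 dvd a ^ N - 1 \<and> (\<forall>d. 0 < d \<longrightarrow> d < N \<longrightarrow> \<not> int q dvd a ^ d - 1))"

definition q :: nat where "q = fst qa"
definition a :: int where "a = snd qa"

lemma qa: "prime q" "int q dvd poly cyc.m a" "\<not> q dvd N" "\<not> int q dvd a"
    "\<not> int q ^ 2 dvd a ^ N - 1" "0 < d \<Longrightarrow> d < N \<Longrightarrow> \<not> int q dvd a ^ d - 1"
proof -
  have "\<exists>x. case x of (q', a') \<Rightarrow> prime q' \<and> int q' dvd poly cyc.m a' \<and> \<not> q' dvd N \<and> \<not> int q' dvd a' \<and>
     \<not> int q' ^ 2 dvd a' ^ N - 1 \<and> (\<forall>d. 0 < d \<longrightarrow> d < N \<longrightarrow> \<not> int q' dvd a' ^ d - 1)"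
  proof (rule cyc.ex_unramified_prime)
    fix q' :: nat and a' :: int
    assume "prime q'" "int q' dvd poly cyc.m a'" "\<not> q' dvd N" "\<not> int q' dvd a'"
      "\<not> int q' ^ 2 dvd a' ^ N - 1" "\<And>d. 0 < d \<Longrightarrow> d < N \<Longrightarrow> \<not> int q' dvd a' ^ d - 1"
    then show ?thesis
      by (intro exI[of _ "(q', a')"]) auto
  qed
  from someI_ex[OF this] show "prime q" "int q dvd poly cyc.m a" "\<not> q dvd N" "\<not> int q dvd a"
    "\<not> int q ^ 2 dvd a ^ N - 1" "0 < d \<Longrightarrow> d < N \<Longrightarrow> \<not> int q dvd a ^ d - 1"
    unfolding q_def a_def qa_def[symmetric] by (simp_all add: case_prod_beta)
qed

lemma a_minus_nonzero: "of_int a - \<zeta> ^ s \<noteq> 0"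
proof
  assume "of_int a - \<zeta> ^ s = 0"
  then have "of_int a ^ N = (\<zeta> ^ s) ^ N"
    by simp
  also have "\<dots> = (\<zeta> ^ N) ^ s"
    by (simp add: mult.commute flip: power_mult)
  finally have "of_int (a ^ N) = (1::complex)"
    by (simp add: cyc.\<zeta>)
  then have "a ^ N = 1"
    using of_int_eq_1_iff by blast
  \<comment> \<open>\<open>q ^ 2\<close> would divide \<open>a ^ N - 1 = 0\<close>.\<close>
  then show False
    using qa(5) by simp
qed

text \<open>The root is chosen once for each complex number, so that \<open>b s\<close> depends on
  \<open>\<zeta> ^ s\<close> alone and thus only on \<open>s\<close> modulo
  \<open>N\<close>.\<close>

definition rt :: "complex \<Rightarrow> complex" where "rt z = (SOME w. w ^ p = z)"
definition b :: "nat \<Rightarrow> complex" where "b s = rt (of_int a - \<zeta> ^ s)"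

lemma rt: "rt z ^ p = z"
  unfolding rt_def by (rule someI_ex[OF nth_root_exists[OF p_pos]])

lemma b_power: "b s ^ p = of_int a - \<zeta> ^ s"
  by (simp add: b_def rt)

lemma b_nonzero: "b s \<noteq> 0"
  using b_power[of s] a_minus_nonzero[of s] p_pos by (auto simp: power_0_left)

lemma b_cong: "[s = t] (mod N) \<Longrightarrow> b s = b t"
  by (simp add: b_def cyc.power_cong)

text \<open>Reducing the exponents modulo \<open>p\<close> makes \<open>B\<close> periodic in
  \<open>j\<close>; \<open>K\<close> collects the full \<open>p\<close>-th powers that are split off
  and lie in the field of \<open>\<zeta>\<close>.\<close>

definition B :: "nat \<Rightarrow> complex" where "B j = (\<Prod>s\<in>G. b s ^ ((j * c s) mod p))"
definition K :: "nat \<Rightarrow> rat poly" where "K j = (\<Prod>s\<in>G. ([:of_int a:] - monom 1 s) ^ ((j * c s) div p))"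
definition \<Theta> :: "rat poly" where "\<Theta> = (\<Prod>s\<in>G. ([:of_int a:] - monom 1 s) ^ c s)"

abbreviation cev :: "rat poly \<Rightarrow> complex \<Rightarrow> complex" where "cev g z \<equiv> poly (complex_poly g) z"

lemma cev_prod: "cev (\<Prod>s\<in>G. ([:of_int a:] - monom 1 s) ^ f s) w = (\<Prod>s\<in>G. (of_int a - w ^ s) ^ f s)"
  by (simp add: cpoly.map_prod cpoly.map_power cpoly.map_diff rat.map_poly_pCons' rat.map_poly_monom'
      poly_prod poly_monom)

lemma B_cong: "[j = k] (mod p) \<Longrightarrow> B j = B k"
proof -
  assume "[j = k] (mod p)"
  then have "(j * x) mod p = (k * x) mod p" for x
    using cong_mult[OF _ cong_refl] unfolding Cong.cong_def by blast
  then show ?thesis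
    by (simp add: B_def)
qed

lemma reindex_G: "coprime t N \<Longrightarrow> (\<Prod>s\<in>G. f s) = (\<Prod>s\<in>G. f ((s * t) mod N))"
  using prod.reindex_bij_betw[OF G_times_bij, of t f] by simp

lemma c_ci_cancel:
  assumes "s \<in> G" "coprime t N"
  shows "[j * ci t * c ((s * t) mod N) = j * c s] (mod p)"
proof -
  have s: "coprime s N"
    using assms(1) by (rule G_coprime)
  have "coprime (s * t) N"
    using assms(2) s by simp
  then have "c ((s * t) mod N) = c (s * t)"
    using c_cong[of "s * t" "(s * t) mod N"] by (simp add: Cong.cong_def)
  then have "[j * ci t * c ((s * t) mod N) = j * ci t * (c s * c t)] (mod p)"
    using c_mult[OF s assms(2)] by (simp add: cong_scalar_left)
  also have "j * ci t * (c s * c t) = j * c s * (ci t * c t)"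
    by (simp add: mult_ac)
  also have "[\<dots> = j * c s * 1] (mod p)"
    by (intro cong_mult cong_refl ci assms(2))
  finally show ?thesis
    by simp
qed

text \<open>The right side is \<open>B j\<close> with each \<open>\<zeta> ^ s\<close> moved to
  \<open>\<zeta> ^ (s * t)\<close>. Reindexing by \<open>s * t\<close> multiplies the exponent by
  \<open>c t\<close>, which \<open>ci t\<close> cancels.\<close>

lemma B_ci:
  assumes "coprime t N"
  shows "B (j * ci t) = (\<Prod>s\<in>G. b (s * t) ^ ((j * c s) mod p))"
proof -
  have "B (j * ci t) = (\<Prod>s\<in>G. b ((s * t) mod N) ^ ((j * ci t * c ((s * t) mod N)) mod p))"
    unfolding B_def by (rule reindex_G[OF assms])
  also have "\<dots> = (\<Prod>s\<in>G. b (s * t) ^ ((j * c s) mod p))"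
  proof (rule prod.cong[OF refl])
    fix s assume s: "s \<in> G"
    have "b ((s * t) mod N) = b (s * t)"
      by (rule b_cong) simp
    then show "b ((s * t) mod N) ^ ((j * ci t * c ((s * t) mod N)) mod p) = b (s * t) ^ ((j * c s) mod p)"
      using c_ci_cancel[OF s assms, of j] by (simp add: Cong.cong_def)
  qed
  finally show ?thesis .
qed

text \<open>Division with remainder of the exponents \<open>j * c s\<close> by \<open>p\<close>, as
  \<open>b (s * t) ^ p\<close> is the value of \<open>a - X ^ s\<close> at
  \<open>\<zeta> ^ t\<close>.\<close>

lemma B_times_K:
  assumes "coprime t N"
  shows "B (j * ci t) * cev (K j) (\<zeta> ^ t) = B (ci t) ^ j"
proof -
  have "B (ci t) = (\<Prod>s\<in>G. b (s * t) ^ c s)"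
    using B_ci[OF assms, of 1] c_less by simp
  then have "B (ci t) ^ j = (\<Prod>s\<in>G. b (s * t) ^ (j * c s))"
    by (simp add: prod_power_distrib mult.commute flip: power_mult)
  also have "\<dots> = (\<Prod>s\<in>G. b (s * t) ^ ((j * c s) mod p) * (of_int a - (\<zeta> ^ t) ^ s) ^ ((j * c s) div p))"
  proof (rule prod.cong[OF refl])
    fix s
    have "(of_int a - (\<zeta> ^ t) ^ s) = b (s * t) ^ p"
      by (simp add: b_power mult.commute flip: power_mult)
    then have "b (s * t) ^ ((j * c s) mod p) * (of_int a - (\<zeta> ^ t) ^ s) ^ ((j * c s) div p) =
        b (s * t) ^ (p * ((j * c s) div p) + (j * c s) mod p)"
      by (simp only: power_add power_mult mult.commute)
    then show "b (s * t) ^ (j * c s) = b (s * t) ^ ((j * c s) mod p) * (of_int a - (\<zeta> ^ t) ^ s) ^ ((j * c s) div p)"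
      by (simp only: mult_div_mod_eq)
  qed
  also have "\<dots> = B (j * ci t) * cev (K j) (\<zeta> ^ t)"
    by (simp add: B_ci[OF assms] K_def cev_prod prod.distrib)
  finally show ?thesis
    by simp
qed

lemma B_power_p: "coprime t N \<Longrightarrow> B (ci t) ^ p = cev \<Theta> (\<zeta> ^ t)"
proof -
  assume t: "coprime t N"
  have "K p = \<Theta>"
    using p_pos by (simp add: K_def \<Theta>_def)
  moreover have "B (p * ci t) = 1"
    by (simp add: B_def mult.assoc)
  ultimately show ?thesis
    using B_times_K[OF t, of p] by simp
qed

lemma B_nonzero: "B j \<noteq> 0"
  by (simp add: B_def finite_G b_nonzero)

lemma cev_conjugate:
  assumes "cev g \<zeta> = 0" "t > 0" "coprime t N"
  shows "cev g (\<zeta> ^ t) = 0"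
  using rat_conjugate_power[OF N(2) cyc.\<zeta>(1) assms(3,2,1)] .

lemma cev_inverse: "cev h \<zeta> \<noteq> 0 \<Longrightarrow> \<exists>k. cev k \<zeta> * cev h \<zeta> = 1"
proof -
  assume h: "cev h \<zeta> \<noteq> 0"
  have nz: "monom 1 N - 1 \<noteq> (0 :: rat poly)"
  proof
    assume "monom 1 N - 1 = (0 :: rat poly)"
    then have "coeff (monom 1 N - 1 :: rat poly) N = 0"
      by simp
    then show False
      using N(2) by simp
  qed
  have "cev (monom 1 N - 1) \<zeta> = 0"
    by (simp add: cpoly.map_diff rat.map_poly_monom' poly_monom cyc.\<zeta>)
  from algebraic_inverse_is_poly[OF nz this h] show ?thesis .
qed

text \<open>The inverse of \<open>K j\<close> at \<open>\<zeta>\<close> is taken as a polynomial, so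
  that its conjugates arise by substitution.\<close>

definition V :: "nat \<Rightarrow> rat poly" where "V j = (SOME k. cev k \<zeta> * cev (K j) \<zeta> = 1)"

lemma V:
  assumes "t > 0" "coprime t N"
  shows "cev (V j) (\<zeta> ^ t) * cev (K j) (\<zeta> ^ t) = 1"
proof -
  have "cev (K j) \<zeta> \<noteq> 0"
    using a_minus_nonzero finite_G by (simp add: K_def cev_prod)
  then have "cev (V j) \<zeta> * cev (K j) \<zeta> = 1"
    unfolding V_def by (rule someI_ex[OF cev_inverse])
  then have "cev (V j * K j - 1) \<zeta> = 0"
    by (simp add: cpoly.map_diff cpoly.map_mult)
  then have "cev (V j * K j - 1) (\<zeta> ^ t) = 0"
    using assms by (rule cev_conjugate)
  then show ?thesis
    by (simp add: cpoly.map_diff cpoly.map_mult)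
qed

text \<open>The coefficient polynomial \<open>V j\<close> does not depend on \<open>t\<close>, so
  replacing \<open>\<zeta>\<close> by \<open>\<zeta> ^ t\<close> and \<open>\<beta>\<close> by
  \<open>B (ci t)\<close> takes every \<open>B j\<close> to another one.\<close>

lemma B_eq:
  assumes "t > 0" "coprime t N"
  shows "B (j * ci t) = cev (V j) (\<zeta> ^ t) * B (ci t) ^ j"
proof -
  have "cev (V j) (\<zeta> ^ t) * B (ci t) ^ j = B (j * ci t) * (cev (V j) (\<zeta> ^ t) * cev (K j) (\<zeta> ^ t))"
    unfolding B_times_K[OF assms(2), symmetric] by (simp only: mult_ac)
  then show ?thesis
    by (simp only: V[OF assms] mult_1_right)
qed

definition \<beta> :: complex where "\<beta> = B 1"
definition \<theta> :: complex where "\<theta> = cev \<Theta> \<zeta>"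

lemma \<beta>_power: "\<beta> ^ p = \<theta>"
  using B_power_p[of 1] by (simp add: \<beta>_def \<theta>_def)

text \<open>The exponent at \<open>s = 1\<close> is \<open>c 1 = 1\<close>, which \<open>p\<close>
  does not divide.\<close>

lemma \<theta>_not_power: "cev g \<zeta> ^ p \<noteq> \<theta>"
proof -
  have "G \<subseteq> {1..<N}"
    by (auto simp: G_def)
  moreover have "\<not> p dvd c 1"
    unfolding c_one using p by simp
  ultimately show ?thesis
    using cyc.conjugate_product_not_power[OF qa, of G p c g] one_G p_pos
    by (simp add: \<theta>_def \<Theta>_def cev_prod)
qed

lemma linear_independence:
  assumes "(\<Sum>j<p. cev (r j) \<zeta> * \<beta> ^ j) = 0" "j < p"
  shows "cev (r j) \<zeta> = 0"
proof -
  \<comment> \<open>This is the field generated by \<open>\<zeta>\<close>; closure under inverses is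
    \<open>cev_inverse\<close>.\<close>
  define M where "M = range (\<lambda>g. cev g \<zeta>)"
  define P where "P = (\<Sum>j<p. monom (cev (r j) \<zeta>) j)"
  have P: "coeff P k = (if k < p then cev (r k) \<zeta> else 0)" for k
    by (simp add: P_def coeff_sum)
  have zero: "0 \<in> M"
    unfolding M_def by (rule range_eqI[of _ _ 0]) simp
  have "P = 0"
  proof (rule radical_linearly_independent[where M = M and p = p and \<theta> = \<theta> and \<beta> = \<beta>])
    show "0 \<in> M"
      by (rule zero)
    show "1 \<in> M"
      unfolding M_def by (rule range_eqI[of _ _ 1]) simp
    show "x + y \<in> M" "x * y \<in> M" if "x \<in> M" "y \<in> M" for x y
      using that unfolding M_def
      by (auto simp flip: cpoly.map_add cpoly.map_mult poly_add poly_mult)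
    show "- x \<in> M" if "x \<in> M" for x
      using that unfolding M_def by (auto simp flip: cpoly.map_uminus poly_minus)
    show "inverse x \<in> M" if x: "x \<in> M" for x
    proof (cases "x = 0")
      case False
      then obtain k h where "cev k \<zeta> * cev h \<zeta> = 1" "x = cev h \<zeta>"
        using cev_inverse x unfolding M_def by blast
      then have "inverse x = cev k \<zeta>"
        using inverse_unique[of x "cev k \<zeta>"] by (simp add: mult.commute)
      then show ?thesis
        by (simp add: M_def)
    qed (simp add: zero)
    show "\<theta> \<in> M" "\<And>x. x \<in> M \<Longrightarrow> x ^ p \<noteq> \<theta>"
      using \<theta>_not_power by (auto simp: M_def \<theta>_def)
    show "\<theta> \<noteq> 0"
      using \<beta>_power B_nonzero[of 1] by (auto simp: \<beta>_def)
    show "coeff P k \<in> M" for k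
      using zero by (simp add: P M_def)
    show "degree P < p"
      using p_pos by (intro degree_lessI) (auto simp: P)
    show "poly P \<beta> = 0"
      using assms(1) by (simp add: P_def poly_sum poly_monom)
  qed (use p odd_p \<beta>_power in auto)
  then have "coeff P j = 0"
    by simp
  then show ?thesis
    using assms(2) by (simp add: P)
qed

section \<open>Automorphisms of the Kummer extension as evaluations\<close>

definition \<zeta>p :: complex where "\<zeta>p = \<zeta> ^ (N div p)"

lemma \<zeta>p_eq_one_iff: "\<zeta>p ^ k = 1 \<longleftrightarrow> p dvd k"
proof -
  obtain d where d: "N = p * d"
    using N(1) ..
  then have "d > 0" "N div p = d"
    using N(2) p_pos by simp_all
  then have "\<zeta>p ^ k = \<zeta> ^ (d * k)"
    by (simp add: \<zeta>p_def power_mult)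
  then have "\<zeta>p ^ k = 1 \<longleftrightarrow> p * d dvd d * k"
    by (simp only: cyc.power_eq_one_iff d[symmetric])
  also have "\<dots> \<longleftrightarrow> p dvd k"
    using \<open>d > 0\<close> by (simp add: mult.commute[of p])
  finally show ?thesis .
qed

lemma \<zeta>p_cong: "[j = k] (mod p) \<Longrightarrow> \<zeta>p ^ j = \<zeta>p ^ k"
proof -
  have "\<zeta>p ^ k = \<zeta>p ^ (k mod p)" for k
  proof -
    have "\<zeta>p ^ k = (\<zeta>p ^ p) ^ (k div p) * \<zeta>p ^ (k mod p)"
      by (simp flip: power_mult power_add)
    then show ?thesis
      using \<zeta>p_eq_one_iff[of p] by simp
  qed
  then show "[j = k] (mod p) \<Longrightarrow> \<zeta>p ^ j = \<zeta>p ^ k"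
    unfolding Cong.cong_def by metis
qed

definition \<Gamma> :: "(nat \<times> nat) set" where "\<Gamma> = G \<times> {..<p}"

text \<open>
  \<open>(t, i)\<close> stands for the automorphism that maps \<open>\<zeta>\<close> to \<open>\<zeta> ^ t\<close> and \<open>\<beta> = B 1\<close> to \<open>\<zeta>p ^ i * B (ci t)\<close>. By
  \<open>B_eq\<close> the automorphism \<open>(t, 0)\<close> maps every \<open>B j\<close> to \<open>B (j * ci t)\<close>, which is what splits the extension.
\<close>

definition ev :: "nat \<times> nat \<Rightarrow> rat poly poly \<Rightarrow> complex" where
  "ev = (\<lambda>(t, i) r. poly (map_poly (\<lambda>g. cev g (\<zeta> ^ t)) r) (\<zeta>p ^ i * B (ci t)))"

lemma ring_map_ev: "ring_map (ev \<gamma>)"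
  unfolding ev_def case_prod_beta
  by (intro ring_map_eval cpoly.ring_map_comp ring_map_poly)

lemma ring_map_cev: "ring_map (\<lambda>g. cev g w)"
  by (intro cpoly.ring_map_comp ring_map_poly)

lemma ev_e: "ev (1, 0) r = poly (map_poly (\<lambda>g. cev g \<zeta>) r) \<beta>"
  by (simp add: ev_def \<beta>_def)

lemma ev_sum:
  assumes "degree r < p"
  shows "ev (t, i) r = (\<Sum>j<p. cev (coeff r j) (\<zeta> ^ t) * (\<zeta>p ^ i * B (ci t)) ^ j)"
proof -
  interpret ring_map "\<lambda>g. cev g (\<zeta> ^ t)"
    by (rule ring_map_cev)
  have "degree (map_poly (\<lambda>g. cev g (\<zeta> ^ t)) r) < p"
    using assms by (rule le_less_trans[OF map_poly_degree_leq])
  then show ?thesis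
    by (simp add: ev_def poly_eq_sum_lessThan coeff_map_poly')
qed

text \<open>Every \<open>ev \<gamma>\<close> with \<open>\<gamma>\<close> in \<open>\<Gamma>\<close>
  kills the monic polynomial \<open>X ^ p - \<Theta>\<close>, because \<open>B (ci t) ^ p\<close> is
  the value of \<open>\<Theta>\<close> at \<open>\<zeta> ^ t\<close>.\<close>

lemma ev_reduce:
  "\<exists>R. degree R < p \<and> (\<forall>\<gamma>\<in>\<Gamma>. ev \<gamma> r = ev \<gamma> R)"
proof -
  define T where "T = monom 1 p - [:\<Theta>:]"
  have degT: "degree T = p"
    unfolding T_def diff_conv_add_uminus
    using degree_add_eq_left[of "- [:\<Theta>:]" "monom (1 :: rat poly) p"] p_pos
    by (simp only: degree_minus degree_pCons_0 degree_monom_eq one_neq_zero not_False_eq_True)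
  then have "lead_coeff T = 1"
    using p_pos by (simp add: T_def coeff_pCons split: nat.split)
  then obtain Q R where QR: "r = T * Q + R" "degree R < p"
    using monic_division'[of T r] degT p_pos by metis
  have "ev \<gamma> T = 0" if \<gamma>: "\<gamma> \<in> \<Gamma>" for \<gamma>
  proof -
    obtain t i where ti: "\<gamma> = (t, i)" "coprime t N"
      using \<gamma> by (auto simp: \<Gamma>_def G_def)
    interpret h: ring_map "\<lambda>g. cev g (\<zeta> ^ t)"
      by (rule ring_map_cev)
    interpret H: ring_map "map_poly (\<lambda>g. cev g (\<zeta> ^ t))"
      by (rule h.ring_map_map_poly)
    have "ev \<gamma> T = (\<zeta>p ^ i * B (ci t)) ^ p - cev \<Theta> (\<zeta> ^ t)"
      by (simp add: ev_def ti T_def H.map_diff h.map_poly_monom' h.map_poly_pCons' poly_monom)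
    also have "(\<zeta>p ^ i * B (ci t)) ^ p = (\<zeta>p ^ p) ^ i * cev \<Theta> (\<zeta> ^ t)"
      by (simp add: power_mult_distrib B_power_p ti(2) mult.commute flip: power_mult)
    also have "\<zeta>p ^ p = 1"
      by (simp add: \<zeta>p_eq_one_iff)
    finally show ?thesis
      by simp
  qed
  then have "ev \<gamma> r = ev \<gamma> R" if "\<gamma> \<in> \<Gamma>" for \<gamma>
    using that by (simp add: QR(1) ring_map.map_add[OF ring_map_ev] ring_map.map_mult[OF ring_map_ev])
  with QR(2) show ?thesis
    by blast
qed

lemma e_\<Gamma>: "(1, 0) \<in> \<Gamma>"
  using one_G p_pos by (simp add: \<Gamma>_def)

text \<open>A reduced representative of 0 has coefficients vanishing at \<open>\<zeta>\<close> by
  linear independence, and these vanish at \<open>\<zeta> ^ t\<close> too.\<close>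

lemma ev_zero:
  assumes "\<gamma> \<in> \<Gamma>" "ev (1, 0) r = 0"
  shows "ev \<gamma> r = 0"
proof -
  obtain R where R: "degree R < p" "\<And>\<gamma>. \<gamma> \<in> \<Gamma> \<Longrightarrow> ev \<gamma> r = ev \<gamma> R"
    using ev_reduce by blast
  obtain t i where ti: "\<gamma> = (t, i)" "t > 0" "coprime t N"
    using assms(1) by (auto simp: \<Gamma>_def G_def)
  have "(\<Sum>j<p. cev (coeff R j) \<zeta> * \<beta> ^ j) = 0"
    using ev_sum[OF R(1), of 1 0] R(2)[OF e_\<Gamma>] assms(2) by (simp add: \<beta>_def)
  then have "cev (coeff R j) \<zeta> = 0" if "j < p" for j
    using that by (rule linear_independence)
  then have "cev (coeff R j) (\<zeta> ^ t) = 0" if "j < p" for j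
    using cev_conjugate that ti by blast
  then show ?thesis
    using R(2)[OF assms(1)] ev_sum[OF R(1)] by (simp add: ti)
qed

text \<open>The pair \<open>(1, 1)\<close> multiplies the coefficient of \<open>\<beta> ^ j\<close>
  by \<open>\<zeta>p ^ j\<close>, so invariance kills it for \<open>0 < j < p\<close>. Invariance
  under the pairs \<open>(t, 0)\<close> makes the remaining constant coefficient rational.\<close>

lemma ev_invariant:
  assumes "\<And>\<gamma>. \<gamma> \<in> \<Gamma> \<Longrightarrow> ev \<gamma> r = ev (1, 0) r"
  shows "ev (1, 0) r \<in> \<rat>"
proof -
  obtain R where R: "degree R < p" "\<And>\<gamma>. \<gamma> \<in> \<Gamma> \<Longrightarrow> ev \<gamma> r = ev \<gamma> R"
    using ev_reduce by blast
  have inv: "ev \<gamma> R = ev (1, 0) R" if "\<gamma> \<in> \<Gamma>" for \<gamma>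
    using assms R(2) that e_\<Gamma> by metis
  have zero: "cev (coeff R j) \<zeta> = 0" if j: "j < p" "j > 0" for j
  proof -
    have "(1, 1) \<in> \<Gamma>"
      using one_G p(2) by (simp add: \<Gamma>_def)
    then have "(\<Sum>j<p. cev (coeff R j) \<zeta> * (\<zeta>p * \<beta>) ^ j) = (\<Sum>j<p. cev (coeff R j) \<zeta> * \<beta> ^ j)"
      using inv[of "(1, 1)"] ev_sum[OF R(1), of 1 0] ev_sum[OF R(1), of 1 1]
      by (simp add: \<beta>_def)
    then have "(\<Sum>j<p. cev (coeff R j) \<zeta> * (\<zeta>p ^ j - 1) * \<beta> ^ j) = 0"
      by (simp add: power_mult_distrib algebra_simps sum_subtractf)
    \<comment> \<open>\<open>\<zeta>p\<close> is a power of \<open>\<zeta>\<close>, so the factor is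
      absorbed into the coefficient polynomial, as \<open>linear_independence\<close>
      demands.\<close>
    moreover have "cev (coeff R j * (monom 1 (N div p * j) - 1)) \<zeta> = cev (coeff R j) \<zeta> * (\<zeta>p ^ j - 1)" for j
      by (simp add: cpoly.map_mult cpoly.map_diff rat.map_poly_monom' poly_monom \<zeta>p_def power_mult)
    ultimately have "(\<Sum>j<p. cev (coeff R j * (monom 1 (N div p * j) - 1)) \<zeta> * \<beta> ^ j) = 0"
      by simp
    then have "cev (coeff R j * (monom 1 (N div p * j) - 1)) \<zeta> = 0"
      using j(1) by (rule linear_independence)
    then have "cev (coeff R j) \<zeta> * (\<zeta>p ^ j - 1) = 0"
      by (simp add: cpoly.map_mult cpoly.map_diff rat.map_poly_monom' poly_monom \<zeta>p_def power_mult)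
    moreover have "\<zeta>p ^ j \<noteq> 1"
      using j by (auto simp: \<zeta>p_eq_one_iff dest: dvd_imp_le)
    ultimately show ?thesis
      by simp
  qed
  have ev_R: "ev (t, 0) R = cev (coeff R 0) (\<zeta> ^ t)" if t: "t > 0" "coprime t N" for t
  proof -
    have "cev (coeff R j) (\<zeta> ^ t) = 0" if "j < p" "j > 0" for j
      using cev_conjugate zero that t by blast
    then have "(\<Sum>j<p. cev (coeff R j) (\<zeta> ^ t) * (\<zeta>p ^ 0 * B (ci t)) ^ j) =
        (\<Sum>j\<in>{0}. cev (coeff R j) (\<zeta> ^ t) * (\<zeta>p ^ 0 * B (ci t)) ^ j)"
      using p_pos by (intro sum.mono_neutral_right) auto
    then show ?thesis
      using ev_sum[OF R(1), of t 0] by simp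
  qed
  have "cev (coeff R 0) (\<zeta> ^ t) = cev (coeff R 0) \<zeta>" if t: "t > 0" "coprime t N" for t
  proof -
    have "(t mod N, 0) \<in> \<Gamma>"
      using mod_in_G[OF t(2)] p_pos by (simp add: \<Gamma>_def)
    moreover have tm: "t mod N > 0" "coprime (t mod N) N"
      using mod_in_G[OF t(2)] by (simp_all add: G_def)
    ultimately have "cev (coeff R 0) (\<zeta> ^ (t mod N)) = cev (coeff R 0) (\<zeta> ^ 1)"
      using inv[of "(t mod N, 0)"] ev_R[OF tm] ev_R[of 1] by simp
    moreover have "\<zeta> ^ (t mod N) = \<zeta> ^ t"
      by (rule cyc.power_cong) simp
    ultimately show ?thesis
      by simp
  qed
  then have "cev (coeff R 0) \<zeta> \<in> \<rat>"
    by (rule cyc.rational_if_invariant)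
  moreover have "ev (1, 0) r = cev (coeff R 0) \<zeta>"
    using R(2)[OF e_\<Gamma>] ev_R[of 1] by simp
  ultimately show ?thesis
    by simp
qed

section \<open>The roots as resolvent sums\<close>

definition A :: "nat \<Rightarrow> rat poly poly" where
  "A k = (\<Sum>j<p. monom (monom 1 (N div p * (j * k)) * V j) j)"

text \<open>Inverse Lagrange resolvents: up to the factor \<open>p\<close>, the \<open>B j\<close>
  are the resolvents of the \<open>\<alpha> k\<close>. Scaling \<open>\<beta>\<close> by
  \<open>\<zeta>p\<close> therefore shifts \<open>k\<close>.\<close>

definition \<alpha> :: "nat \<Rightarrow> complex" where "\<alpha> k = (\<Sum>j<p. \<zeta>p ^ (j * k) * B j)"

lemma \<alpha>_cong: "[k = l] (mod p) \<Longrightarrow> \<alpha> k = \<alpha> l"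
  unfolding \<alpha>_def by (intro sum.cong refl arg_cong2[of _ _ _ _ "(*)"] \<zeta>p_cong cong_mult cong_refl)

text \<open>The pair \<open>(t, i)\<close> turns \<open>\<zeta>p ^ (j * k) * B j\<close> into
  \<open>\<zeta>p ^ (j * (t * k + i)) * B (j * ci t)\<close>. Substituting \<open>j * c t\<close>
  for \<open>j\<close> restores \<open>B j\<close> and multiplies \<open>t * k + i\<close> by
  \<open>c t\<close>; the slope becomes \<open>c t * t\<close>, which is \<open>\<chi> t\<close> by
  the choice of the twist.\<close>

lemma ev_A:
  assumes "\<gamma> \<in> \<Gamma>"
  shows "ev \<gamma> (A k) = \<alpha> (\<chi> (fst \<gamma>) * k + c (fst \<gamma>) * snd \<gamma>)"
proof -
  obtain t i where ti: "\<gamma> = (t, i)" "t > 0" "coprime t N"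
    using assms by (auto simp: \<Gamma>_def G_def)
  interpret h: ring_map "\<lambda>g. cev g (\<zeta> ^ t)"
    by (rule ring_map_cev)
  interpret H: ring_map "map_poly (\<lambda>g. cev g (\<zeta> ^ t))"
    by (rule h.ring_map_map_poly)
  have "ev \<gamma> (A k) = (\<Sum>j<p. \<zeta>p ^ (t * (j * k)) * cev (V j) (\<zeta> ^ t) * (\<zeta>p ^ i * B (ci t)) ^ j)"
  proof -
    have "(\<zeta> ^ t) ^ (N div p * x) = \<zeta>p ^ (t * x)" for x
      by (simp add: \<zeta>p_def mult_ac flip: power_mult)
    then show ?thesis
      by (simp add: ev_def ti A_def H.map_sum h.map_poly_monom' poly_sum poly_monom h.map_mult
          rat.map_poly_monom' cpoly.map_mult)
  qed
  also have "\<dots> = (\<Sum>j<p. \<zeta>p ^ (j * (t * k + i)) * B (j * ci t))"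
    by (intro sum.cong refl) (simp add: B_eq[OF ti(2,3)] power_mult_distrib algebra_simps power_add flip: power_mult)
  also have "\<dots> = (\<Sum>j<p. \<zeta>p ^ (((j * c t) mod p) * (t * k + i)) * B (((j * c t) mod p) * ci t))"
  proof -
    have "inj_on (\<lambda>j. (j * c t) mod p) {..<p}"
    proof (rule inj_onI)
      fix x y assume *: "x \<in> {..<p}" "y \<in> {..<p}" "(x * c t) mod p = (y * c t) mod p"
      then have "[x * c t = y * c t] (mod p)"
        by (simp add: Cong.cong_def)
      then have "[x = y] (mod p)"
        using c_coprime[OF ti(3)] by (simp add: cong_mult_rcancel_nat)
      then show "x = y"
        using *(1,2) by (simp add: Cong.cong_def)
    qed
    moreover have "(\<lambda>j. (j * c t) mod p) ` {..<p} \<subseteq> {..<p}"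
      using p_pos by auto
    ultimately have "bij_betw (\<lambda>j. (j * c t) mod p) {..<p} {..<p}"
      by (simp add: bij_betw_def endo_inj_surj)
    from sum.reindex_bij_betw[OF this, of "\<lambda>j. \<zeta>p ^ (j * (t * k + i)) * B (j * ci t)"] show ?thesis
      by simp
  qed
  also have "\<dots> = (\<Sum>j<p. \<zeta>p ^ (j * (\<chi> t * k + c t * i)) * B j)"
  proof (rule sum.cong[OF refl])
    fix j
    have "[((j * c t) mod p) * (t * k + i) = (j * c t) * (t * k + i)] (mod p)"
      by (intro cong_mult) simp_all
    also have "(j * c t) * (t * k + i) = j * ((c t * t) * k + c t * i)"
      by (simp add: algebra_simps)
    also have "[\<dots> = j * (\<chi> t * k + c t * i)] (mod p)"
      by (intro cong_mult cong_add cong_refl c_mult_self ti(3))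
    finally have 1: "\<zeta>p ^ (((j * c t) mod p) * (t * k + i)) = \<zeta>p ^ (j * (\<chi> t * k + c t * i))"
      by (rule \<zeta>p_cong)
    have "[((j * c t) mod p) * ci t = (j * c t) * ci t] (mod p)"
      by (intro cong_mult) simp_all
    also have "(j * c t) * ci t = j * (ci t * c t)"
      by (simp add: mult_ac)
    also have "[\<dots> = j * 1] (mod p)"
      by (intro cong_mult cong_refl ci ti(3))
    finally have "B (((j * c t) mod p) * ci t) = B j"
      by (intro B_cong) simp
    with 1 show "\<zeta>p ^ (((j * c t) mod p) * (t * k + i)) * B (((j * c t) mod p) * ci t) =
        \<zeta>p ^ (j * (\<chi> t * k + c t * i)) * B j"
      by simp
  qed
  also have "\<dots> = \<alpha> (\<chi> t * k + c t * i)"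
    by (simp add: \<alpha>_def)
  finally show ?thesis
    by (simp add: ti(1))
qed

lemma \<chi>_one: "[\<chi> 1 = 1] (mod p)"
  using c_mult_self[of 1] cong_sym unfolding c_one by simp

lemma ev_e_A: "ev (1, 0) (A k) = \<alpha> k"
proof -
  have "[\<chi> 1 * k + c 1 * 0 = 1 * k + c 1 * 0] (mod p)"
    by (intro cong_add cong_mult \<chi>_one cong_refl)
  then show ?thesis
    using \<alpha>_cong ev_A[OF e_\<Gamma>, of k] by simp
qed

text \<open>Comparison of the coefficients of \<open>\<beta>\<close> itself: \<open>V 1\<close> is
  nonzero at \<open>\<zeta>\<close>, so \<open>\<zeta>p ^ k = \<zeta>p ^ l\<close>.\<close>

lemma \<alpha>_eqD:
  assumes "\<alpha> k = \<alpha> l"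
  shows "[k = l] (mod p)"
proof -
  define r where "r j = (monom 1 (N div p * (j * k)) - monom 1 (N div p * (j * l))) * V j" for j
  have r: "cev (r j) \<zeta> = (\<zeta>p ^ (j * k) - \<zeta>p ^ (j * l)) * cev (V j) \<zeta>" for j
    by (simp add: r_def cpoly.map_mult cpoly.map_diff rat.map_poly_monom' poly_monom \<zeta>p_def power_mult)
  have "B j = cev (V j) \<zeta> * \<beta> ^ j" for j
    using B_eq[of 1 j] by (simp add: \<beta>_def)
  then have "(\<Sum>j<p. cev (r j) \<zeta> * \<beta> ^ j) = \<alpha> k - \<alpha> l"
    unfolding \<alpha>_def sum_subtractf[symmetric] by (simp add: r algebra_simps)
  then have "cev (r 1) \<zeta> = 0"
    using linear_independence[of r 1] assms p(2) by simp
  moreover have "cev (V 1) \<zeta> \<noteq> 0"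
    using V[of 1 1] by auto
  ultimately have eq: "\<zeta>p ^ k = \<zeta>p ^ l"
    by (simp add: r)
  have nz: "\<zeta>p \<noteq> 0"
    using cyc.nonzero by (simp add: \<zeta>p_def)
  have *: "[x = y] (mod p)" if "x \<le> y" "\<zeta>p ^ x = \<zeta>p ^ y" for x y
  proof -
    have "\<zeta>p ^ x * \<zeta>p ^ (y - x) = \<zeta>p ^ y"
      using \<open>x \<le> y\<close> by (simp flip: power_add)
    then have "\<zeta>p ^ (y - x) = 1"
      using that(2) nz by simp
    then have "p dvd y - x"
      by (simp add: \<zeta>p_eq_one_iff)
    then have "[y = x] (mod p)"
      using \<open>x \<le> y\<close> by (simp add: cong_altdef_nat)
    then show ?thesis
      by (rule cong_sym)
  qed
  show ?thesis
  proof (cases "k \<le> l")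
    case False
    then show ?thesis
      using cong_sym[OF *[of l k]] eq by simp
  qed (use * eq in blast)
qed

section \<open>Complex conjugation\<close>

lemma cnj_of_rat: "cnj (of_rat x) = of_rat x"
  by (cases x) (simp add: of_rat_rat)

lemma cnj_cev: "cnj (cev g z) = cev g (cnj z)"
  by (simp add: poly_cnj map_poly_map_poly o_def cnj_of_rat)

lemma cnj_\<zeta>: "cnj \<zeta> = \<zeta> ^ (N - 1)"
proof -
  have "\<zeta> ^ (N - 1) * \<zeta> = 1"
    using cyc.\<zeta>(1) N(2) by (simp only: power_minus_mult)
  moreover have "cnj \<zeta> * \<zeta> = 1"
    by (simp add: \<zeta>_def cis_cnj cis_mult)
  ultimately show ?thesis
    using cyc.nonzero by (metis mult_right_cancel)
qed

lemma minus_one_coprime: "coprime (N - 1) N"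
  using N(2) by (rule coprime_diff_one_left_nat)

lemma minus_one_G: "N - 1 \<in> G"
  using N_ge minus_one_coprime by (simp add: G_def)

text \<open>Both \<open>cnj \<beta>\<close> and \<open>B (ci (N - 1))\<close> have the conjugate of
  \<open>\<theta>\<close> as \<open>p\<close>-th power, so they differ by a power of
  \<open>\<zeta>p\<close>.\<close>

lemma ex_cnj_\<beta>: "\<exists>i<p. cnj \<beta> = \<zeta>p ^ i * B (ci (N - 1))"
proof -
  define x where "x = cnj \<beta> / B (ci (N - 1))"
  have "cnj \<beta> ^ p = cnj \<theta>"
    by (simp flip: complex_cnj_power add: \<beta>_power)
  also have "\<dots> = B (ci (N - 1)) ^ p"
    by (simp only: \<theta>_def cnj_cev cnj_\<zeta> B_power_p[OF minus_one_coprime])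
  finally have "x ^ p = 1"
    using B_nonzero by (simp add: x_def power_divide)
  then have "x \<in> (\<lambda>k. cis (2 * pi * real k / real p)) ` {..<p}"
    using bij_betw_imp_surj_on[OF bij_betw_roots_unity[OF p_pos]] by blast
  then obtain k where k: "k < p" "x = cis (2 * pi * real k / real p)"
    by blast
  obtain d where d: "N = p * d"
    using N(1) ..
  then have dN: "d > 0" "N div p = d"
    using N(2) p_pos by simp_all
  have "\<zeta>p ^ k = cis (real (d * k) * (2 * pi / real N))"
    by (simp add: \<zeta>p_def dN(2) \<zeta>_def DeMoivre mult_ac flip: power_mult)
  also have "real (d * k) * (2 * pi / real N) = 2 * pi * real k / real p"
    unfolding d using dN(1) by simp
  finally have "x = \<zeta>p ^ k"
    using k(2) by simp
  then have "cnj \<beta> = \<zeta>p ^ k * B (ci (N - 1))"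
    using B_nonzero[of "ci (N - 1)"] by (simp add: x_def field_simps)
  with k(1) show ?thesis
    by blast
qed

text \<open>Thus conjugation is one of the maps indexed by \<open>\<Gamma>\<close>, which brings it
  under \<open>ev_act\<close>.\<close>

lemma ex_cnj_ev: "\<exists>i<p. \<forall>r. cnj (ev (1, 0) r) = ev (N - 1, i) r"
proof -
  obtain i where i: "i < p" "cnj \<beta> = \<zeta>p ^ i * B (ci (N - 1))"
    using ex_cnj_\<beta> by blast
  have "cnj (ev (1, 0) r) = ev (N - 1, i) r" for r
  proof -
    have "cnj (ev (1, 0) r) = poly (map_poly cnj (map_poly (\<lambda>g. cev g \<zeta>) r)) (cnj \<beta>)"
      by (simp only: ev_e poly_cnj)
    also have "map_poly cnj (map_poly (\<lambda>g. cev g \<zeta>) r) = map_poly (\<lambda>g. cev g (\<zeta> ^ (N - 1))) r"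
      by (subst map_poly_map_poly) (simp_all add: o_def cnj_cev cnj_\<zeta>)
    finally show ?thesis
      by (simp add: ev_def i(2))
  qed
  with i(1) show ?thesis
    by blast
qed

section \<open>The action through the Frobenius group\<close>

definition act :: "nat \<times> nat \<Rightarrow> int \<Rightarrow> int" where
  "act = (\<lambda>(t, i). affine_map p (int (\<chi> t) mod int p) (int (c t * i) mod int p))"

lemma act_apply:
  assumes "k \<in> {0..int p - 1}"
  shows "act (t, i) k = int ((\<chi> t * nat k + c t * i) mod p)"
proof -
  have "act (t, i) k = ((int (\<chi> t) mod int p) * int (nat k) + int (c t * i) mod int p) mod int p"
    using assms by (simp add: act_def affine_map_apply[OF p(1) n])
  also have "\<dots> = (int (\<chi> t) * int (nat k) + int (c t * i)) mod int p"
    unfolding Cong.cong_def[symmetric] by (intro cong_add cong_mult) simp_all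
  finally show ?thesis
    by (simp add: zmod_int)
qed

lemma int_\<chi>_power: "coprime t N \<Longrightarrow> [int (\<chi> t) ^ n = 1] (mod int p)"
  using residue_characterD(3)[OF character] by (metis cong_int_iff of_nat_1 of_nat_power)

lemma act_mem: "\<gamma> \<in> \<Gamma> \<Longrightarrow> act \<gamma> \<in> carrier (frobenius_group p n)"
  using affine_mem_frobenius[OF p(1) n int_\<chi>_power] by (auto simp: \<Gamma>_def act_def G_coprime)

lemma ev_act:
  assumes "\<gamma> \<in> \<Gamma>" "k \<in> {0..int p - 1}"
  shows "ev \<gamma> (A (nat k)) = ev (1, 0) (A (nat (act \<gamma> k)))"
proof -
  obtain t i where ti: "\<gamma> = (t, i)"
    by fastforce
  have "ev (1, 0) (A (nat (act \<gamma> k))) = \<alpha> ((\<chi> t * nat k + c t * i) mod p)"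
    by (simp add: ev_e_A[unfolded One_nat_def] ti act_apply[OF assms(2)])
  also have "\<dots> = \<alpha> (\<chi> t * nat k + c t * i)"
    by (rule \<alpha>_cong) simp
  finally show ?thesis
    using ev_A[OF assms(1)] by (simp add: ti)
qed

lemma act_surj:
  assumes "\<pi> \<in> carrier (frobenius_group p n)"
  shows "\<exists>\<gamma>\<in>\<Gamma>. act \<gamma> = \<pi>"
proof -
  obtain x y where xy: "\<pi> = affine_map p x y" "[x ^ n = 1] (mod int p)"
      "x \<in> {0..int p - 1}" "y \<in> {0..int p - 1}"
    using frobenius_memE[OF p(1) n assms] by metis
  have "[int (nat x ^ n) = int 1] (mod int p)"
    using xy(2,3) by simp
  then have "[nat x ^ n = 1] (mod p)"
    by (simp only: cong_int_iff)
  then obtain s where s: "coprime s N" "[\<chi> s = nat x] (mod p)"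
    using residue_characterD(4)[OF character] by blast
  define t where "t = s mod N"
  \<comment> \<open>Solves \<open>c t * i = y\<close> modulo \<open>p\<close>.\<close>
  define i where "i = (ci t * nat y) mod p"
  have t: "t \<in> G" "coprime t N"
    using mod_in_G[OF s(1)] by (simp_all add: t_def G_coprime)
  have "[\<chi> s = \<chi> t] (mod p)"
    by (rule residue_characterD(2)[OF character s(1)]) (simp add: t_def)
  then have "[\<chi> t = nat x] (mod p)"
    using s(2) cong_sym cong_trans by blast
  then have "[int (\<chi> t) = int (nat x)] (mod int p)"
    by (simp only: cong_int_iff)
  then have "int (\<chi> t) mod int p = x"
    using xy(3) by (simp add: Cong.cong_def)
  moreover have "[c t * i = nat y] (mod p)"
  proof -
    have "[c t * i = c t * (ci t * nat y)] (mod p)"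
      unfolding i_def by (intro cong_mult cong_refl) simp
    also have "c t * (ci t * nat y) = (ci t * c t) * nat y"
      by (simp add: mult_ac)
    also have "[\<dots> = 1 * nat y] (mod p)"
      by (intro cong_mult cong_refl ci t(2))
    finally show ?thesis
      by simp
  qed
  then have "[int (c t * i) = int (nat y)] (mod int p)"
    by (simp only: cong_int_iff)
  then have "int (c t * i) mod int p = y"
    using xy(4) by (simp add: Cong.cong_def)
  ultimately have "act (t, i) = \<pi>"
    by (simp add: act_def xy(1))
  moreover have "(t, i) \<in> \<Gamma>"
    using t(1) p_pos by (simp add: \<Gamma>_def i_def)
  ultimately show ?thesis
    by blast
qed

text \<open>The affine map of conjugation has slope \<open>\<chi> (N - 1)\<close>, that is -1;
  fixing 0 and 1 would make the slope 1, impossible for \<open>p \<ge> 3\<close>.\<close>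

lemma conj_act:
  "\<exists>\<pi>\<in>carrier (frobenius_group p n). (\<exists>k\<in>{0..int p - 1}. \<pi> k \<noteq> k) \<and>
     (\<forall>k\<in>{0..int p - 1}. cnj (ev (1, 0) (A (nat k))) = ev (1, 0) (A (nat (\<pi> k))))"
proof -
  obtain i where i: "i < p" "\<And>r. cnj (ev (1, 0) r) = ev (N - 1, i) r"
    using ex_cnj_ev by blast
  have \<gamma>: "(N - 1, i) \<in> \<Gamma>"
    using minus_one_G i(1) by (simp add: \<Gamma>_def)
  have zo: "0 \<in> {0..int p - 1}" "1 \<in> {0..int p - 1}"
    using p(2) by simp_all
  have "\<exists>k\<in>{0..int p - 1}. act (N - 1, i) k \<noteq> k"
  proof (rule ccontr)
    assume "\<not> ?thesis"
    then have fixed: "act (N - 1, i) 0 = 0" "act (N - 1, i) 1 = 1"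
      using zo by blast+
    define y where "y = c (N - 1) * i"
    have "y mod p = 0" "(\<chi> (N - 1) + y) mod p = 1"
      using fixed act_apply[OF zo(1), of "N - 1" i] act_apply[OF zo(2), of "N - 1" i]
      by (simp_all add: y_def)
    then have "\<chi> (N - 1) mod p = 1"
      by (metis add.right_neutral mod_add_right_eq)
    then have "(p - 1) mod p = 1"
      using \<chi>_minus_one by (simp add: Cong.cong_def)
    then show False
      using p(2) by simp
  qed
  then show ?thesis
    using act_mem[OF \<gamma>] ev_act[OF \<gamma>] i(2) by (intro bexI[of _ "act (N - 1, i)"]) auto
qed

text \<open>The representing ring is \<open>rat poly poly\<close>: polynomials in
  \<open>\<beta>\<close> whose coefficients are polynomials in \<open>\<zeta>\<close>.\<close>

lemma frobenius_action: "frobenius_action p n \<Gamma> (1, 0) ev (\<lambda>x. [:[:x:]:]) (\<lambda>i. A (nat i)) act"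
proof (rule frobenius_action.intro)
  show "ring_map (\<lambda>x::rat. [:[:x:]:])"
    by standard (simp_all add: one_pCons)
  show "ev \<gamma> [:[:x:]:] = of_rat x" for \<gamma> x
    by (cases \<gamma>) (simp add: ev_def ring_map.map_poly_pCons'[OF ring_map_cev] rat.map_poly_pCons')
  show "inj_on (\<lambda>i. ev (1, 0) (A (nat i))) {0..int p - 1}"
  proof (rule inj_onI)
    fix x y assume *: "x \<in> {0..int p - 1}" "y \<in> {0..int p - 1}"
      "ev (1, 0) (A (nat x)) = ev (1, 0) (A (nat y))"
    then have "[nat x = nat y] (mod p)"
      using \<alpha>_eqD by (simp only: ev_e_A)
    then have "nat x = nat y"
      using *(1,2) by (simp add: Cong.cong_def nat_less_iff)
    then show "x = y"
      using *(1,2) by (subst (asm) eq_nat_nat_iff) simp_all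
  qed
  show "ev \<gamma> r = 0" if "\<gamma> \<in> \<Gamma>" "ev (1, 0) r = 0" for \<gamma> r
    using that by (rule ev_zero)
  show "ev (1, 0) r \<in> \<rat>" if "\<And>\<gamma>. \<gamma> \<in> \<Gamma> \<Longrightarrow> ev \<gamma> r = ev (1, 0) r" for r
    using that by (rule ev_invariant)
  show "ev \<gamma> (A (nat i)) = ev (1, 0) (A (nat (act \<gamma> i)))" if "\<gamma> \<in> \<Gamma>" "i \<in> {0..int p - 1}" for \<gamma> i
    using that by (rule ev_act)
qed (fact p n e_\<Gamma> act_mem act_surj conj_act | rule ring_map_ev)+

end

theorem theorem7:
  fixes p n :: nat
  assumes "prime p" and "p \<ge> 5"
    and "n > 0" and "n dvd p - 1" and "n \<noteq> 1"
    and "even (Coset.order (frobenius_group p n))"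
  shows "\<exists>f :: rat poly.
           irreducible f \<and> degree f = p \<and>
           (\<exists>z. poly (complex_poly f) z = 0 \<and> z \<notin> \<real>) \<and>
           poly_galois_group f \<cong> frobenius_group p n \<and>
           (\<forall>a b :: real.
              poly (complex_poly f) (complex_of_real a + \<i> * complex_of_real b) = 0 \<and>
              complex_of_real a + \<i> * complex_of_real b \<notin> \<real> \<longrightarrow>
              splitting_field f = rat_adjoin {complex_of_real a, \<i> * complex_of_real b})"
proof -
  have "odd p"
    using prime_odd_nat[OF assms(1)] assms(2) by linarith
  then have "even n"
    using assms(6) order_frobenius_group[OF assms(1,4)] by simp
  then obtain N \<chi> where N: "p dvd N" "N > 0" "residue_character p N n \<chi>" "[\<chi> (N - 1) = p - 1] (mod p)"
    using ex_odd_character[OF assms(1,4)] by blast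
  interpret kummer_setup p n N \<chi>
    using assms N by unfold_locales auto
  show ?thesis
    by (rule frobenius_action.realization[OF frobenius_action])
qed

end
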